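(* Let $w$ be a normalized weight, and suppose $q\in L^2(S^1,\mathbb C)$ is real-valued and its gap lengths satisfy $$\sum_{n\ge1}w_n^2|\gamma_n(q)|^2<\infty.$$ If $w$ is strictly subexponential, then $q\in\mathcal H^w$. On the other hand, if $w$ is exponential, then $q$ is real analytic.
   Context: Let $S^1=\mathbb R/\mathbb Z$. A normalized weight is a function $w:\mathbb Z\to\mathbb R$, $n\mapsto w_n=w(n)$, with $w_n=w_{-n}\ge1$ for all $n$. It is submultiplicative if $w_{n+m}\le w_nw_m$ for all $n,m$. An exponential weight is a submultiplicative normalized weight with $\liminf_{n\to\infty}\frac{\log w(n)}{n}>0$. A normalized weight is strictly subexponential if $\frac{\log w(n)}{n}\to0$ as $n\to\infty$ in an eventually monotone manner, and $w(n)$ is nondecreasing for $n\ge0$. For a 1-periodic function $q=\sum_{n\in\mathbb Z}q_ne^{2n\pi ix}$ put $\|q\|_w^2=\sum_{n\in\mathbb Z}w_n^2|q_n|^2$, and $\mathcal H^w=\{q\in L^2(S^1,\mathbb C):\|q\|_w<\infty\}$. For real $q$, the periodic eigenvalues are the eigenvalues of $L=-\frac{d^2}{dx^2}+q$ on $[0,1]$ with periodic or anti-periodic boundary conditions (both types taken together; equivalently the eigenvalues of $-\frac{d^2}{dx^2}+q$ on functions of period 2), listed with multiplicity: $\lambda_0^+(q)<\lambda_1^-(q)\le\lambda_1^+(q)<\dots<\lambda_n^-(q)\le\lambda_n^+(q)<\cdots$. The gap lengths are $\gamma_n(q)=\lambda_n^+(q)-\lambda_n^-(q)$, $n\ge1$.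 "Real analytic" for an $L^2$-function means that it agrees almost everywhere with a real analytic function on $S^1$. *)

theory Defs
  imports "HOL-Analysis.Analysis" "HOL-Library.Function_Algebras"
begin

definition normalized_weight :: "(int \<Rightarrow> real) \<Rightarrow> bool" where
  "normalized_weight w \<longleftrightarrow> (\<forall>n. w n = w (- n) \<and> w n \<ge> 1)"

definition submultiplicative :: "(int \<Rightarrow> real) \<Rightarrow> bool" where
  "submultiplicative w \<longleftrightarrow> (\<forall>n m. w (n + m) \<le> w n * w m)"

definition exponential_weight :: "(int \<Rightarrow> real) \<Rightarrow> bool" where
  "exponential_weight w \<longleftrightarrow> normalized_weight w \<and> submultiplicative w \<and>
     liminf (\<lambda>n. ereal (ln (w (int n)) / real n)) > 0"

definition strictly_subexponential_weight :: "(int \<Rightarrow> real) \<Rightarrow> bool" where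
  "strictly_subexponential_weight w \<longleftrightarrow> normalized_weight w \<and>
     (\<lambda>n. ln (w (int n)) / real n) \<longlonglongrightarrow> 0 \<and>
     (\<exists>N. mono_on {N..} (\<lambda>n. ln (w (int n)) / real n) \<or>
          antimono_on {N..} (\<lambda>n. ln (w (int n)) / real n)) \<and>
     mono_on {0..} w"

definition square_integrable_on :: "(real \<Rightarrow> complex) \<Rightarrow> real set \<Rightarrow> bool" where
  "square_integrable_on g S \<longleftrightarrow>
     g \<in> borel_measurable (lebesgue_on S) \<and>
     integrable (lebesgue_on S) (\<lambda>x. (cmod (g x))\<^sup>2)"

text \<open>Elements of the complex $L^2$-space of the circle $\mathbb R/\mathbb Z$ are represented by
  1-periodic functions on the line, without passing to classes modulo null sets; every notion
  below depends only on the class of \<open>q\<close>.\<close>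

definition L2_circle :: "(real \<Rightarrow> complex) set" where
  "L2_circle = {q. (\<forall>x. q (x + 1) = q x) \<and> square_integrable_on q {0..1}}"

definition fourier_coeff :: "(real \<Rightarrow> complex) \<Rightarrow> int \<Rightarrow> complex" where
  "fourier_coeff q n =
     (LINT x|lebesgue_on {0..1}. q x * exp (- (2 * of_int n * of_real pi * \<i> * of_real x)))"

definition H_weighted :: "(int \<Rightarrow> real) \<Rightarrow> (real \<Rightarrow> complex) set" where
  "H_weighted w =
     {q \<in> L2_circle. (\<lambda>n. (w n)\<^sup>2 * (cmod (fourier_coeff q n))\<^sup>2) summable_on UNIV}"

text \<open>The solutions of period 2 of $-f'' + qf = \mu f$ in the Sobolev space $H^2$ of the circle
  $\mathbb R/2\mathbb Z$: \<open>f\<close> is continuously differentiable, \<open>f1\<close> is its derivative, which is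
  an indefinite integral of the square-integrable function \<open>g\<close>, and the equation holds almost
  everywhere with $f'' = g$. This is the sum of the eigenspaces for periodic and for anti-periodic
  boundary conditions on $[0,1]$.\<close>

definition hill_eigenspace :: "(real \<Rightarrow> complex) \<Rightarrow> complex \<Rightarrow> (real \<Rightarrow> complex) set" where
  "hill_eigenspace q \<mu> = {f. (\<forall>x. f (x + 2) = f x) \<and>
     (\<exists>f1 g. (\<forall>x. (f has_vector_derivative f1 x) (at x)) \<and>
        square_integrable_on g {0..2} \<and>
        (\<forall>a b. a \<le> b \<longrightarrow> (g has_integral (f1 b - f1 a)) {a..b}) \<and>
        (AE x in lebesgue. - g x + q x * f x = \<mu> * f x))}"

abbreviation scale_fun :: "complex \<Rightarrow> (real \<Rightarrow> complex) \<Rightarrow> real \<Rightarrow> complex" where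
  "scale_fun c f \<equiv> (\<lambda>x. c * f x)"

lemma vector_space_scale_fun: "vector_space scale_fun"
  by unfold_locales (auto simp: fun_eq_iff algebra_simps)

text \<open>The complex dimension of the eigenspace. It is at most 2, so that the value 0 of
  \<open>dim\<close> on infinite-dimensional spaces plays no role; by self-adjointness for real \<open>q\<close>,
  geometric and algebraic multiplicities agree.\<close>

definition hill_multiplicity :: "(real \<Rightarrow> complex) \<Rightarrow> real \<Rightarrow> nat" where
  "hill_multiplicity q \<mu> = vector_space.dim scale_fun (hill_eigenspace q (of_real \<mu>))"

text \<open>The sequence \<open>lam\<close> is the nondecreasing list, with multiplicities, of the periodic
  eigenvalues of a real potential \<open>q\<close> (all of which are real). It is uniquely determined by
  \<open>q\<close>. In the customary notation it reads
  $\lambda_0^+, \lambda_1^-, \lambda_1^+, \lambda_2^-, \lambda_2^+, \dots$; thus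
  $\lambda_n^- =$ \<open>lam (2 * n - 1)\<close> and $\lambda_n^+ =$ \<open>lam (2 * n)\<close>.
  The strict inequalities $\lambda_{n-1}^+ < \lambda_n^-$ are a property of this list and are not
  part of the definition.\<close>

definition periodic_eigenvalue_list :: "(real \<Rightarrow> complex) \<Rightarrow> (nat \<Rightarrow> real) \<Rightarrow> bool" where
  "periodic_eigenvalue_list q lam \<longleftrightarrow> mono lam \<and>
     (\<forall>\<mu>. finite {k. lam k = \<mu>} \<and> card {k. lam k = \<mu>} = hill_multiplicity q \<mu>)"

definition gap_length :: "(nat \<Rightarrow> real) \<Rightarrow> nat \<Rightarrow> real" where
  "gap_length lam n = lam (2 * n) - lam (2 * n - 1)"

definition real_analytic_circle :: "(real \<Rightarrow> complex) \<Rightarrow> bool" where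
  "real_analytic_circle g \<longleftrightarrow> (\<forall>x. g (x + 1) = g x) \<and>
     (\<forall>x0. \<exists>r>0. \<exists>a :: nat \<Rightarrow> complex. \<forall>x. \<bar>x - x0\<bar> < r \<longrightarrow>
        (\<lambda>n. a n * of_real (x - x0) ^ n) sums g x)"

end

(*
The eigenvalue equation is studied on Fourier coefficients of period 2 by a Lyapunov-Schmidt
reduction.  For a large n and l in the n-th "tile" [((n - 1/2) pi)^2, ((n + 1/2) pi)^2] the modes
other than n and -n are eliminated by a bounded solution Y of an infinite linear system, and l is an
eigenvalue iff a Hermitian 2x2 matrix with off-diagonal entry c_n(l) = q_n + O(1/n) is singular.
Its two roots r1 <= r2 satisfy |c_n(r2)| <= r2 - r1.

The tiles cover a neighbourhood of infinity and each of them contains exactly two eigenvalues, so the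
gaps of the list are the differences r2 - r1 up to a shift of the index, provided that the number
of eigenvalues below the first tile is odd; were it even, the gaps would tend to infinity.  Hence
the numbers c_n(r2) lie in the weighted sequence space, a shift of the index being harmless.

It remains to pass from c_n to q_n.  For a weight v with v(a + b) <= K v(a) v(b) the reduced
system gives v(n) |q_n| <= v(n) |c_n| + C ||q||_v^2 / n, provided ||q||_v is small compared with n.
This is applied to the bounded weights v = min(w, exp(e |m|), J): their norm of q is continuous in e,
equals the L^2-norm at e = 0, and by the estimate it omits a whole interval of values, whence it
stays bounded uniformly in J for all small e.
*)

theory Submission
  imports Defs
begin

section \<open>Infinite systems of linear equations\<close>

text \<open>The quadratic bound presupposes a weighted norm of \<open>q\<close> that is finite and
  small against \<open>n\<close>, which is the very thing to be proved. To break the circle, the cap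
  \<open>J\<close> makes the norm finite from the outset, and \<open>exp (e * |m|)\<close> joins the
  weight 1, whose norm is known, to the wanted one. The threshold beyond which the bound is applied
  is fixed by the omitted interval of norms, not by \<open>e\<close> or \<open>J\<close>. Smallness
  of \<open>e\<close> serves the finitely many modes below the threshold, whose squares may grow by
  at most a factor 2. A minimum of submultiplicative weights need not be submultiplicative. What
  survives minima is a nondecreasing logarithm whose quotient by \<open>n\<close> is nonincreasing
  from some \<open>N\<close> on, and this still gives the inequality up to a constant. Hence the
  monotonicity built into subexponential weights; an exponential weight is first replaced by a pure
  exponential below a multiple of it. The outcome is a finite norm for
  \<open>min w (exp (e * |m|))\<close>. For a subexponential \<open>w\<close> this is
  \<open>w\<close> far out, so nothing is lost; for an exponential weight some positive rate
  remains, hence analyticity.\<close>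

lemma infsum_Cauchy_Schwarz:
  fixes f g :: "'a \<Rightarrow> real"
  assumes nn: "\<And>x. f x \<ge> 0" "\<And>x. g x \<ge> 0"
    and f: "(\<lambda>x. (f x)\<^sup>2) summable_on A" and g: "(\<lambda>x. (g x)\<^sup>2) summable_on A"
  shows "(\<lambda>x. f x * g x) summable_on A"
    and "(\<Sum>\<^sub>\<infinity>x\<in>A. f x * g x) \<le> sqrt (\<Sum>\<^sub>\<infinity>x\<in>A. (f x)\<^sup>2) * sqrt (\<Sum>\<^sub>\<infinity>x\<in>A. (g x)\<^sup>2)"
proof -
  have fin: "(\<Sum>x\<in>F. f x * g x) \<le> sqrt (\<Sum>\<^sub>\<infinity>x\<in>A. (f x)\<^sup>2) * sqrt (\<Sum>\<^sub>\<infinity>x\<in>A. (g x)\<^sup>2)"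
    if F: "finite F" "F \<subseteq> A" for F
  proof -
    have "(\<Sum>x\<in>F. f x * g x) \<le> L2_set f F * L2_set g F"
      using L2_set_mult_ineq[of f g F] nn by simp
    also have "\<dots> \<le> sqrt (\<Sum>\<^sub>\<infinity>x\<in>A. (f x)\<^sup>2) * sqrt (\<Sum>\<^sub>\<infinity>x\<in>A. (g x)\<^sup>2)"
      unfolding L2_set_def using F
      by (intro mult_mono real_sqrt_le_mono finite_sum_le_infsum f g) (auto intro: sum_nonneg infsum_nonneg)
    finally show ?thesis .
  qed
  show s: "(\<lambda>x. f x * g x) summable_on A"
    by (rule nonneg_bdd_above_summable_on) (use nn fin in \<open>auto intro!: bdd_aboveI2\<close>)
  show "(\<Sum>\<^sub>\<infinity>x\<in>A. f x * g x) \<le> sqrt (\<Sum>\<^sub>\<infinity>x\<in>A. (f x)\<^sup>2) * sqrt (\<Sum>\<^sub>\<infinity>x\<in>A. (g x)\<^sup>2)"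
    by (rule infsum_le_finite_sums[OF s]) (use fin in auto)
qed

lemma infsum_diff:
  fixes f g :: "'a \<Rightarrow> 'b :: {topological_ab_group_add, t2_space}"
  assumes "f summable_on A" "g summable_on A"
  shows "(\<Sum>\<^sub>\<infinity>x\<in>A. f x - g x) = infsum f A - infsum g A"
proof -
  have "((\<lambda>x. f x + - g x) has_sum (infsum f A + - infsum g A)) A"
    using assms by (intro has_sum_add has_sum_uminus[THEN iffD2]) auto
  thus ?thesis by (auto intro: infsumI)
qed

lemma bounded_row_apply:
  fixes a :: "'a \<Rightarrow> complex"
  assumes a: "(\<lambda>j. cmod (a j)) summable_on UNIV" and y: "\<And>j. cmod (y j) \<le> C"
  shows "(\<lambda>j. cmod (a j * y j)) summable_on UNIV" "(\<lambda>j. a j * y j) summable_on UNIV"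
    and "cmod (\<Sum>\<^sub>\<infinity>j. a j * y j) \<le> (\<Sum>\<^sub>\<infinity>j. cmod (a j)) * C"
proof -
  have aC: "(\<lambda>j. cmod (a j) * C) summable_on UNIV"
    using a by (rule summable_on_cmult_left)
  show s: "(\<lambda>j. cmod (a j * y j)) summable_on UNIV"
    by (rule summable_on_comparison_test[OF aC]) (auto simp: norm_mult intro!: mult_left_mono y)
  show "(\<lambda>j. a j * y j) summable_on UNIV"
    by (rule abs_summable_summable[OF s])
  have "cmod (\<Sum>\<^sub>\<infinity>j. a j * y j) \<le> (\<Sum>\<^sub>\<infinity>j. cmod (a j * y j))"
    by (rule norm_infsum_bound[OF s])
  also have "\<dots> \<le> (\<Sum>\<^sub>\<infinity>j. cmod (a j) * C)"
    by (rule infsum_mono[OF s aC]) (auto simp: norm_mult intro!: mult_left_mono y)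
  also have "\<dots> = (\<Sum>\<^sub>\<infinity>j. cmod (a j)) * C"
    by (rule infsum_cmult_left) (use a in auto)
  finally show "cmod (\<Sum>\<^sub>\<infinity>j. a j * y j) \<le> (\<Sum>\<^sub>\<infinity>j. cmod (a j)) * C" .
qed

text \<open>The supremum \<open>s\<close> of the moduli satisfies \<open>s \<le> B + s/2\<close>.
  The a priori bound \<open>C\<close> makes \<open>s\<close> finite and drops out of the
  result.\<close>

lemma bounded_solution_bound:
  fixes A :: "'a \<Rightarrow> 'a \<Rightarrow> complex"
  assumes A: "\<And>k. (\<lambda>j. cmod (A k j)) summable_on UNIV" "\<And>k. (\<Sum>\<^sub>\<infinity>j. cmod (A k j)) \<le> 1/2"
    and b: "\<And>k. cmod (b k) \<le> B"
    and y: "\<And>k. cmod (y k) \<le> C"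
    and eq: "\<And>k. y k = b k + (\<Sum>\<^sub>\<infinity>j. A k j * y j)"
  shows "cmod (y k) \<le> 2 * B"
proof -
  define s where "s = (SUP k. cmod (y k))"
  have bdd: "bdd_above (range (\<lambda>k. cmod (y k)))"
    by (rule bdd_aboveI[of _ C]) (use y in auto)
  have le: "cmod (y k) \<le> s" for k
    unfolding s_def by (rule cSUP_upper[OF _ bdd]) auto
  hence s0: "s \<ge> 0" using norm_ge_zero order_trans by blast
  have "cmod (y k) \<le> B + s/2" for k
  proof -
    have "cmod (y k) \<le> cmod (b k) + cmod (\<Sum>\<^sub>\<infinity>j. A k j * y j)"
      by (subst eq) (rule norm_triangle_ineq)
    also have "\<dots> \<le> B + (\<Sum>\<^sub>\<infinity>j. cmod (A k j)) * s"
      by (intro add_mono b bounded_row_apply A le)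
    also have "\<dots> \<le> B + 1/2 * s"
      by (intro add_left_mono mult_right_mono A s0)
    finally show ?thesis by simp
  qed
  hence "s \<le> B + s/2"
    unfolding s_def by (intro cSUP_least) auto
  with le[of k] show ?thesis by linarith
qed

text \<open>Neumann series: \<open>d l\<close> is the matrix applied \<open>l\<close> times to
  \<open>b\<close>, and each application at least halves the supremum norm.\<close>

lemma bounded_solution_exists:
  fixes A :: "int \<Rightarrow> int \<Rightarrow> complex"
  assumes A: "\<And>k. (\<lambda>j. cmod (A k j)) summable_on UNIV" "\<And>k. (\<Sum>\<^sub>\<infinity>j. cmod (A k j)) \<le> 1/2"
    and b: "\<And>k. cmod (b k) \<le> B"
  shows "\<exists>y. (\<exists>C. \<forall>k. cmod (y k) \<le> C) \<and> (\<forall>k. y k = b k + (\<Sum>\<^sub>\<infinity>j. A k j * y j))"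
proof -
  define d where "d = rec_nat b (\<lambda>_ f k. \<Sum>\<^sub>\<infinity>j. A k j * f j)"
  have dS: "d (Suc l) k = (\<Sum>\<^sub>\<infinity>j. A k j * d l j)" for l k by (simp add: d_def)
  have B0: "B \<ge> 0" using b[of 0] norm_ge_zero order_trans by blast
  have db: "cmod (d l k) \<le> B * (1/2)^l" for l k
  proof (induction l arbitrary: k)
    case (Suc l)
    have "cmod (d (Suc l) k) \<le> (\<Sum>\<^sub>\<infinity>j. cmod (A k j)) * (B * (1/2)^l)"
      unfolding dS by (intro bounded_row_apply A Suc)
    also have "\<dots> \<le> 1/2 * (B * (1/2)^l)"
      by (intro mult_right_mono A) (use B0 in auto)
    finally show ?case by simp
  qed (use b in \<open>simp add: d_def\<close>)
  have geo: "((\<lambda>l. c * (B * (1/2)^l)) has_sum (c * (B * 2))) UNIV" for c :: real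
    using sums_mult[OF geometric_sums[of "1/2::real"], of B] B0
    by (intro has_sum_cmult_right sums_nonneg_imp_has_sum) (auto simp: mult_ac)
  have ds: "(\<lambda>l. cmod (d l k)) summable_on UNIV" for k
    by (rule summable_on_comparison_test[OF has_sum_imp_summable[OF geo[of 1]]]) (use db in auto)
  define y where "y k = (\<Sum>\<^sub>\<infinity>l. d l k)" for k
  have yB: "cmod (y k) \<le> B * 2" for k
  proof -
    have "cmod (y k) \<le> (\<Sum>\<^sub>\<infinity>l. cmod (d l k))" unfolding y_def by (rule norm_infsum_bound[OF ds])
    also have "\<dots> \<le> B * 2"
      by (rule has_sum_mono[OF has_sum_infsum[OF ds]]) (use geo[of 1] db in auto)
    finally show ?thesis .
  qed
  have "y k = b k + (\<Sum>\<^sub>\<infinity>j. A k j * y j)" for k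
  proof -
    \<comment> \<open>Absolute summability in both indices allows the matrix to be applied termwise,
      which shifts the series by one place.\<close>
    have "(\<lambda>p. cmod (case p of (j, l) \<Rightarrow> A k j * d l j)) summable_on UNIV \<times> UNIV"
    proof (rule summable_on_comparison_test)
      show "(\<lambda>(j, l). cmod (A k j) * (B * (1/2)^l)) summable_on UNIV \<times> UNIV"
        by (rule summable_on_SigmaI[where g = "\<lambda>j. cmod (A k j) * (B * 2)"])
           (use geo B0 A(1) in \<open>auto intro!: summable_on_cmult_left\<close>)
    qed (use db in \<open>auto simp: norm_mult intro!: mult_left_mono\<close>)
    hence swap: "(\<Sum>\<^sub>\<infinity>j. \<Sum>\<^sub>\<infinity>l. A k j * d l j) = (\<Sum>\<^sub>\<infinity>l. d (Suc l) k)"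
      unfolding dS by (rule infsum_swap_banach[OF abs_summable_summable])
    have sd: "(\<lambda>l. d l k) sums y k" unfolding y_def
      by (rule has_sum_imp_sums[OF has_sum_infsum[OF abs_summable_summable[OF ds]]])
    have "(\<lambda>l. cmod (d l k)) summable_on range Suc" by (rule summable_on_subset[OF ds]) auto
    hence "(\<lambda>l. cmod (d (Suc l) k)) summable_on UNIV"
      by (subst (asm) summable_on_reindex) (auto simp: o_def)
    hence "(\<lambda>l. d (Suc l) k) sums (\<Sum>\<^sub>\<infinity>l. d (Suc l) k)"
      by (rule has_sum_imp_sums[OF has_sum_infsum[OF abs_summable_summable]])
    hence "(\<lambda>l. d l k) sums ((\<Sum>\<^sub>\<infinity>l. d (Suc l) k) + d 0 k)" by (rule sums_Suc)
    with sd have "y k = (\<Sum>\<^sub>\<infinity>l. d (Suc l) k) + d 0 k" by (rule sums_unique2)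
    thus ?thesis unfolding swap[symmetric] infsum_cmult_right' y_def by (simp add: d_def add.commute)
  qed
  with yB show ?thesis by blast
qed

section \<open>Decay of the free resolvent on a tile\<close>

lemma summable_on_nat_abs:
  fixes f :: "nat \<Rightarrow> real"
  assumes "f summable_on UNIV"
  shows "(\<lambda>m::int. f (nat \<bar>m\<bar>)) summable_on UNIV"
proof -
  have "(\<lambda>m::int. f (nat \<bar>m\<bar>)) summable_on range int"
    by (subst summable_on_reindex) (use assms in \<open>auto simp: o_def\<close>)
  moreover have "(\<lambda>m::int. f (nat \<bar>m\<bar>)) summable_on range (\<lambda>n. - int n)"
    by (subst summable_on_reindex) (use assms in \<open>auto simp: o_def inj_on_def\<close>)
  ultimately have "(\<lambda>m::int. f (nat \<bar>m\<bar>)) summable_on (range int \<union> range (\<lambda>n. - int n))"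
    by (rule summable_on_union)
  moreover have "range int \<union> range (\<lambda>n. - int n) = UNIV" by (auto intro: int_cases2)
  ultimately show ?thesis by simp
qed

definition tile :: "nat \<Rightarrow> real set" where
  "tile n = {((real n - 1/2) * pi)\<^sup>2 .. ((real n + 1/2) * pi)\<^sup>2}"

text \<open>The diagonal of the free resolvent, with the two resonant modes \<open>n\<close> and \<open>- n\<close> removed.\<close>

definition resolvent :: "nat \<Rightarrow> real \<Rightarrow> int \<Rightarrow> real" where
  "resolvent n l j = (if \<bar>j\<bar> = int n then 0 else 1 / (l - (pi * of_int j)\<^sup>2))"

text \<open>Shifted to the two resonant modes, this majorizes the resolvent and, after division by
  \<open>n^2\<close>, its square, uniformly on the tile.\<close>

definition inv_sq :: "int \<Rightarrow> real" where "inv_sq k = (if k = 0 then 0 else 1 / (real_of_int k)\<^sup>2)"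

lemma inv_sq_nonneg: "inv_sq k \<ge> 0" by (simp add: inv_sq_def)

lemma inv_sq_summable: "inv_sq summable_on UNIV"
proof -
  have "summable (\<lambda>n. 1 / (real n)\<^sup>2)"
    using inverse_power_summable[of 2, where 'a = real] by (simp add: field_simps)
  hence "(\<lambda>n. 1 / (real n)\<^sup>2) summable_on UNIV"
    by (subst summable_on_UNIV_nonneg_real_iff) auto
  from summable_on_nat_abs[OF this] show ?thesis
    by (rule summable_on_cong[THEN iffD1, rotated]) (simp add: inv_sq_def)
qed

definition inv_sq_sum :: real where "inv_sq_sum = (\<Sum>\<^sub>\<infinity>k. inv_sq k)"

lemma inverse_square_le_isq:
  assumes "\<bar>j\<bar> \<noteq> int n"
  shows "1 / (of_int \<bar>j\<bar> - real n)\<^sup>2 \<le> inv_sq (j - int n) + inv_sq (j + int n)"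
proof (cases "j \<ge> 0")
  case True
  hence "1 / (of_int \<bar>j\<bar> - real n)\<^sup>2 = inv_sq (j - int n)" using assms by (auto simp: inv_sq_def)
  thus ?thesis using inv_sq_nonneg[of "j + int n"] by linarith
next
  case False
  hence "(of_int \<bar>j\<bar> - real n)\<^sup>2 = (of_int (j + int n))\<^sup>2"
    by (subst power2_commute) (simp add: power2_eq_square algebra_simps)
  hence "1 / (of_int \<bar>j\<bar> - real n)\<^sup>2 = inv_sq (j + int n)" using False assms by (auto simp: inv_sq_def)
  thus ?thesis using inv_sq_nonneg[of "j - int n"] by linarith
qed

text \<open>With \<open>d\<close> the distance between \<open>|j|\<close> and \<open>n\<close>, a
  difference of squares factors into \<open>d - 1/2\<close>, which is at least \<open>d/2\<close>,
  and a sum. The first bound carries the factor \<open>n\<close> that makes the kernel small; the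
  second makes the resolvent itself summable over \<open>j\<close>.\<close>

lemma tile_separation:
  assumes n: "n \<ge> 1" and l: "l \<in> tile n" and j: "\<bar>j\<bar> \<noteq> int n"
  shows "\<bar>l - (pi * of_int j)\<^sup>2\<bar> \<ge> real n * \<bar>of_int \<bar>j\<bar> - real n\<bar>"
    and "\<bar>l - (pi * of_int j)\<^sup>2\<bar> \<ge> (of_int \<bar>j\<bar> - real n)\<^sup>2"
proof -
  define m where "m = nat \<bar>j\<bar>"
  have jm: "(pi * of_int j)\<^sup>2 = pi\<^sup>2 * (real m)\<^sup>2" "of_int \<bar>j\<bar> = real m" "m \<noteq> n"
    using j by (auto simp: m_def power_mult_distrib)
  have p4: "pi\<^sup>2 \<ge> 4" using power_mono[OF pi_ge_two, of 2] by simp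
  define X where "X = \<bar>l - pi\<^sup>2 * (real m)\<^sup>2\<bar>"
  have l1: "l \<ge> pi\<^sup>2 * (real n - 1/2)\<^sup>2" and l2: "l \<le> pi\<^sup>2 * (real n + 1/2)\<^sup>2"
    using l by (auto simp: tile_def power_mult_distrib mult_ac)
  have "X \<ge> real n * \<bar>real m - real n\<bar> \<and> X \<ge> (real m - real n)\<^sup>2"
  proof (cases "m > n")
    case True
    define d where "d = real m - real n"
    have d: "d \<ge> 1" "real m = real n + d" using True by (auto simp: d_def)
    have "X \<ge> pi\<^sup>2 * (real m)\<^sup>2 - pi\<^sup>2 * (real n + 1/2)\<^sup>2" unfolding X_def using l2 by linarith
    also have "pi\<^sup>2 * (real m)\<^sup>2 - pi\<^sup>2 * (real n + 1/2)\<^sup>2 = pi\<^sup>2 * ((d - 1/2) * (2 * real n + d + 1/2))"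
      by (simp add: d power2_eq_square algebra_simps)
    finally have X: "X \<ge> pi\<^sup>2 * ((d - 1/2) * (2 * real n + d + 1/2))" .
    have "pi\<^sup>2 * ((d - 1/2) * (2 * real n + d + 1/2)) \<ge> 4 * (d/2 * (real n + d))"
      using d n by (intro mult_mono p4) auto
    moreover have "4 * (d/2 * (real n + d)) \<ge> real n * d" "4 * (d/2 * (real n + d)) \<ge> d\<^sup>2"
      using d by (auto simp: power2_eq_square algebra_simps)
    ultimately have "X \<ge> real n * d" "X \<ge> d\<^sup>2" using X by linarith+
    moreover have "\<bar>real m - real n\<bar> = d" "(real m - real n)\<^sup>2 = d\<^sup>2" using d by auto
    ultimately show ?thesis by simp
  next
    case False
    define d where "d = real n - real m"
    have d: "d \<ge> 1" "real n = real m + d" using False jm by (auto simp: d_def)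
    have "X \<ge> pi\<^sup>2 * (real n - 1/2)\<^sup>2 - pi\<^sup>2 * (real m)\<^sup>2" unfolding X_def using l1 by linarith
    also have "pi\<^sup>2 * (real n - 1/2)\<^sup>2 - pi\<^sup>2 * (real m)\<^sup>2 = pi\<^sup>2 * ((d - 1/2) * (2 * real m + d - 1/2))"
      by (simp add: d power2_eq_square algebra_simps)
    finally have X: "X \<ge> pi\<^sup>2 * ((d - 1/2) * (2 * real m + d - 1/2))" .
    have "pi\<^sup>2 * ((d - 1/2) * (2 * real m + d - 1/2)) \<ge> 4 * (d/2 * (real m + d/2))"
      using d n by (intro mult_mono p4) auto
    moreover have "4 * (d/2 * (real m + d/2)) \<ge> real n * d" "4 * (d/2 * (real m + d/2)) \<ge> d\<^sup>2"
      using d by (auto simp: power2_eq_square algebra_simps)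
    ultimately have "X \<ge> real n * d" "X \<ge> d\<^sup>2" using X by linarith+
    moreover have "\<bar>real m - real n\<bar> = d" "(real m - real n)\<^sup>2 = d\<^sup>2" using d by (auto simp: power2_eq_square)
    ultimately show ?thesis by simp
  qed
  thus "\<bar>l - (pi * of_int j)\<^sup>2\<bar> \<ge> real n * \<bar>of_int \<bar>j\<bar> - real n\<bar>"
    "\<bar>l - (pi * of_int j)\<^sup>2\<bar> \<ge> (of_int \<bar>j\<bar> - real n)\<^sup>2"
    by (simp_all only: jm X_def)
qed

lemma tile_nonzero:
  assumes "n \<ge> 1" "l \<in> tile n" "\<bar>j\<bar> \<noteq> int n"
  shows "l - (pi * of_int j)\<^sup>2 \<noteq> 0"
proof -
  have "0 < (of_int \<bar>j\<bar> - real n)\<^sup>2" using assms(3) by simp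
  thus ?thesis using tile_separation(2)[OF assms] by linarith
qed

context
  fixes n :: nat and l :: real
  assumes n: "n \<ge> 1" and l: "l \<in> tile n"
begin

lemma resolvent_le_inverse: "\<bar>resolvent n l j\<bar> \<le> 1 / real n"
proof (cases "\<bar>j\<bar> = int n")
  case False
  have "real n * 1 \<le> real n * \<bar>of_int \<bar>j\<bar> - real n\<bar>"
    using False by (intro mult_left_mono) linarith+
  also have "\<dots> \<le> \<bar>l - (pi * of_int j)\<^sup>2\<bar>" by (rule tile_separation[OF n l False])
  finally show ?thesis using False n unfolding resolvent_def
    by (auto simp: abs_divide intro!: frac_le)
qed (simp add: resolvent_def)

lemma resolvent_le_isq: "\<bar>resolvent n l j\<bar> \<le> inv_sq (j - int n) + inv_sq (j + int n)"
proof (cases "\<bar>j\<bar> = int n")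
  case False
  have "\<bar>resolvent n l j\<bar> \<le> 1 / (of_int \<bar>j\<bar> - real n)\<^sup>2"
    using tile_separation(2)[OF n l False] False unfolding resolvent_def
    by (auto simp: abs_divide intro!: frac_le)
  also have "\<dots> \<le> inv_sq (j - int n) + inv_sq (j + int n)"
    by (rule inverse_square_le_isq[OF False])
  finally show ?thesis .
qed (simp add: resolvent_def inv_sq_nonneg)

lemma resolvent_sq_le: "(resolvent n l j)\<^sup>2 \<le> (inv_sq (j - int n) + inv_sq (j + int n)) / (real n)\<^sup>2"
proof (cases "\<bar>j\<bar> = int n")
  case False
  have "(resolvent n l j)\<^sup>2 \<le> (1 / (real n * \<bar>of_int \<bar>j\<bar> - real n\<bar>))\<^sup>2"
    using tile_separation(1)[OF n l False] False n unfolding resolvent_def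
    by (intro power2_le_iff_abs_le[THEN iffD2]) (auto simp: abs_divide intro!: frac_le)
  also have "\<dots> = (1 / (of_int \<bar>j\<bar> - real n)\<^sup>2) / (real n)\<^sup>2"
    by (simp add: power_divide power_mult_distrib)
  also have "\<dots> \<le> (inv_sq (j - int n) + inv_sq (j + int n)) / (real n)\<^sup>2"
    by (intro divide_right_mono inverse_square_le_isq False) auto
  finally show ?thesis .
qed (simp add: resolvent_def inv_sq_nonneg)

lemma inv_sq_pair: "((\<lambda>j. inv_sq (j - int n) + inv_sq (j + int n)) has_sum 2 * inv_sq_sum) UNIV"
proof -
  have "((\<lambda>j. inv_sq (j + c)) has_sum inv_sq_sum) UNIV" for c
    unfolding inv_sq_sum_def
    by (subst has_sum_reindex_bij_betw[of "\<lambda>j. j + c" UNIV UNIV inv_sq])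
       (use inv_sq_summable in \<open>auto intro!: bij_betw_byWitness[where f' = "\<lambda>j. j - c"]\<close>)
  from has_sum_add[OF this this, of "- int n" "int n"] show ?thesis by simp
qed

lemma resolvent_summable: "(\<lambda>j. \<bar>resolvent n l j\<bar>) summable_on UNIV"
  by (rule summable_on_comparison_test[OF has_sum_imp_summable[OF inv_sq_pair]]) (use resolvent_le_isq in auto)

lemma resolvent_sq_summable: "(\<lambda>j. (resolvent n l j)\<^sup>2) summable_on UNIV"
  and resolvent_sq_sum: "(\<Sum>\<^sub>\<infinity>j. (resolvent n l j)\<^sup>2) \<le> 2 * inv_sq_sum / (real n)\<^sup>2"
proof -
  have h: "((\<lambda>j. (inv_sq (j - int n) + inv_sq (j + int n)) / (real n)\<^sup>2) has_sum (2 * inv_sq_sum / (real n)\<^sup>2)) UNIV"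
    using has_sum_cmult_left[OF inv_sq_pair, of "1 / (real n)\<^sup>2"] by simp
  show s: "(\<lambda>j. (resolvent n l j)\<^sup>2) summable_on UNIV"
    by (rule summable_on_comparison_test[OF has_sum_imp_summable[OF h]]) (use resolvent_sq_le in auto)
  show "(\<Sum>\<^sub>\<infinity>j. (resolvent n l j)\<^sup>2) \<le> 2 * inv_sq_sum / (real n)\<^sup>2"
    using has_sum_mono[OF has_sum_infsum[OF s] h] resolvent_sq_le by auto
qed

end

text \<open>\<open>res_const / n\<close> bounds the square-sum norm of the resolvent diagonal on the
  tile; the factor 2 counts the two resonant modes.\<close>

definition res_const :: real where "res_const = sqrt (2 * inv_sq_sum)"

lemma inv_sq_sum_nonneg: "inv_sq_sum \<ge> 0" unfolding inv_sq_sum_def by (intro infsum_nonneg inv_sq_nonneg)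
lemma res_const_nonneg: "res_const \<ge> 0" by (simp add: res_const_def inv_sq_sum_nonneg)

lemma summable_on_reflect:
  fixes f :: "int \<Rightarrow> 'a :: {comm_monoid_add,t2_space}"
  shows "(\<lambda>j. f (k - j)) summable_on UNIV \<longleftrightarrow> f summable_on UNIV"
    "(\<Sum>\<^sub>\<infinity>j. f (k - j)) = (\<Sum>\<^sub>\<infinity>j. f j)"
proof -
  have b: "bij_betw (\<lambda>j::int. k - j) UNIV UNIV"
    by (rule bij_betw_byWitness[where f' = "\<lambda>j. k - j"]) auto
  show "(\<lambda>j. f (k - j)) summable_on UNIV \<longleftrightarrow> f summable_on UNIV"
    by (rule summable_on_reindex_bij_betw[OF b])
  show "(\<Sum>\<^sub>\<infinity>j. f (k - j)) = (\<Sum>\<^sub>\<infinity>j. f j)"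
    by (rule infsum_reindex_bij_betw[OF b])
qed

text \<open>By Cauchy-Schwarz the square sum of \<open>V\<close> is all that enters, and the bound
  is uniform in \<open>k\<close>. This is the source of every factor \<open>1 / n\<close> below, for
  plain and for weighted coefficients alike.\<close>

lemma convolution_rdiag:
  fixes V :: "int \<Rightarrow> real"
  assumes n: "n \<ge> 1" and l: "l \<in> tile n" and V: "\<And>k. V k \<ge> 0" "(\<lambda>k. (V k)\<^sup>2) summable_on UNIV"
  shows "(\<lambda>j. V (k - j) * \<bar>resolvent n l j\<bar>) summable_on UNIV"
    and "(\<Sum>\<^sub>\<infinity>j. V (k - j) * \<bar>resolvent n l j\<bar>) \<le> sqrt (\<Sum>\<^sub>\<infinity>k. (V k)\<^sup>2) * res_const / real n"
proof -
  have Vk: "(\<lambda>j. (V (k - j))\<^sup>2) summable_on UNIV" "(\<Sum>\<^sub>\<infinity>j. (V (k - j))\<^sup>2) = (\<Sum>\<^sub>\<infinity>k. (V k)\<^sup>2)"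
    using V(2) by (simp_all add: summable_on_reflect[of "\<lambda>k. (V k)\<^sup>2"])
  have D: "(\<lambda>j. \<bar>resolvent n l j\<bar>\<^sup>2) summable_on UNIV" using resolvent_sq_summable[OF n l] by simp
  note CS = infsum_Cauchy_Schwarz[OF _ _ Vk(1) D]
  show "(\<lambda>j. V (k - j) * \<bar>resolvent n l j\<bar>) summable_on UNIV" by (rule CS) (use V in auto)
  have "(\<Sum>\<^sub>\<infinity>j. V (k - j) * \<bar>resolvent n l j\<bar>) \<le> sqrt (\<Sum>\<^sub>\<infinity>k. (V k)\<^sup>2) * sqrt (\<Sum>\<^sub>\<infinity>j. \<bar>resolvent n l j\<bar>\<^sup>2)"
    unfolding Vk(2)[symmetric] by (rule CS) (use V in auto)
  also have "\<dots> \<le> sqrt (\<Sum>\<^sub>\<infinity>k. (V k)\<^sup>2) * sqrt (2 * inv_sq_sum / (real n)\<^sup>2)"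
    using resolvent_sq_sum[OF n l] by (intro mult_left_mono real_sqrt_le_mono) (auto intro: infsum_nonneg)
  also have "sqrt (2 * inv_sq_sum / (real n)\<^sup>2) = res_const / real n"
    by (simp add: res_const_def real_sqrt_divide)
  finally show "(\<Sum>\<^sub>\<infinity>j. V (k - j) * \<bar>resolvent n l j\<bar>) \<le> sqrt (\<Sum>\<^sub>\<infinity>k. (V k)\<^sup>2) * res_const / real n" by simp
qed

section \<open>The reduced system\<close>

locale hermitian_coeffs =
  fixes Q :: "int \<Rightarrow> complex"
  assumes Q_minus: "Q (- k) = cnj (Q k)"
    and Q_sq: "(\<lambda>k. (cmod (Q k))\<^sup>2) summable_on UNIV"
begin

definition S :: real where "S = sqrt (\<Sum>\<^sub>\<infinity>k. (cmod (Q k))\<^sup>2)"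

lemma S_nonneg: "S \<ge> 0" by (simp add: S_def infsum_nonneg)

lemma Q_le_S: "cmod (Q k) \<le> S"
proof -
  have "(cmod (Q k))\<^sup>2 \<le> (\<Sum>\<^sub>\<infinity>k. (cmod (Q k))\<^sup>2)"
    using finite_sum_le_infsum[OF Q_sq, of "{k}"] by simp
  thus ?thesis unfolding S_def by (rule real_le_rsqrt)
qed

text \<open>The second inequality brings the row sums of the kernel below 1/2, the third makes
  \<open>Y\<close> Lipschitz in \<open>l\<close> with constant 1/8, and the last keeps the roots
  inside their tile and those of neighbouring tiles apart.\<close>

definition large :: "nat \<Rightarrow> bool" where
  "large n \<longleftrightarrow> n \<ge> 1 \<and> 2 * S * res_const \<le> real n \<and> 32 * S\<^sup>2 * res_const \<le> real n \<and> 8 * S + 1 \<le> real n"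

lemma eventually_large: "\<exists>N. \<forall>n\<ge>N. large n"
proof -
  define N where "N = nat \<lceil>1 + \<bar>2 * S * res_const\<bar> + \<bar>32 * S\<^sup>2 * res_const\<bar> + \<bar>8 * S + 1\<bar>\<rceil>"
  have "large n" if "n \<ge> N" for n
  proof -
    have "real n \<ge> 1 + \<bar>2 * S * res_const\<bar> + \<bar>32 * S\<^sup>2 * res_const\<bar> + \<bar>8 * S + 1\<bar>"
      using that unfolding N_def by linarith
    thus ?thesis unfolding large_def by (intro conjI) linarith+
  qed
  thus ?thesis by blast
qed

definition kern :: "nat \<Rightarrow> real \<Rightarrow> int \<Rightarrow> int \<Rightarrow> complex" where
  "kern n l k j = Q (k - j) * of_real (resolvent n l j)"

lemma kern_sum:
  assumes n: "n \<ge> 1" and l: "l \<in> tile n"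
  shows "(\<lambda>j. cmod (kern n l k j)) summable_on UNIV"
    and "(\<Sum>\<^sub>\<infinity>j. cmod (kern n l k j)) \<le> S * res_const / real n"
  using convolution_rdiag[OF n l, of "\<lambda>k. cmod (Q k)" k] Q_sq
  by (auto simp: kern_def norm_mult S_def)

lemma kern_half:
  assumes n: "large n" and l: "l \<in> tile n"
  shows "(\<Sum>\<^sub>\<infinity>j. cmod (kern n l k j)) \<le> 1/2"
proof -
  have "S * res_const / real n \<le> 1/2" using n by (simp add: large_def field_simps)
  moreover have "(\<Sum>\<^sub>\<infinity>j. cmod (kern n l k j)) \<le> S * res_const / real n"
    using n l by (intro kern_sum) (auto simp: large_def)
  ultimately show ?thesis by linarith
qed

text \<open>If \<open>x\<close> is the coefficient sequence of a solution whose resonant part is the mode \<open>- n\<close>, then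
  \<open>Y n l\<close> is the convolution of \<open>Q\<close> with \<open>x\<close>.  Unlike \<open>x\<close> it obeys an equation which contracts the
  supremum norm.  The mode \<open>n\<close> gives \<open>\<lambda>k. cnj (Y n l (- k))\<close>, as \<open>Q\<close> is Hermitian.\<close>

definition Y :: "nat \<Rightarrow> real \<Rightarrow> int \<Rightarrow> complex" where
  "Y n l = (SOME y. (\<exists>C. \<forall>k. cmod (y k) \<le> C) \<and> (\<forall>k. y k = Q (k + int n) + (\<Sum>\<^sub>\<infinity>j. kern n l k j * y j)))"

context
  fixes n l assumes n: "large n" and l: "l \<in> tile n"
begin

lemma n1: "n \<ge> 1" using n by (simp add: large_def)

lemma bounded_solution_le:
  assumes "\<And>k. cmod (b k) \<le> B" "\<And>k. cmod (y k) \<le> C"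
    "\<And>k. y k = b k + (\<Sum>\<^sub>\<infinity>j. kern n l k j * y j)"
  shows "cmod (y k) \<le> 2 * B"
  by (rule bounded_solution_bound[OF kern_sum(1)[OF n1 l] kern_half[OF n l] assms])

lemma Y_props: "(\<exists>C. \<forall>k. cmod (Y n l k) \<le> C) \<and>
   (\<forall>k. Y n l k = Q (k + int n) + (\<Sum>\<^sub>\<infinity>j. kern n l k j * Y n l j))"
proof -
  have "\<exists>y. (\<exists>C. \<forall>k. cmod (y k) \<le> C) \<and> (\<forall>k. y k = Q (k + int n) + (\<Sum>\<^sub>\<infinity>j. kern n l k j * y j))"
    by (rule bounded_solution_exists[where B = S])
       (use kern_sum[OF n1 l] kern_half[OF n l] Q_le_S in auto)
  from someI_ex[OF this] show ?thesis unfolding Y_def .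
qed

lemma Y_eq: "Y n l k = Q (k + int n) + (\<Sum>\<^sub>\<infinity>j. kern n l k j * Y n l j)"
  using Y_props by blast

lemma Y_bound: "cmod (Y n l k) \<le> 2 * S"
proof -
  obtain C where "\<And>k. cmod (Y n l k) \<le> C" using Y_props by blast
  thus ?thesis by (intro bounded_solution_le[where b = "\<lambda>k. Q (k + int n)" and C = C] Q_le_S Y_eq)
qed

lemma kern_apply_summable:
  assumes "\<And>k. cmod (y k) \<le> C"
  shows "(\<lambda>j. kern n l k j * y j) summable_on UNIV"
  by (rule bounded_row_apply(2)[OF kern_sum(1)[OF n1 l] assms])

text \<open>The kernel is invariant under reflecting both indices and conjugating, since
  \<open>Q\<close> is Hermitian and the resolvent is real and even. The source at mode
  \<open>- n\<close> becomes the source at mode \<open>n\<close>.\<close>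

lemma cnj_Y_eq:
  "cnj (Y n l (- k)) = Q (k - int n) + (\<Sum>\<^sub>\<infinity>j. kern n l k j * cnj (Y n l (- j)))"
proof -
  have Q': "Q (int n - k) = cnj (Q (k - int n))" "Q (- k - j) = cnj (Q (k + j))" for j
    using Q_minus[of "k - int n"] Q_minus[of "k + j"] by simp_all
  have "cnj (Y n l (- k)) = Q (k - int n) + (\<Sum>\<^sub>\<infinity>j. cnj (kern n l (- k) j * Y n l j))"
    by (subst Y_eq) (simp add: Q' infsum_cnj[symmetric] del: infsum_cnj)
  also have "(\<Sum>\<^sub>\<infinity>j. cnj (kern n l (- k) j * Y n l j)) = (\<Sum>\<^sub>\<infinity>j. kern n l k (0 - j) * cnj (Y n l (- (0 - j))))"
    by (intro infsum_cong) (simp add: kern_def Q' resolvent_def)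
  also have "\<dots> = (\<Sum>\<^sub>\<infinity>j. kern n l k j * cnj (Y n l (- j)))"
    by (rule summable_on_reflect)
  finally show ?thesis .
qed

lemma combination_bound:
  "cmod (\<beta> * Y n l k + \<alpha> * cnj (Y n l (- k))) \<le> (cmod \<beta> + cmod \<alpha>) * (2 * S)"
  unfolding distrib_right
  by (rule order_trans[OF norm_triangle_ineq], rule add_mono) (simp_all add: norm_mult Y_bound mult_left_mono)

lemma kern_apply_combination:
  "(\<Sum>\<^sub>\<infinity>j. kern n l k j * (\<beta> * Y n l j + \<alpha> * cnj (Y n l (- j))))
     = \<beta> * (Y n l k - Q (k + int n)) + \<alpha> * (cnj (Y n l (- k)) - Q (k - int n))"
proof -
  have s: "(\<lambda>j. kern n l k j * Y n l j) summable_on UNIV"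
    "(\<lambda>j. kern n l k j * cnj (Y n l (- j))) summable_on UNIV"
    by (rule kern_apply_summable[of _ "2 * S"], simp add: Y_bound)+
  have "(\<Sum>\<^sub>\<infinity>j. kern n l k j * (\<beta> * Y n l j + \<alpha> * cnj (Y n l (- j))))
     = (\<Sum>\<^sub>\<infinity>j. \<beta> * (kern n l k j * Y n l j) + \<alpha> * (kern n l k j * cnj (Y n l (- j))))"
    by (simp add: algebra_simps)
  also have "\<dots> = \<beta> * (\<Sum>\<^sub>\<infinity>j. kern n l k j * Y n l j) + \<alpha> * (\<Sum>\<^sub>\<infinity>j. kern n l k j * cnj (Y n l (- j)))"
    by (simp add: infsum_add infsum_cmult_right' summable_on_cmult_right s)
  finally show ?thesis using Y_eq[of k] cnj_Y_eq[of k] by (simp add: algebra_simps)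
qed

text \<open>The difference from the combination solves the homogeneous system, so the supremum bound
  applies to it with source bound 0.\<close>

lemma solution_unique:
  assumes z: "\<And>k. cmod (z k) \<le> C"
    and eq: "\<And>k. z k = \<beta> * Q (k + int n) + \<alpha> * Q (k - int n) + (\<Sum>\<^sub>\<infinity>j. kern n l k j * z j)"
  shows "z k = \<beta> * Y n l k + \<alpha> * cnj (Y n l (- k))"
proof -
  define c where "c k = \<beta> * Y n l k + \<alpha> * cnj (Y n l (- k))" for k
  have cb: "cmod (c k) \<le> (cmod \<beta> + cmod \<alpha>) * (2 * S)" for k unfolding c_def by (rule combination_bound)
  have "cmod (z k - c k) \<le> 2 * 0" for k
  proof (rule bounded_solution_le[where b = "\<lambda>_. 0"])
    show "cmod (z k - c k) \<le> C + (cmod \<beta> + cmod \<alpha>) * (2 * S)" for k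
      by (rule order_trans[OF norm_triangle_ineq4 add_mono[OF z cb]])
    fix k
    have "(\<Sum>\<^sub>\<infinity>j. kern n l k j * (z j - c j)) = (\<Sum>\<^sub>\<infinity>j. kern n l k j * z j) - (\<Sum>\<^sub>\<infinity>j. kern n l k j * c j)"
      unfolding right_diff_distrib by (rule infsum_diff; rule kern_apply_summable, rule z cb)
    also have "\<dots> = z k - c k"
      unfolding c_def kern_apply_combination by (subst eq) (simp add: right_diff_distrib)
    finally show "z k - c k = 0 + (\<Sum>\<^sub>\<infinity>j. kern n l k j * (z j - c j))" by simp
  qed simp
  thus ?thesis by (simp add: c_def)
qed

text \<open>The diagonal entry of the reduced 2x2 matrix is real because the infinite matrix \<open>Q (k - j)\<close>
  is Hermitian and the free resolvent is real.\<close>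

lemma Y_diagonal_real: "Y n l (- int n) \<in> \<real>"
proof -
  define D where "D j = complex_of_real (resolvent n l j)" for j
  define y where "y = Y n l"
  have yb: "cmod (y j) \<le> 2 * S" for j unfolding y_def by (rule Y_bound)
  \<comment> \<open>\<open>R\<close> is the Hermitian form of the matrix \<open>Q (i - j)\<close> at
    the vector \<open>D j * y j\<close>. Conjugation exchanges the two indices, and absolute
    summability allows the order of summation to be exchanged back.\<close>
  define P where "P j i = D j * y j * cnj (y i) * D i * Q (i - j)" for j i
  define R where "R = (\<Sum>\<^sub>\<infinity>j. \<Sum>\<^sub>\<infinity>i. P j i)"
  have Dsum: "(\<lambda>j. \<bar>resolvent n l j\<bar>) summable_on UNIV" by (rule resolvent_summable[OF n1 l])
  have Psum: "(\<lambda>(j, i). P j i) summable_on UNIV \<times> UNIV"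
  proof -
    have "(\<lambda>(j,i). \<bar>resolvent n l j\<bar> * \<bar>resolvent n l i\<bar> * (4 * S^3)) summable_on UNIV \<times> UNIV"
    proof (rule summable_on_SigmaI)
      show "((\<lambda>i. case (j, i) of (j, i) \<Rightarrow> \<bar>resolvent n l j\<bar> * \<bar>resolvent n l i\<bar> * (4 * S^3)) has_sum
          (\<bar>resolvent n l j\<bar> * (\<Sum>\<^sub>\<infinity>i. \<bar>resolvent n l i\<bar>) * (4 * S^3))) UNIV" for j
        using has_sum_cmult_left[OF has_sum_cmult_right[OF has_sum_infsum[OF Dsum]]] by simp
      show "(\<lambda>j. \<bar>resolvent n l j\<bar> * (\<Sum>\<^sub>\<infinity>i. \<bar>resolvent n l i\<bar>) * (4 * S^3)) summable_on UNIV"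
        using Dsum by (intro summable_on_cmult_left) 
    qed (use S_nonneg in auto)
    moreover have "norm (P j i) \<le> \<bar>resolvent n l j\<bar> * \<bar>resolvent n l i\<bar> * (4 * S^3)" for j i
    proof -
      have "norm (P j i) = (\<bar>resolvent n l j\<bar> * \<bar>resolvent n l i\<bar>) * ((cmod (y j) * cmod (y i)) * cmod (Q (i - j)))"
        by (simp add: P_def D_def norm_mult)
      also have "\<dots> \<le> (\<bar>resolvent n l j\<bar> * \<bar>resolvent n l i\<bar>) * (((2*S) * (2*S)) * S)"
        using S_nonneg by (intro mult_left_mono mult_mono yb Q_le_S) auto
      finally show ?thesis by (simp add: power3_eq_cube algebra_simps)
    qed
    ultimately have "(\<lambda>x. norm (case x of (j, i) \<Rightarrow> P j i)) summable_on UNIV \<times> UNIV"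
      by (elim summable_on_comparison_test) auto
    thus ?thesis by (rule abs_summable_summable)
  qed
  have "cnj R = (\<Sum>\<^sub>\<infinity>j. \<Sum>\<^sub>\<infinity>i. P i j)"
    unfolding R_def infsum_cnj[symmetric]
    by (intro infsum_cong) (simp add: P_def D_def Q_minus[symmetric] mult_ac)
  also have "\<dots> = R" unfolding R_def by (rule infsum_swap_banach[OF Psum, symmetric])
  finally have R: "R \<in> \<real>" by (simp add: Reals_cnj_iff)
  \<comment> \<open>Row \<open>- n\<close> of the kernel contains the conjugated source term, which
    the equation for \<open>y\<close> eliminates. The diagonal entry becomes \<open>Q 0\<close> plus
    a real sum of squares minus the form \<open>R\<close>.\<close>
  have Qy: "Q (- int n - j) = cnj (y j) - cnj (\<Sum>\<^sub>\<infinity>i. kern n l j i * y i)" for j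
  proof -
    have "- int n - j = - (j + int n)" by simp
    thus ?thesis using Y_eq[of j] by (simp only: Q_minus y_def) simp
  qed
  have yab: "cmod (D j * (y j * cnj (y j))) \<le> cmod (D j) * (2 * S * (2 * S))" for j
    unfolding norm_mult using yb[of j] S_nonneg by (intro mult_left_mono mult_mono) auto
  have s1: "(\<lambda>j. D j * (y j * cnj (y j))) summable_on UNIV"
    by (rule abs_summable_summable, rule summable_on_comparison_test[OF _ yab])
       (use summable_on_cmult_left[OF Dsum] in \<open>auto simp: D_def\<close>)
  have s2: "(\<lambda>j. D j * y j * cnj (\<Sum>\<^sub>\<infinity>i. kern n l j i * y i)) summable_on UNIV"
  proof -
    have "(\<lambda>j. \<Sum>\<^sub>\<infinity>i. P j i) summable_on UNIV"
      using summable_on_Sigma_banach[OF Psum] by simp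
    also have "(\<lambda>j. \<Sum>\<^sub>\<infinity>i. P j i) = (\<lambda>j. D j * y j * cnj (\<Sum>\<^sub>\<infinity>i. kern n l j i * y i))"
      unfolding P_def infsum_cnj[symmetric] infsum_cmult_right'[symmetric]
      by (intro ext infsum_cong) (simp add: kern_def D_def mult_ac Q_minus[symmetric])
    finally show ?thesis .
  qed
  have "(\<Sum>\<^sub>\<infinity>j. kern n l (- int n) j * y j)
     = (\<Sum>\<^sub>\<infinity>j. D j * (y j * cnj (y j)) - D j * y j * cnj (\<Sum>\<^sub>\<infinity>i. kern n l j i * y i))"
    by (intro infsum_cong) (simp add: kern_def[of n l "- int n"] Qy D_def algebra_simps)
  also have "\<dots> = (\<Sum>\<^sub>\<infinity>j. D j * (y j * cnj (y j))) - (\<Sum>\<^sub>\<infinity>j. D j * y j * cnj (\<Sum>\<^sub>\<infinity>i. kern n l j i * y i))"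
    by (rule infsum_diff[OF s1 s2])
  also have "(\<Sum>\<^sub>\<infinity>j. D j * y j * cnj (\<Sum>\<^sub>\<infinity>i. kern n l j i * y i)) = R"
    unfolding R_def P_def infsum_cnj[symmetric] infsum_cmult_right'[symmetric]
    by (intro infsum_cong) (simp add: kern_def D_def mult_ac Q_minus[symmetric])
  finally have "y (- int n) = Q 0 + ((\<Sum>\<^sub>\<infinity>j. D j * (y j * cnj (y j))) - R)"
    using Y_eq[of "- int n"] by (simp add: y_def)
  moreover have "Q 0 \<in> \<real>" using Q_minus[of 0] by (simp add: Reals_cnj_iff)
  moreover have "(\<Sum>\<^sub>\<infinity>j. D j * (y j * cnj (y j))) \<in> \<real>"
    unfolding Reals_cnj_iff infsum_cnj[symmetric] by (simp add: D_def mult_ac)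
  ultimately show ?thesis using R by (simp add: y_def)
qed

end

text \<open>By the resolvent identity the two resolvents differ by at most
  \<open>|l - m| / n\<close> times the one at \<open>l\<close>. Hence \<open>Y n l - Y n m\<close>
  solves the system at \<open>l\<close> with a source of size \<open>|l - m| / 16\<close>.\<close>

lemma Y_Lipschitz:
  assumes n: "large n" and l: "l \<in> tile n" and m: "m \<in> tile n"
  shows "cmod (Y n l k - Y n m k) \<le> \<bar>l - m\<bar> / 8"
proof -
  have n1: "n \<ge> 1" using n by (simp add: large_def)
  define b where "b k = (\<Sum>\<^sub>\<infinity>j. (kern n l k j - kern n m k j) * Y n m j)" for k
  define c where "c = \<bar>l - m\<bar> / real n"
  have rd: "\<bar>resolvent n l j - resolvent n m j\<bar> \<le> c * \<bar>resolvent n l j\<bar>" for j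
  proof (cases "\<bar>j\<bar> = int n")
    case False
    note tile_nonzero[OF n1 l False] tile_nonzero[OF n1 m False]
    hence "resolvent n l j - resolvent n m j = (m - l) * resolvent n m j * resolvent n l j"
      using False by (simp add: resolvent_def field_simps)
    hence "\<bar>resolvent n l j - resolvent n m j\<bar> = \<bar>l - m\<bar> * \<bar>resolvent n m j\<bar> * \<bar>resolvent n l j\<bar>"
      by (simp add: abs_mult abs_minus_commute)
    also have "\<dots> \<le> \<bar>l - m\<bar> * (1 / real n) * \<bar>resolvent n l j\<bar>"
      by (intro mult_right_mono mult_left_mono resolvent_le_inverse[OF n1 m]) auto
    finally show ?thesis by (simp add: c_def)
  qed (simp add: resolvent_def)
  have kd: "cmod (kern n l k j - kern n m k j) \<le> c * cmod (kern n l k j)" for k j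
  proof -
    have "kern n l k j - kern n m k j = Q (k - j) * of_real (resolvent n l j - resolvent n m j)"
      by (simp add: kern_def algebra_simps)
    hence "cmod (kern n l k j - kern n m k j) = cmod (Q (k - j)) * \<bar>resolvent n l j - resolvent n m j\<bar>"
      by (simp add: norm_mult del: of_real_diff)
    also have "\<dots> \<le> cmod (Q (k - j)) * (c * \<bar>resolvent n l j\<bar>)"
      by (intro mult_left_mono rd) auto
    finally show ?thesis by (simp add: kern_def norm_mult mult_ac)
  qed
  have sd0: "(\<lambda>j. c * cmod (kern n l k j)) summable_on UNIV" for k
    by (intro summable_on_cmult_right kern_sum n1 l)
  have sd: "(\<lambda>j. cmod (kern n l k j - kern n m k j)) summable_on UNIV" for k
    by (rule summable_on_comparison_test[OF sd0 kd]) auto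
  have c0: "c \<ge> 0" by (simp add: c_def)
  have b: "cmod (b k) \<le> \<bar>l - m\<bar> / 16" for k
  proof -
    have "cmod (b k) \<le> (\<Sum>\<^sub>\<infinity>j. cmod (kern n l k j - kern n m k j)) * (2 * S)"
      unfolding b_def by (rule bounded_row_apply(3)[OF sd Y_bound[OF n m]])
    also have "\<dots> \<le> (\<Sum>\<^sub>\<infinity>j. c * cmod (kern n l k j)) * (2 * S)"
      using S_nonneg by (intro mult_right_mono infsum_mono sd sd0 kd) auto
    also have "\<dots> = (c * (\<Sum>\<^sub>\<infinity>j. cmod (kern n l k j))) * (2 * S)"
      by (simp add: infsum_cmult_right')
    also have "\<dots> \<le> (c * (S * res_const / real n)) * (2 * S)"
      using S_nonneg c0 by (intro mult_right_mono mult_left_mono kern_sum n1 l) auto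
    also have "\<dots> = \<bar>l - m\<bar> * ((2 * S\<^sup>2 * res_const / real n) * (1 / real n))"
      by (simp add: c_def power2_eq_square)
    also have "\<dots> \<le> \<bar>l - m\<bar> * (1/16 * 1)"
      using n n1 res_const_nonneg by (intro mult_left_mono mult_mono) (auto simp: large_def field_simps)
    finally show ?thesis by simp
  qed
  have "cmod (Y n l k - Y n m k) \<le> 2 * (\<bar>l - m\<bar> / 16)"
  proof (rule bounded_solution_le[OF n l b])
    show "cmod (Y n l k - Y n m k) \<le> 2 * S + 2 * S" for k
      by (rule order_trans[OF norm_triangle_ineq4]) (intro add_mono Y_bound n l m)
    fix k
    note ka = kern_apply_summable[OF n l] kern_apply_summable[OF n m]
    have s: "(\<lambda>j. kern n l k j * Y n l j) summable_on UNIV" "(\<lambda>j. kern n l k j * Y n m j) summable_on UNIV"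
       "(\<lambda>j. kern n m k j * Y n m j) summable_on UNIV"
      by (rule ka, rule Y_bound[OF n], rule l m)+
    have "b k + (\<Sum>\<^sub>\<infinity>j. kern n l k j * (Y n l j - Y n m j))
       = ((\<Sum>\<^sub>\<infinity>j. kern n l k j * Y n m j) - (\<Sum>\<^sub>\<infinity>j. kern n m k j * Y n m j))
        + ((\<Sum>\<^sub>\<infinity>j. kern n l k j * Y n l j) - (\<Sum>\<^sub>\<infinity>j. kern n l k j * Y n m j))"
      unfolding b_def by (simp add: left_diff_distrib right_diff_distrib infsum_diff s)
    thus "Y n l k - Y n m k = b k + (\<Sum>\<^sub>\<infinity>j. kern n l k j * (Y n l j - Y n m j))"
      using Y_eq[OF n l, of k] Y_eq[OF n m, of k] by simp
  qed
  thus ?thesis by simp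
qed

end

text \<open>Increments of \<open>g\<close> stay within a quarter of those of the identity, so
  \<open>g\<close> is continuous and increasing. The constant leaves room for two perturbations with
  Lipschitz constant 1/8, those of the diagonal and of the off-diagonal entry.\<close>

lemma near_identity_root:
  fixes g :: "real \<Rightarrow> real"
  assumes AB: "A \<le> B" and g: "\<And>x y. x \<in> {A..B} \<Longrightarrow> y \<in> {A..B} \<Longrightarrow> \<bar>g x - g y - (x - y)\<bar> \<le> \<bar>x - y\<bar> / 4"
    and sgn: "g A \<le> 0" "g B \<ge> 0"
  obtains r where "r \<in> {A..B}" "g r = 0" "\<And>x. x \<in> {A..B} \<Longrightarrow> x < r \<Longrightarrow> g x < 0"
    "\<And>x. x \<in> {A..B} \<Longrightarrow> x > r \<Longrightarrow> g x > 0"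
proof -
  have "2-lipschitz_on {A..B} g"
  proof (rule lipschitz_onI)
    fix x y assume "x \<in> {A..B}" "y \<in> {A..B}"
    from g[OF this] have "\<bar>g x - g y\<bar> \<le> \<bar>x - y\<bar> / 4 + \<bar>x - y\<bar>"
      using abs_triangle_ineq[of "g x - g y - (x - y)" "x - y"] by simp
    moreover have "a \<le> 2 * b" if "a \<le> b / 4 + b" "0 \<le> b" for a b :: real using that by linarith
    ultimately have "\<bar>g x - g y\<bar> \<le> 2 * \<bar>x - y\<bar>" using abs_ge_zero by blast
    thus "dist (g x) (g y) \<le> 2 * dist x y" by (simp add: dist_real_def)
  qed auto
  hence "continuous_on {A..B} g" by (rule lipschitz_on_continuous_on)
  then obtain r where r: "A \<le> r" "r \<le> B" "g r = 0" using IVT'[of g A 0 B] sgn AB by blast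
  show ?thesis
  proof (rule that[of r])
    fix x assume x: "x \<in> {A..B}"
    have *: "\<bar>g x - (x - r)\<bar> \<le> \<bar>x - r\<bar> / 4" using g[OF x, of r] r by auto
    show "g x < 0" if "x < r" using abs_le_D1[OF *] that by (simp add: field_simps)
    show "g x > 0" if "x > r" using abs_le_D2[OF *] that by (simp add: field_simps)
  qed (use r in auto)
qed

section \<open>The reduced 2x2 system and its two roots\<close>

context hermitian_coeffs
begin

text \<open>The eigenvalue equation on the Fourier side. Absolute summability is demanded because it
  makes the convolution with the bounded sequence \<open>Q\<close> converge and the synthesized
  function continuous.\<close>

definition eigseq :: "real \<Rightarrow> (int \<Rightarrow> complex) set" where
  "eigseq l = {x. (\<lambda>k. cmod (x k)) summable_on UNIV \<and>
     (\<forall>k. of_real (l - (pi * of_int k)\<^sup>2) * x k = (\<Sum>\<^sub>\<infinity>j. Q (k - j) * x j))}"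

text \<open>The rows of the reduced matrix are \<open>(detuning n l, - offdiag n l)\<close> and \<open>(- cnj (offdiag n l), detuning n l)\<close>,
  acting on the pair of coefficients with indices \<open>n\<close> and \<open>- n\<close>.\<close>

definition detuning :: "nat \<Rightarrow> real \<Rightarrow> real" where
  "detuning n l = l - (pi * real n)\<^sup>2 - Re (Y n l (- int n))"

definition offdiag :: "nat \<Rightarrow> real \<Rightarrow> complex" where "offdiag n l = Y n l (int n)"

text \<open>The solution with coefficient 1 at \<open>- n\<close> and 0 at \<open>n\<close>, where
  the resolvent vanishes. Together with its conjugate reflection it spans all candidates for
  eigenvectors.\<close>

definition U :: "nat \<Rightarrow> real \<Rightarrow> int \<Rightarrow> complex" where
  "U n l k = (if k = - int n then 1 else of_real (resolvent n l k) * Y n l k)"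

lemma Q_apply_summable:
  assumes "(\<lambda>k. cmod (x k)) summable_on UNIV"
  shows "(\<lambda>j. Q (k - j) * x j) summable_on UNIV"
    "cmod (\<Sum>\<^sub>\<infinity>j. Q (k - j) * x j) \<le> S * (\<Sum>\<^sub>\<infinity>j. cmod (x j))"
  using bounded_row_apply(2,3)[OF assms, of "\<lambda>j. Q (k - j)" S] Q_le_S by (simp_all add: mult.commute)

context
  fixes n l assumes n: "large n" and l: "l \<in> tile n"
begin

lemma Q_apply_split:
  assumes z: "\<And>k. cmod (z k) \<le> C"
    and x: "\<And>k. x k = (if k = int n then \<alpha> else if k = - int n then \<beta> else of_real (resolvent n l k) * z k)"
  shows "(\<Sum>\<^sub>\<infinity>j. Q (k - j) * x j) = \<beta> * Q (k + int n) + \<alpha> * Q (k - int n) + (\<Sum>\<^sub>\<infinity>j. kern n l k j * z j)"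
proof -
  define p where "p j = (if j = int n then Q (k - int n) * \<alpha> else 0)
     + (if j = - int n then Q (k + int n) * \<beta> else 0)" for j
  have nn: "int n \<noteq> - int n" using n by (simp add: large_def)
  have hp: "(p has_sum (\<alpha> * Q (k - int n) + \<beta> * Q (k + int n))) UNIV"
    unfolding p_def by (intro has_sum_add has_sum_finite_neutralI[where B = "{int n}"] has_sum_finite_neutralI[where B = "{- int n}"]) auto
  have "((\<lambda>j. p j + kern n l k j * z j) has_sum
     (\<alpha> * Q (k - int n) + \<beta> * Q (k + int n) + (\<Sum>\<^sub>\<infinity>j. kern n l k j * z j))) UNIV"
    by (intro has_sum_add hp has_sum_infsum kern_apply_summable[OF n l, of z C] z)
  also have "(\<lambda>j. p j + kern n l k j * z j) = (\<lambda>j. Q (k - j) * x j)"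
    using nn by (auto simp: x p_def kern_def resolvent_def fun_eq_iff)
  finally show ?thesis by (simp add: infsumI algebra_simps)
qed

lemma diag_real: "cnj (Y n l (- int n)) = Y n l (- int n)"
  "Y n l (- int n) = of_real (Re (Y n l (- int n)))"
  using Y_diagonal_real[OF n l] by (auto simp: Reals_cnj_iff of_real_Re)

text \<open>Let \<open>z\<close> be the convolution of \<open>Q\<close> with \<open>x\<close>. The
  nonresonant equations say that \<open>x\<close> is the resolvent times \<open>z\<close>, so
  \<open>z\<close> solves the contracting system and is determined by the two resonant coefficients.
  The equations at \<open>n\<close> and \<open>- n\<close> are then the 2x2 system.\<close>

lemma eigseq_imp:
  assumes x: "x \<in> eigseq l"
  shows "of_real (detuning n l) * x (int n) = offdiag n l * x (- int n)"
    "of_real (detuning n l) * x (- int n) = cnj (offdiag n l) * x (int n)"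
    "x k = x (- int n) * U n l k + x (int n) * cnj (U n l (- k))"
proof -
  define z where "z k = (\<Sum>\<^sub>\<infinity>j. Q (k - j) * x j)" for k
  have nn: "int n \<noteq> - int n" and n1: "n \<ge> 1" using n by (simp_all add: large_def)
  have xs: "(\<lambda>k. cmod (x k)) summable_on UNIV"
    and eq: "of_real (l - (pi * of_int k)\<^sup>2) * x k = z k" for k
    using x by (auto simp: eigseq_def z_def)
  have zb: "cmod (z k) \<le> S * (\<Sum>\<^sub>\<infinity>j. cmod (x j))" for k
    unfolding z_def by (rule Q_apply_summable[OF xs])
  have xz: "x k = (if k = int n then x (int n) else if k = - int n then x (- int n) else of_real (resolvent n l k) * z k)" for k
  proof (cases "\<bar>k\<bar> = int n")
    case False
    have ne: "l - (pi * of_int k)\<^sup>2 \<noteq> 0" by (rule tile_nonzero[OF n1 l False])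
    hence "of_real (resolvent n l k) * z k = x k"
      unfolding eq[symmetric] using False by (simp add: resolvent_def del: of_real_diff of_real_power)
    thus ?thesis using False by auto
  qed auto
  have "z k = x (- int n) * Q (k + int n) + x (int n) * Q (k - int n) + (\<Sum>\<^sub>\<infinity>j. kern n l k j * z j)" for k
    unfolding z_def[of k] by (rule Q_apply_split[OF zb xz])
  hence zY: "z k = x (- int n) * Y n l k + x (int n) * cnj (Y n l (- k))" for k
    by (rule solution_unique[OF n l zb])
  show "of_real (detuning n l) * x (int n) = offdiag n l * x (- int n)"
    using eq[of "int n"] zY[of "int n"] diag_real by (simp add: detuning_def offdiag_def algebra_simps)
  show "of_real (detuning n l) * x (- int n) = cnj (offdiag n l) * x (int n)"
    using eq[of "- int n"] zY[of "- int n"] diag_real by (simp add: detuning_def offdiag_def algebra_simps)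
  show "x k = x (- int n) * U n l k + x (int n) * cnj (U n l (- k))"
    by (subst xz) (use nn in \<open>auto simp: U_def zY resolvent_def algebra_simps\<close>)
qed

text \<open>The elimination run backwards; the absolute summability of the result comes from that of
  the resolvent on the tile.\<close>

lemma eigseqI:
  assumes e1: "of_real (detuning n l) * \<alpha> = offdiag n l * \<beta>" and e2: "of_real (detuning n l) * \<beta> = cnj (offdiag n l) * \<alpha>"
  shows "(\<lambda>k. \<beta> * U n l k + \<alpha> * cnj (U n l (- k))) \<in> eigseq l"
proof -
  define x where "x k = \<beta> * U n l k + \<alpha> * cnj (U n l (- k))" for k
  define z where "z k = \<beta> * Y n l k + \<alpha> * cnj (Y n l (- k))" for k
  have nn: "int n \<noteq> - int n" and n1: "n \<ge> 1" using n by (simp_all add: large_def)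
  have xz: "x k = (if k = int n then \<alpha> else if k = - int n then \<beta> else of_real (resolvent n l k) * z k)" for k
    using nn by (auto simp: x_def z_def U_def resolvent_def algebra_simps)
  define C where "C = (cmod \<beta> + cmod \<alpha>) * (2 * S)"
  have zb: "cmod (z k) \<le> C" for k unfolding z_def C_def by (rule combination_bound[OF n l])
  have zeq: "z k = \<beta> * Q (k + int n) + \<alpha> * Q (k - int n) + (\<Sum>\<^sub>\<infinity>j. kern n l k j * z j)" for k
    unfolding z_def kern_apply_combination[OF n l] by (simp add: algebra_simps)
  have Qx: "(\<Sum>\<^sub>\<infinity>j. Q (k - j) * x j) = z k" for k
    by (rule trans[OF Q_apply_split[OF zb xz] zeq[symmetric]])
  have xs: "(\<lambda>k. cmod (x k)) summable_on UNIV"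
  proof (rule summable_on_comparison_test)
    show "(\<lambda>k. \<bar>resolvent n l k\<bar> * C + ((if k = int n then cmod \<alpha> else 0) + (if k = - int n then cmod \<beta> else 0))) summable_on UNIV"
      by (intro summable_on_add summable_on_cmult_left resolvent_summable n1 l finite_nonzero_values_imp_summable_on) auto
    fix k show "cmod (x k) \<le> \<bar>resolvent n l k\<bar> * C + ((if k = int n then cmod \<alpha> else 0) + (if k = - int n then cmod \<beta> else 0))"
      using mult_left_mono[OF zb[of k], of "\<bar>resolvent n l k\<bar>"] nn by (auto simp: xz norm_mult resolvent_def)
  qed auto
  have "of_real (l - (pi * of_int k)\<^sup>2) * x k = z k" for k
  proof (cases "\<bar>k\<bar> = int n")
    case True
    hence "k = int n \<or> k = - int n" by auto
    thus ?thesis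
    proof
      assume "k = int n"
      thus ?thesis using e1 diag_real nn by (simp add: xz z_def detuning_def offdiag_def algebra_simps)
    next
      assume "k = - int n"
      thus ?thesis using e2 diag_real nn by (simp add: xz z_def detuning_def offdiag_def algebra_simps)
    qed
  next
    case False
    have ne: "l - (pi * of_int k)\<^sup>2 \<noteq> 0" by (rule tile_nonzero[OF n1 l False])
    thus ?thesis using False by (auto simp: xz resolvent_def simp del: of_real_diff of_real_power)
  qed
  thus ?thesis using xs Qx by (simp add: eigseq_def x_def)
qed

end

text \<open>The determinant is the square of \<open>detuning\<close> minus that of
  \<open>|offdiag|\<close>, so \<open>r1\<close> and \<open>r2\<close> are the zeros of
  \<open>detuning + |offdiag|\<close> and \<open>detuning - |offdiag|\<close>. Both functions are
  close to the identity up to a constant. At a double root both entries vanish.\<close>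

lemma tile_roots:
  assumes n: "large n"
  obtains r1 r2 where "r1 \<le> r2" "r1 \<in> tile n" "r2 \<in> tile n"
    "\<bar>r1 - (pi * real n)\<^sup>2\<bar> \<le> 4 * S" "\<bar>r2 - (pi * real n)\<^sup>2\<bar> \<le> 4 * S"
    "\<And>l. l \<in> tile n \<Longrightarrow> \<bar>detuning n l\<bar> = cmod (offdiag n l) \<longleftrightarrow> l = r1 \<or> l = r2"
    "r1 = r2 \<longleftrightarrow> offdiag n r2 = 0" "r1 = r2 \<longleftrightarrow> offdiag n r1 = 0"
    "cmod (offdiag n r2) \<le> r2 - r1"
proof -
  define A where "A = ((real n - 1/2) * pi)\<^sup>2"
  define B where "B = ((real n + 1/2) * pi)\<^sup>2"
  have tl: "tile n = {A..B}" by (simp add: tile_def A_def B_def)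
  have n1: "real n \<ge> 1" "8 * S + 1 \<le> real n" using n by (simp_all add: large_def)
  have p4: "pi\<^sup>2 \<ge> 4" using power_mono[OF pi_ge_two, of 2] by simp
  have An: "A = (pi * real n)\<^sup>2 - pi\<^sup>2 * (real n - 1/4)" "B = (pi * real n)\<^sup>2 + pi\<^sup>2 * (real n + 1/4)"
    by (simp_all add: A_def B_def power2_eq_square algebra_simps)
  have p3: "pi\<^sup>2 * (real n - 1/4) \<ge> 4 * (real n - 1/4)" "pi\<^sup>2 * (real n + 1/4) \<ge> 4 * (real n + 1/4)"
    using p4 n1 by (intro mult_right_mono; simp)+
  \<comment> \<open>The radius \<open>4 * S\<close> allows \<open>2 * S\<close> for the diagonal and
    \<open>2 * S\<close> for the off-diagonal entry.\<close>
  have mid: "A \<le> (pi * real n)\<^sup>2 - 4 * S" "B \<ge> (pi * real n)\<^sup>2 + 4 * S"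
  proof -
    have "pi\<^sup>2 * (real n - 1/4) \<ge> 4 * S"
      by (rule order_trans[OF _ p3(1)]) (use n1 S_nonneg in simp)
    moreover have "pi\<^sup>2 * (real n + 1/4) \<ge> 4 * S"
      by (rule order_trans[OF _ p3(2)]) (use n1 S_nonneg in simp)
    ultimately show "A \<le> (pi * real n)\<^sup>2 - 4 * S" "B \<ge> (pi * real n)\<^sup>2 + 4 * S" unfolding An by simp_all
  qed
  hence AB: "A \<le> B" using S_nonneg by linarith
  have ab: "\<bar>Re (Y n l (- int n))\<bar> \<le> 2 * S" "cmod (offdiag n l) \<le> 2 * S" if "l \<in> {A..B}" for l
    using Y_bound[OF n, of l] that abs_Re_le_cmod order_trans unfolding tl offdiag_def by blast+
  have lip: "\<bar>detuning n x - detuning n y - (x - y)\<bar> \<le> \<bar>x - y\<bar> / 8" "\<bar>cmod (offdiag n x) - cmod (offdiag n y)\<bar> \<le> \<bar>x - y\<bar> / 8"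
    if "x \<in> {A..B}" "y \<in> {A..B}" for x y
  proof -
    have L: "cmod (Y n x k - Y n y k) \<le> \<bar>x - y\<bar> / 8" for k
      by (rule Y_Lipschitz[OF n]) (use that tl in auto)
    have "\<bar>Re (Y n x (- int n) - Y n y (- int n))\<bar> \<le> \<bar>x - y\<bar> / 8"
      using abs_Re_le_cmod L order_trans by blast
    thus "\<bar>detuning n x - detuning n y - (x - y)\<bar> \<le> \<bar>x - y\<bar> / 8" by (simp add: detuning_def abs_minus_commute)
    show "\<bar>cmod (offdiag n x) - cmod (offdiag n y)\<bar> \<le> \<bar>x - y\<bar> / 8"
      using L[of "int n"] norm_triangle_ineq3 order_trans unfolding offdiag_def by blast
  qed
  have dA: "detuning n A \<le> - cmod (offdiag n A)" "detuning n B \<ge> cmod (offdiag n B)"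
    using ab[of A] ab[of B] mid AB by (auto simp: detuning_def)
  have root: "\<exists>r. r \<in> {A..B} \<and> detuning n r + \<sigma> * cmod (offdiag n r) = 0 \<and>
      (\<forall>x\<in>{A..B}. (x < r \<longrightarrow> detuning n x + \<sigma> * cmod (offdiag n x) < 0) \<and> (x > r \<longrightarrow> detuning n x + \<sigma> * cmod (offdiag n x) > 0))"
    if \<sigma>: "\<sigma> = 1 \<or> \<sigma> = - 1" for \<sigma> :: real
  proof (rule near_identity_root[OF AB, of "\<lambda>x. detuning n x + \<sigma> * cmod (offdiag n x)"], goal_cases)
    case (1 x y)
    have eq: "detuning n x + \<sigma> * cmod (offdiag n x) - (detuning n y + \<sigma> * cmod (offdiag n y)) - (x - y)
      = (detuning n x - detuning n y - (x - y)) + \<sigma> * (cmod (offdiag n x) - cmod (offdiag n y))" by (simp add: algebra_simps)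
    have "\<bar>\<sigma> * (cmod (offdiag n x) - cmod (offdiag n y))\<bar> \<le> \<bar>x - y\<bar> / 8" using lip(2)[OF 1] \<sigma> by (auto simp: abs_mult)
    from add_mono[OF lip(1)[OF 1] this] show ?case unfolding eq
      by (intro order_trans[OF abs_triangle_ineq]) simp
  next
    case 2
    have "\<sigma> * cmod (offdiag n A) \<le> 1 * cmod (offdiag n A)" using \<sigma> by (intro mult_right_mono) auto
    thus ?case using dA(1) by linarith
  next
    case 3
    have "- 1 * cmod (offdiag n B) \<le> \<sigma> * cmod (offdiag n B)" using \<sigma> by (intro mult_right_mono) auto
    thus ?case using dA(2) by linarith
  next
    case (4 r) thus ?case by blast
  qed
  obtain r1 where r1: "r1 \<in> {A..B}" "detuning n r1 + cmod (offdiag n r1) = 0"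
    "\<And>x. x \<in> {A..B} \<Longrightarrow> x < r1 \<Longrightarrow> detuning n x + cmod (offdiag n x) < 0" "\<And>x. x \<in> {A..B} \<Longrightarrow> x > r1 \<Longrightarrow> detuning n x + cmod (offdiag n x) > 0"
    using root[of 1] by auto
  obtain r2 where r2: "r2 \<in> {A..B}" "detuning n r2 - cmod (offdiag n r2) = 0"
    "\<And>x. x \<in> {A..B} \<Longrightarrow> x < r2 \<Longrightarrow> detuning n x - cmod (offdiag n x) < 0" "\<And>x. x \<in> {A..B} \<Longrightarrow> x > r2 \<Longrightarrow> detuning n x - cmod (offdiag n x) > 0"
    using root[of "- 1"] by auto
  have le: "r1 \<le> r2"
    using r1(3)[OF r2(1)] r2(2) norm_ge_zero[of "offdiag n r2"] by force
  show ?thesis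
  proof (rule that[of r1 r2])
    show "r1 \<le> r2" by (rule le)
    show "r1 \<in> tile n" "r2 \<in> tile n" using r1 r2 tl by auto
    show "\<bar>r1 - (pi * real n)\<^sup>2\<bar> \<le> 4 * S" using ab[OF r1(1)] r1(2) norm_ge_zero[of "offdiag n r1"] unfolding detuning_def by linarith
    show "\<bar>r2 - (pi * real n)\<^sup>2\<bar> \<le> 4 * S" using ab[OF r2(1)] r2(2) norm_ge_zero[of "offdiag n r2"] unfolding detuning_def by linarith
    show "\<bar>detuning n l\<bar> = cmod (offdiag n l) \<longleftrightarrow> l = r1 \<or> l = r2" if "l \<in> tile n" for l
    proof
      assume a: "\<bar>detuning n l\<bar> = cmod (offdiag n l)"
      have l: "l \<in> {A..B}" using that tl by simp
      from a have "detuning n l + cmod (offdiag n l) = 0 \<or> detuning n l - cmod (offdiag n l) = 0" by linarith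
      thus "l = r1 \<or> l = r2" using r1(3,4)[OF l] r2(3,4)[OF l] by (metis less_irrefl linorder_neqE_linordered_idom)
    next
      assume "l = r1 \<or> l = r2"
      hence "detuning n l = - cmod (offdiag n l) \<or> detuning n l = cmod (offdiag n l)" using r1(2) r2(2) by auto
      thus "\<bar>detuning n l\<bar> = cmod (offdiag n l)" by auto
    qed
    show "r1 = r2 \<longleftrightarrow> offdiag n r2 = 0"
    proof
      assume "r1 = r2" thus "offdiag n r2 = 0" using r1(2) r2(2) by simp
    next
      assume "offdiag n r2 = 0" thus "r1 = r2" using r2(2) r1(4)[OF r2(1)] le by force
    qed
    show "r1 = r2 \<longleftrightarrow> offdiag n r1 = 0"
    proof
      assume "r1 = r2" thus "offdiag n r1 = 0" using r1(2) r2(2) by simp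
    next
      assume "offdiag n r1 = 0" thus "r1 = r2" using r1(2) r2(3)[OF r1(1)] le by force
    qed
    \<comment> \<open>The increment of \<open>detuning\<close> is \<open>|offdiag|\<close> at
      \<open>r2\<close> plus \<open>|offdiag|\<close> at \<open>r1\<close>, and at most 9/8 of the
      gap; the two moduli differ by at most 1/8 of it. Adding up, twice the modulus at
      \<open>r2\<close> is at most 10/8 of the gap.\<close>
    show "cmod (offdiag n r2) \<le> r2 - r1"
      using lip[OF r2(1) r1(1), THEN abs_le_D1] r1(2) r2(2) le by (simp add: field_simps)
  qed
qed

end

section \<open>Fourier series of period 2\<close>

definition fmode :: "int \<Rightarrow> real \<Rightarrow> complex" where
  "fmode k x = cis (pi * of_int k * x)"

lemma fmode_add: "fmode (j + k) x = fmode j x * fmode k x"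
  by (simp add: fmode_def cis_mult algebra_simps)

lemma fmode_0 [simp]: "fmode 0 x = 1" "fmode k 0 = 1" by (simp_all add: fmode_def)

lemma norm_cisk [simp]: "cmod (fmode k x) = 1" by (simp add: fmode_def)

lemma fmode_minus: "fmode (- k) x = cnj (fmode k x)" by (simp add: fmode_def cis_cnj)

lemma fmode_mult_minus: "fmode k x * fmode (- k) x = 1" by (simp add: fmode_add[symmetric])

lemma fmode_periodic: "fmode k (x + 2) = fmode k x"
proof -
  have "cis (pi * of_int k * (x + 2)) = cis (pi * of_int k * x) * cis (2 * pi * of_int k)"
    by (simp add: cis_mult algebra_simps)
  thus ?thesis by (simp add: fmode_def cis_multiple_2pi)
qed

lemma fmode_shift_one: "fmode k (x + 1) = (if even k then 1 else - 1) * fmode k x"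
proof -
  have e: "cis (pi * of_int k * (x + 1)) = cis (pi * of_int k * x) * cis (pi * of_int k)"
    by (simp add: cis_mult algebra_simps)
  show ?thesis
  proof (cases "even k")
    case True
    then obtain m where "k = 2 * m" by auto
    hence "cis (pi * of_int k) = 1" using cis_multiple_2pi[of "of_int m"] by (simp add: mult_ac)
    thus ?thesis using True e by (simp add: fmode_def)
  next
    case False
    then obtain m where "k = 2 * m + 1" by (auto elim: oddE)
    hence "pi * of_int k = 2 * pi * of_int m + pi" by (simp add: algebra_simps)
    hence "cis (pi * of_int k) = cis (2 * pi * of_int m) * cis pi" by (simp only: cis_mult)
    thus ?thesis using False e by (simp add: fmode_def cis_multiple_2pi)
  qed
qed

lemma fmode_deriv: "(fmode k has_vector_derivative (\<i> * of_real (pi * of_int k) * fmode k x)) (at x within A)"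
proof -
  have "((\<lambda>t. exp (\<i> * of_real (pi * of_int k) * of_real t)) has_vector_derivative
     (\<i> * of_real (pi * of_int k) * exp (\<i> * of_real (pi * of_int k) * of_real x))) (at x within A)"
    by (auto intro!: derivative_eq_intros has_vector_derivative_real_field)
  thus ?thesis by (simp add: fmode_def[abs_def] cis_conv_exp mult_ac)
qed

lemma fmode_continuous [continuous_intros]: "continuous_on A (fmode k)"
  by (rule continuous_on_vector_derivative) (rule fmode_deriv)

abbreviation M2 :: "real measure" where "M2 \<equiv> lebesgue_on {0..2}"

text \<open>Coefficients with respect to the period 2: for a potential \<open>q\<close> of period 1, \<open>fc q (2 * m)\<close> is
  \<open>fourier_coeff q m\<close>, and the odd coefficients vanish.\<close>

definition fc :: "(real \<Rightarrow> complex) \<Rightarrow> int \<Rightarrow> complex" where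
  "fc f k = (LINT x|M2. f x * fmode (- k) x) / 2"

lemma continuous_M2_measurable: "continuous_on {0..2} f \<Longrightarrow> f \<in> borel_measurable M2"
  for f :: "real \<Rightarrow> complex"
  by (rule borel_measurable_integrable[OF continuous_imp_integrable_real])

lemma integrable_mult_bounded:
  fixes f h :: "real \<Rightarrow> complex"
  assumes f: "integrable M2 f" and h: "h \<in> borel_measurable M2" "\<And>x. x \<in> {0..2} \<Longrightarrow> cmod (h x) \<le> C"
  shows "integrable M2 (\<lambda>x. f x * h x)"
proof (rule Bochner_Integration.integrable_bound)
  show "integrable M2 (\<lambda>x. C * cmod (f x))" using f by auto
  show "(\<lambda>x. f x * h x) \<in> borel_measurable M2" using borel_measurable_integrable[OF f] h(1) by measurable
  show "AE x in M2. norm (f x * h x) \<le> norm (C * cmod (f x))"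
  proof (rule AE_I2)
    fix x assume "x \<in> space M2"
    hence "cmod (h x) \<le> C" using h(2) by simp
    hence "cmod (f x) * cmod (h x) \<le> cmod (f x) * \<bar>C\<bar>" by (intro mult_left_mono) auto
    thus "norm (f x * h x) \<le> norm (C * cmod (f x))" by (simp add: norm_mult abs_mult mult_ac)
  qed
qed

lemma fmode_measurable: "fmode k \<in> borel_measurable M2"
  by (rule continuous_M2_measurable[OF fmode_continuous])

lemma integrable_mult_cisk:
  assumes "integrable M2 f" shows "integrable M2 (\<lambda>x. f x * fmode k x)"
  by (rule integrable_mult_bounded[OF assms fmode_measurable, of _ 1]) simp

lemma fc_add: "integrable M2 f \<Longrightarrow> integrable M2 g \<Longrightarrow> fc (\<lambda>x. f x + g x) k = fc f k + fc g k"
  by (simp add: fc_def distrib_right integrable_mult_cisk add_divide_distrib)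

lemma fc_diff: "integrable M2 f \<Longrightarrow> integrable M2 g \<Longrightarrow> fc (\<lambda>x. f x - g x) k = fc f k - fc g k"
  by (simp add: fc_def left_diff_distrib integrable_mult_cisk diff_divide_distrib)

lemma fc_cmult: "fc (\<lambda>x. c * f x) k = c * fc f k"
  by (simp add: fc_def mult.assoc)

lemma fc_mult_cisk: "fc (\<lambda>x. f x * fmode j x) k = fc f (k - j)"
  by (simp add: fc_def mult.assoc fmode_add[symmetric] algebra_simps)

lemma fc_norm_le: "cmod (fc f k) \<le> (LINT x|M2. cmod (f x)) / 2"
proof -
  have "cmod (LINT x|M2. f x * fmode (- k) x) \<le> (LINT x|M2. cmod (f x * fmode (- k) x))"
    by (rule integral_norm_bound)
  thus ?thesis by (simp add: fc_def norm_divide norm_mult)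
qed

lemma fc_cong_AE:
  assumes "f \<in> borel_measurable M2" "g \<in> borel_measurable M2" "AE x in M2. f x = g x"
  shows "fc f k = fc g k"
proof -
  have "(LINT x|M2. f x * fmode (- k) x) = (LINT x|M2. g x * fmode (- k) x)"
    by (rule integral_cong_AE) (use assms fmode_measurable in \<open>auto intro!: borel_measurable_times\<close>)
  thus ?thesis by (simp add: fc_def)
qed

lemma fc_const_1: "fc (\<lambda>_. c) k = (if k = 0 then c else 0)"
proof (cases "k = 0")
  case False
  define d where "d = \<i> * of_real (pi * of_int (- k))"
  have d0: "d \<noteq> 0" using False by (simp add: d_def)
  have "((\<lambda>x. d * fmode (- k) x) has_integral (fmode (- k) 2 - fmode (- k) 0)) {0..2}"
    by (rule fundamental_theorem_of_calculus) (auto simp only: d_def intro!: fmode_deriv)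
  hence "integral {0..2} (\<lambda>x. d * fmode (- k) x) = fmode (- k) 2 - fmode (- k) 0" by (rule integral_unique)
  also have "fmode (- k) 2 = 1" using fmode_periodic[of "- k" 0] by simp
  finally have "integral {0..2} (\<lambda>x. d * fmode (- k) x) = 0" by simp
  moreover have "(LINT x|M2. d * fmode (- k) x) = integral {0..2} (\<lambda>x. d * fmode (- k) x)"
    by (rule lebesgue_integral_eq_integral) (auto intro!: continuous_imp_integrable_real continuous_intros simp del: integral_mult_right_zero)
  ultimately have "(LINT x|M2. fmode (- k) x) = 0" using d0 by simp
  thus ?thesis using False by (simp add: fc_def)
next
  case True
  have "(LINT x|M2. c) = integral {0..2::real} (\<lambda>x. c)"
    by (rule lebesgue_integral_eq_integral) (auto intro!: continuous_imp_integrable_real)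
  thus ?thesis using True by (simp add: fc_def scaleR_conv_of_real)
qed

lemma integrable_const_M2: "integrable M2 (\<lambda>_. c)" for c :: complex
  by (rule continuous_imp_integrable_real) auto

lemma fc_cisk: "fc (fmode j) k = (if k = j then 1 else 0)"
  using fc_mult_cisk[of "\<lambda>_. 1" j k] by (simp add: fc_const_1)

lemma square_integrable_imp_integrable:
  fixes a b :: real
  assumes "square_integrable_on f {a..b}" shows "integrable (lebesgue_on {a..b}) f"
proof (rule Bochner_Integration.integrable_bound)
  show "integrable (lebesgue_on {a..b}) (\<lambda>x. 1 + (cmod (f x))\<^sup>2)"
    using assms by (auto simp: square_integrable_on_def intro!: Bochner_Integration.integrable_add continuous_imp_integrable_real)
  show "f \<in> borel_measurable (lebesgue_on {a..b})" using assms by (simp add: square_integrable_on_def)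
  have "c \<le> 1 + c\<^sup>2" for c :: real
    using zero_le_power2[of "c - 1/2"] by (simp add: power2_eq_square algebra_simps)
  thus "AE x in lebesgue_on {a..b}. norm (f x) \<le> norm (1 + (cmod (f x))\<^sup>2)" by (auto simp: add_nonneg_nonneg)
qed

lemma continuous_square_integrable: "continuous_on {0..2} f \<Longrightarrow> square_integrable_on f {0..2}"
  by (auto simp: square_integrable_on_def continuous_M2_measurable intro!: continuous_imp_integrable_real continuous_intros)

lemma Bessel:
  assumes f: "square_integrable_on f {0..2}" and K: "finite K"
  shows "(\<Sum>k\<in>K. (cmod (fc f k))\<^sup>2) \<le> (LINT x|M2. (cmod (f x))\<^sup>2) / 2"
proof -
  define P where "P x = (\<Sum>k\<in>K. fc f k * fmode k x)" for x
  have int: "integrable M2 f" by (rule square_integrable_imp_integrable[OF f])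
  have Pc: "continuous_on {0..2} P" unfolding P_def by (intro continuous_intros)
  have P2: "(\<lambda>x. P x * cnj (P x)) = (\<lambda>x. \<Sum>k\<in>K. cnj (fc f k) * (P x * fmode (- k) x))"
    by (simp add: P_def[of "_"] sum_distrib_left fmode_minus mult_ac fun_eq_iff)
  have fP: "(\<lambda>x. f x * cnj (P x)) = (\<lambda>x. \<Sum>k\<in>K. cnj (fc f k) * (f x * fmode (- k) x))"
    by (simp add: P_def[of "_"] sum_distrib_left fmode_minus mult_ac fun_eq_iff)
  have fcP: "fc P k = fc f k" if "k \<in> K" for k
  proof -
    have "fc P k = (LINT x|M2. (\<Sum>j\<in>K. fc f j * (fmode j x * fmode (- k) x))) / 2"
      by (simp add: fc_def P_def sum_distrib_right mult.assoc)
    also have "\<dots> = (\<Sum>j\<in>K. fc f j * fc (fmode j) k)"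
      by (subst Bochner_Integration.integral_sum)
         (auto simp: fc_def sum_divide_distrib intro!: continuous_imp_integrable_real continuous_intros)
    also have "\<dots> = fc f k" using that K by (simp add: fc_cisk sum.delta' if_distrib[of "\<lambda>x. _ * x"] cong: if_cong)
    finally show ?thesis .
  qed
  define N where "N = (\<Sum>k\<in>K. (cmod (fc f k))\<^sup>2)"
  have Pi: "integrable M2 P" by (rule continuous_imp_integrable_real[OF Pc])
  have i1: "integrable M2 (\<lambda>x. f x * cnj (P x))" "integrable M2 (\<lambda>x. P x * cnj (P x))"
    unfolding P2 fP
    by (intro Bochner_Integration.integrable_sum integrable_mult_right integrable_mult_cisk int Pi)+
  have "(LINT x|M2. f x * cnj (P x)) = (\<Sum>k\<in>K. cnj (fc f k) * (2 * fc f k))"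
    unfolding fP by (subst Bochner_Integration.integral_sum)
      (auto intro!: integrable_mult_right integrable_mult_cisk int simp: fc_def)
  also have "\<dots> = (\<Sum>k\<in>K. of_real (2 * (cmod (fc f k))\<^sup>2))"
    by (intro sum.cong) (auto simp: complex_norm_square mult_ac simp del: of_real_power)
  also have "\<dots> = of_real (2 * N)" by (simp add: N_def sum_distrib_left)
  finally have v1: "(LINT x|M2. Re (f x * cnj (P x))) = 2 * N" by (subst integral_Re[OF i1(1)]) simp
  have "(LINT x|M2. P x * cnj (P x)) = (\<Sum>k\<in>K. cnj (fc f k) * (2 * fc P k))"
    unfolding P2 by (subst Bochner_Integration.integral_sum)
      (auto intro!: integrable_mult_right integrable_mult_cisk Pi simp: fc_def)
  also have "\<dots> = (\<Sum>k\<in>K. of_real (2 * (cmod (fc f k))\<^sup>2))"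
    by (intro sum.cong) (auto simp: fcP complex_norm_square mult_ac simp del: of_real_power)
  also have "\<dots> = of_real (2 * N)" by (simp add: N_def sum_distrib_left)
  finally have v2: "(LINT x|M2. Re (P x * cnj (P x))) = 2 * N" by (subst integral_Re[OF i1(2)]) simp
  define A B where "A x = Re (f x * cnj (P x))" and "B x = Re (P x * cnj (P x))" for x
  have AB: "integrable M2 A" "integrable M2 B" "integral\<^sup>L M2 A = 2 * N" "integral\<^sup>L M2 B = 2 * N"
    using integrable_Re[OF i1(1)] integrable_Re[OF i1(2)] v1 v2 unfolding A_def[abs_def] B_def[abs_def] by simp_all
  have pt: "(cmod (f x - P x))\<^sup>2 = (cmod (f x))\<^sup>2 - 2 * A x + B x" for x
    unfolding cmod_power2 A_def B_def by (simp add: power2_eq_square algebra_simps)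
  have "0 \<le> (LINT x|M2. (cmod (f x - P x))\<^sup>2)" by simp
  also have "\<dots> = (LINT x|M2. (cmod (f x))\<^sup>2) - 2 * (2 * N) + 2 * N"
    unfolding pt using f AB by (simp add: square_integrable_on_def)
  finally show ?thesis by (simp add: N_def)
qed

lemma fc_square_summable:
  assumes "square_integrable_on f {0..2}"
  shows "(\<lambda>k. (cmod (fc f k))\<^sup>2) summable_on UNIV"
  by (rule nonneg_bdd_above_summable_on) (auto intro!: bdd_aboveI2 Bessel assms)

text \<open>Riemann-Lebesgue, read off from the square summability of the coefficients.\<close>

lemma fc_tendsto_0:
  assumes f: "square_integrable_on f {0..2}" and i: "inj i"
  shows "(\<lambda>n::nat. fc f (i n)) \<longlonglongrightarrow> 0"
proof -
  have "(\<lambda>k. (cmod (fc f k))\<^sup>2) summable_on range i"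
    using fc_square_summable[OF f] summable_on_subset by blast
  hence "(\<lambda>n. (cmod (fc f (i n)))\<^sup>2) summable_on UNIV"
    by (subst (asm) summable_on_reindex[OF i]) (simp add: o_def)
  hence "(\<lambda>n. (cmod (fc f (i n)))\<^sup>2) \<longlonglongrightarrow> 0"
    by (intro summable_LIMSEQ_zero summable_on_imp_summable)
  hence "(\<lambda>n. cmod (fc f (i n))) \<longlonglongrightarrow> 0" using tendsto_real_sqrt by force
  thus ?thesis by (rule tendsto_norm_zero_cancel)
qed

lemma has_vector_derivative_quotient:
  assumes "(f has_vector_derivative D) (at x)"
  shows "((\<lambda>t. (f t - f x) /\<^sub>R (t - x)) \<longlongrightarrow> D) (at x)"
proof -
  have "((\<lambda>y. (f y - f x - (y - x) *\<^sub>R D) /\<^sub>R \<bar>y - x\<bar>) \<longlongrightarrow> 0) (at x)"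
    using assms by (simp add: has_vector_derivative_def has_derivative_at_within)
  hence "((\<lambda>y. norm ((f y - f x - (y - x) *\<^sub>R D) /\<^sub>R \<bar>y - x\<bar>)) \<longlongrightarrow> 0) (at x)"
    by (rule tendsto_norm_zero)
  moreover have "\<forall>\<^sub>F y in at x. norm ((f y - f x - (y - x) *\<^sub>R D) /\<^sub>R \<bar>y - x\<bar>)
      = norm ((f y - f x) /\<^sub>R (y - x) - D)"
  proof (rule eventually_at_filter[THEN iffD2], rule always_eventually, intro allI impI)
    fix y assume y: "y \<noteq> x"
    have "(f y - f x) /\<^sub>R (y - x) - D = (f y - f x - (y - x) *\<^sub>R D) /\<^sub>R (y - x)"
      using y by (simp add: scaleR_diff_right)
    thus "norm ((f y - f x - (y - x) *\<^sub>R D) /\<^sub>R \<bar>y - x\<bar>) = norm ((f y - f x) /\<^sub>R (y - x) - D)"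
      by simp
  qed
  ultimately have "((\<lambda>y. norm ((f y - f x) /\<^sub>R (y - x) - D)) \<longlongrightarrow> 0) (at x)"
    by (rule Lim_transform_eventually)
  thus ?thesis by (simp add: tendsto_norm_zero_iff LIM_zero_iff)
qed

text \<open>Chernoff's argument: dividing \<open>f - f x0\<close> by \<open>fmode 1 (t - x0) - 1\<close> turns the Fourier
  partial sum at \<open>x0\<close> into a telescoping sum.\<close>

lemma Fourier_partial_sums:
  assumes f: "continuous_on {0..2} f" and x0: "0 < x0" "x0 < 2"
    and d: "(f has_vector_derivative f') (at x0)"
  shows "(\<lambda>N. \<Sum>k\<in>{- int N..int N}. fc f k * fmode k x0) \<longlonglongrightarrow> f x0"
proof -
  define v where "v t = fmode 1 (t - x0) - 1" for t
  \<comment> \<open>The value at \<open>x0\<close> is the quotient of the derivatives of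
    \<open>f - f x0\<close> and \<open>v\<close>, which makes \<open>g\<close> continuous.\<close>
  define g where "g t = (if t = x0 then f' / (\<i> * pi) else (f t - f x0) / v t)" for t
  \<comment> \<open>The other zeros of \<open>v\<close> have distance at least 2 from
    \<open>x0\<close>, so they lie outside \<open>{0..2}\<close> because \<open>x0\<close> is an
    interior point.\<close>
  have vne: "v t \<noteq> 0" if "t \<in> {0..2}" "t \<noteq> x0" for t
  proof
    assume "v t = 0"
    hence "cis (pi * (t - x0)) = 1" by (simp add: v_def fmode_def)
    hence "cos (pi * (t - x0)) = 1" by (simp add: complex_eq_iff)
    then obtain m :: int where "pi * (t - x0) = of_int m * 2 * pi" by (auto simp: cos_one_2pi_int)
    hence m: "t - x0 = 2 * of_int m" by simp
    have "\<bar>t - x0\<bar> < 2" using that x0 by (auto simp: abs_if)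
    hence "m = 0" using m by (auto simp: abs_if split: if_splits)
    thus False using m that by simp
  qed
  have dv: "(v has_vector_derivative (\<i> * pi)) (at x0)"
  proof -
    have "((\<lambda>t. fmode 1 (t - x0)) has_vector_derivative (1 *\<^sub>R (\<i> * pi))) (at x0)"
      using vector_diff_chain_at[of "\<lambda>t. t - x0" 1 x0 "fmode 1" "\<i> * pi"] fmode_deriv[of 1 0 UNIV]
        has_vector_derivative_diff[OF has_vector_derivative_id has_vector_derivative_const[of x0]]
      by (simp add: o_def)
    thus ?thesis unfolding v_def by (auto intro!: derivative_eq_intros)
  qed
  have gc: "continuous_on {0..2} g"
    unfolding continuous_on_eq_continuous_within
  proof
    fix t :: real assume t: "t \<in> {0..2}"
    show "continuous (at t within {0..2}) g"
    proof (cases "t = x0")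
      case False
      have "continuous_on ({0..2} - {x0}) (\<lambda>t. (f t - f x0) / v t)"
        using vne unfolding v_def
        by (intro continuous_intros continuous_on_subset[OF f] continuous_on_compose2[OF fmode_continuous[of UNIV]]) auto
      hence "continuous_on ({0..2} - {x0}) g"
        by (subst continuous_on_cong[OF refl, of _ _ "\<lambda>t. (f t - f x0) / v t"]) (auto simp: g_def)
      hence "continuous (at t within ({0..2} - {x0})) g"
        using t False by (auto simp: continuous_on_eq_continuous_within)
      moreover have "at t within ({0..2} - {x0}) = at t within {0..2}"
        by (rule at_within_nhd[of _ "- {x0}"]) (use False in auto)
      ultimately show ?thesis by simp
    next
      case True
      have "((\<lambda>t. (f t - f x0) /\<^sub>R (t - x0)) \<longlongrightarrow> f') (at x0)" "((\<lambda>t. (v t - v x0) /\<^sub>R (t - x0)) \<longlongrightarrow> \<i> * pi) (at x0)"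
        using d dv by (auto intro: has_vector_derivative_quotient)
      hence "((\<lambda>t. ((f t - f x0) /\<^sub>R (t - x0)) / ((v t - v x0) /\<^sub>R (t - x0))) \<longlongrightarrow> f' / (\<i> * pi)) (at x0)"
        by (intro tendsto_divide) auto
      hence "(g \<longlongrightarrow> f' / (\<i> * pi)) (at x0)"
        by (rule Lim_transform_eventually) (auto simp: eventually_at_filter g_def v_def scaleR_conv_of_real divide_simps)
      hence "isCont g x0" by (simp add: isCont_def g_def)
      thus ?thesis using True continuous_at_imp_continuous_at_within by blast
    qed
  qed
  have gsq: "square_integrable_on g {0..2}" by (rule continuous_square_integrable[OF gc])
  note gi = square_integrable_imp_integrable[OF gsq]
  define h where "h k = fc g k * fmode k x0" for k
  have "f t = (g t * fmode 1 t) * fmode (-1) x0 - g t + f x0" if "t \<in> {0..2}" for t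
  proof (cases "t = x0")
    case False
    have "f t = g t * v t + f x0" using vne[OF that False] False by (simp add: g_def)
    also have "v t = fmode 1 t * fmode (-1) x0 - 1"
      by (simp add: v_def fmode_def cis_mult algebra_simps)
    finally show ?thesis by (simp add: algebra_simps)
  qed (simp add: fmode_mult_minus mult.assoc)
  hence "fc f k = fc (\<lambda>t. fmode (-1) x0 * (g t * fmode 1 t) - g t + f x0) k" for k
    unfolding fc_def by (intro arg_cong[where f = "\<lambda>x. x / 2"] Bochner_Integration.integral_cong) (auto simp: mult_ac)
  also have "\<dots> k = fmode (-1) x0 * fc g (k - 1) - fc g k + (if k = 0 then f x0 else 0)" for k
  proof -
    have i: "integrable M2 (\<lambda>t. fmode (-1) x0 * (g t * fmode 1 t))"
      by (intro integrable_mult_right integrable_mult_cisk gi)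
    show ?thesis
      by (subst fc_add[OF Bochner_Integration.integrable_diff[OF i gi] integrable_const_M2], subst fc_diff[OF i gi])
         (simp add: fc_cmult fc_mult_cisk fc_const_1)
  qed
  finally have fck: "fc f k = fmode (-1) x0 * fc g (k - 1) - fc g k + (if k = 0 then f x0 else 0)" for k .
  have step: "fc f k * fmode k x0 = h (k - 1) - h k + (if k = 0 then f x0 else 0)" for k
  proof -
    have "fmode (k - 1) x0 = fmode k x0 * fmode (-1) x0" using fmode_add[of k "-1" x0] by simp
    thus ?thesis by (simp add: fck h_def algebra_simps)
  qed
  have sum: "(\<Sum>k\<in>{- int N..int N}. fc f k * fmode k x0) = f x0 + (h (- int N - 1) - h (int N))" for N
  proof (induction N)
    case 0 show ?case using step[of 0] by simp
  next
    case (Suc N)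
    have "{- int (Suc N)..int (Suc N)} = insert (int N + 1) (insert (- int N - 1) {- int N..int N})" by auto
    hence "(\<Sum>k\<in>{- int (Suc N)..int (Suc N)}. fc f k * fmode k x0)
      = fc f (int N + 1) * fmode (int N + 1) x0 + (fc f (- int N - 1) * fmode (- int N - 1) x0
        + (\<Sum>k\<in>{- int N..int N}. fc f k * fmode k x0))"
      by simp
    also have "\<dots> = (h (int N) - h (int N + 1)) + ((h (- 2 - int N) - h (- int N - 1))
        + (f x0 + (h (- int N - 1) - h (int N))))"
      unfolding Suc using step[of "int N + 1"] step[of "- int N - 1"] by simp
    finally have e: "(\<Sum>k\<in>{- int (Suc N)..int (Suc N)}. fc f k * fmode k x0) = f x0 + (h (- 2 - int N) - h (int N + 1))"
      by simp
    have "h (- int (Suc N) - 1) = h (- 2 - int N)" by (rule arg_cong[of _ _ h]) simp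
    thus ?case unfolding e by (simp add: add.commute)
  qed
  have h0: "(\<lambda>N. h (i N)) \<longlonglongrightarrow> 0" if "(\<lambda>N. fc g (i N)) \<longlonglongrightarrow> 0" for i :: "nat \<Rightarrow> int"
    by (rule Lim_null_comparison[OF _ tendsto_norm_zero[OF that]]) (simp add: h_def norm_mult)
  have "inj (\<lambda>n. - int n - 1)" by (auto intro: injI)
  hence "(\<lambda>N. fc g (- int N - 1)) \<longlonglongrightarrow> 0" "(\<lambda>N. fc g (int N)) \<longlonglongrightarrow> 0"
    using fc_tendsto_0[OF gsq] by auto
  hence "(\<lambda>N. h (- int N - 1)) \<longlonglongrightarrow> 0" "(\<lambda>N. h (int N)) \<longlonglongrightarrow> 0"
    by (simp_all only: h0)
  hence "(\<lambda>N. f x0 + (h (- int N - 1) - h (int N))) \<longlonglongrightarrow> f x0 + (0 - 0)"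
    by (intro tendsto_intros)
  thus ?thesis by (simp add: sum)
qed

section \<open>Absolutely convergent Fourier series\<close>

definition fsynth :: "(int \<Rightarrow> complex) \<Rightarrow> real \<Rightarrow> complex" where
  "fsynth x t = (\<Sum>\<^sub>\<infinity>k. x k * fmode k t)"

lemma fsynth_periodic: "fsynth x (t + 2) = fsynth x t"
  by (simp add: fsynth_def fmode_periodic)

abbreviation tail :: "(int \<Rightarrow> complex) \<Rightarrow> int set \<Rightarrow> real" where
  "tail x F \<equiv> (\<Sum>\<^sub>\<infinity>k\<in>- F. cmod (x k))"

context
  fixes x :: "int \<Rightarrow> complex"
  assumes xs: "(\<lambda>k. cmod (x k)) summable_on UNIV"
begin

lemma fsynth_has_sum: "((\<lambda>k. x k * fmode k t) has_sum fsynth x t) UNIV"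
  unfolding fsynth_def by (rule has_sum_infsum, rule abs_summable_summable) (use xs in \<open>simp add: norm_mult\<close>)

lemma fsynth_tail:
  assumes F: "finite F"
  shows "cmod (fsynth x t - (\<Sum>k\<in>F. x k * fmode k t)) \<le> tail x F"
proof -
  have s: "(\<lambda>k. x k * fmode k t) summable_on A" for A
    using fsynth_has_sum has_sum_imp_summable summable_on_subset_banach by blast
  have "fsynth x t = (\<Sum>k\<in>F. x k * fmode k t) + (\<Sum>\<^sub>\<infinity>k\<in>- F. x k * fmode k t)"
    unfolding fsynth_def using infsum_Un_disjoint[OF s s, of F "- F"] F by simp
  hence "fsynth x t - (\<Sum>k\<in>F. x k * fmode k t) = (\<Sum>\<^sub>\<infinity>k\<in>- F. x k * fmode k t)" by simp
  also have "cmod \<dots> \<le> (\<Sum>\<^sub>\<infinity>k\<in>- F. cmod (x k * fmode k t))"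
    by (rule norm_infsum_bound) (use summable_on_subset[OF xs] in \<open>simp add: norm_mult\<close>)
  finally show ?thesis by (simp add: norm_mult)
qed

lemma fsynth_tail_tendsto_0: "((\<lambda>F. tail x F) \<longlongrightarrow> 0) (finite_subsets_at_top UNIV)"
proof -
  have "((\<lambda>F. (\<Sum>\<^sub>\<infinity>k. cmod (x k)) - (\<Sum>k\<in>F. cmod (x k))) \<longlongrightarrow> (\<Sum>\<^sub>\<infinity>k. cmod (x k)) - (\<Sum>\<^sub>\<infinity>k. cmod (x k)))
     (finite_subsets_at_top UNIV)"
    by (intro tendsto_intros infsum_tendsto xs)
  moreover have "\<forall>\<^sub>F F in finite_subsets_at_top UNIV.
     (\<Sum>\<^sub>\<infinity>k. cmod (x k)) - (\<Sum>k\<in>F. cmod (x k)) = tail x F"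
  proof (rule eventually_finite_subsets_at_top_weakI)
    fix F :: "int set" assume "finite F"
    moreover have "(\<Sum>\<^sub>\<infinity>k\<in>F \<union> - F. cmod (x k)) = (\<Sum>\<^sub>\<infinity>k\<in>F. cmod (x k)) + tail x F"
      by (rule infsum_Un_disjoint) (auto intro: summable_on_subset[OF xs])
    ultimately show "(\<Sum>\<^sub>\<infinity>k. cmod (x k)) - (\<Sum>k\<in>F. cmod (x k)) = tail x F" by simp
  qed
  ultimately show ?thesis using Lim_transform_eventually by force
qed

lemma fsynth_continuous: "continuous_on A (fsynth x)"
proof (rule uniform_limit_theorem[where f = "\<lambda>F t. \<Sum>k\<in>F. x k * fmode k t" and F = "finite_subsets_at_top UNIV"])
  show "\<forall>\<^sub>F F in finite_subsets_at_top UNIV. continuous_on A (\<lambda>t. \<Sum>k\<in>F. x k * fmode k t)"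
    by (intro always_eventually allI continuous_intros)
  show "uniform_limit A (\<lambda>F t. \<Sum>k\<in>F. x k * fmode k t) (fsynth x) (finite_subsets_at_top UNIV)"
    unfolding fsynth_def[abs_def] by (rule Weierstrass_m_test_general[OF _ xs]) (simp add: norm_mult)
qed auto

lemma integrable_mult_syn:
  assumes h: "integrable M2 h" shows "integrable M2 (\<lambda>t. h t * fsynth x t)"
proof (rule integrable_mult_bounded[OF h continuous_M2_measurable[OF fsynth_continuous]])
  fix t show "cmod (fsynth x t) \<le> (\<Sum>\<^sub>\<infinity>k\<in>- {}. cmod (x k))" using fsynth_tail[of "{}" t] by simp
qed

text \<open>Turns multiplication by \<open>h\<close> into convolution. For a finite sum this is the
  shift rule for coefficients, and the tail of \<open>x\<close> bounds the remaining error uniformly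
  in \<open>t\<close>.\<close>

lemma fc_mult_syn:
  assumes h: "integrable M2 h"
  shows "((\<lambda>j. fc h (k - j) * x j) has_sum fc (\<lambda>t. h t * fsynth x t) k) UNIV"
proof -
  have bd: "cmod (fc (\<lambda>t. h t * fsynth x t) k - (\<Sum>j\<in>F. fc h (k - j) * x j))
      \<le> (LINT t|M2. cmod (h t)) * tail x F" if F: "finite F" for F
  proof -
    define P where "P t = (\<Sum>j\<in>F. x j * fmode j t)" for t
    have hP: "(\<lambda>t. h t * P t) = (\<lambda>t. \<Sum>j\<in>F. x j * (h t * fmode j t))"
      by (simp add: P_def sum_distrib_left mult_ac fun_eq_iff)
    have iP: "integrable M2 (\<lambda>t. h t * P t)"
      unfolding hP by (intro Bochner_Integration.integrable_sum integrable_mult_right integrable_mult_cisk h)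
    have "fc (\<lambda>t. h t * P t) k = (\<Sum>j\<in>F. fc (\<lambda>t. x j * (h t * fmode j t)) k)"
      unfolding hP fc_def sum_distrib_right sum_divide_distrib[symmetric]
      by (subst Bochner_Integration.integral_sum) (intro integrable_mult_cisk integrable_mult_right h, simp)
    also have "\<dots> = (\<Sum>j\<in>F. x j * fc h (k - j))" by (simp only: fc_cmult fc_mult_cisk)
    also have "\<dots> = (\<Sum>j\<in>F. fc h (k - j) * x j)" by (simp only: mult.commute)
    finally have "fc (\<lambda>t. h t * fsynth x t) k - (\<Sum>j\<in>F. fc h (k - j) * x j) = fc (\<lambda>t. h t * fsynth x t - h t * P t) k"
      by (simp add: fc_diff integrable_mult_syn[OF h] iP)
    also have "cmod \<dots> \<le> (LINT t|M2. cmod (h t * fsynth x t - h t * P t)) / 2" by (rule fc_norm_le)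
    also have "\<dots> \<le> (LINT t|M2. cmod (h t) * tail x F) / 2"
    proof (intro divide_right_mono integral_mono)
      fix t
      have "cmod (h t * fsynth x t - h t * P t) = cmod (h t) * cmod (fsynth x t - P t)"
        by (simp add: norm_mult[symmetric] right_diff_distrib)
      also have "\<dots> \<le> cmod (h t) * tail x F"
        unfolding P_def by (intro mult_left_mono fsynth_tail F) auto
      finally show "cmod (h t * fsynth x t - h t * P t) \<le> cmod (h t) * tail x F" .
    qed (use h iP integrable_mult_syn[OF h] in auto)
    also have "\<dots> = (LINT t|M2. cmod (h t)) * tail x F / 2" by simp
    also have "\<dots> \<le> (LINT t|M2. cmod (h t)) * tail x F"
    proof -
      have "0 \<le> (LINT t|M2. cmod (h t)) * tail x F"
        by (intro mult_nonneg_nonneg Bochner_Integration.integral_nonneg infsum_nonneg) auto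
      thus ?thesis by linarith
    qed
    finally show ?thesis .
  qed
  have "((\<lambda>F. (\<Sum>j\<in>F. fc h (k - j) * x j) - fc (\<lambda>t. h t * fsynth x t) k) \<longlongrightarrow> 0) (finite_subsets_at_top UNIV)"
  proof (rule Lim_null_comparison)
    show "\<forall>\<^sub>F F in finite_subsets_at_top UNIV. cmod ((\<Sum>j\<in>F. fc h (k - j) * x j) - fc (\<lambda>t. h t * fsynth x t) k)
       \<le> (LINT t|M2. cmod (h t)) * tail x F"
      by (rule eventually_finite_subsets_at_top_weakI) (subst norm_minus_commute, rule bd)
    show "((\<lambda>F. (LINT t|M2. cmod (h t)) * tail x F) \<longlongrightarrow> 0) (finite_subsets_at_top UNIV)"
      using tendsto_mult_left[OF fsynth_tail_tendsto_0, of "LINT t|M2. cmod (h t)"] by simp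
  qed
  thus ?thesis unfolding has_sum_def by (simp add: LIM_zero_iff)
qed

lemma fc_syn: "fc (fsynth x) k = x k"
proof -
  have "((\<lambda>j. fc (\<lambda>_. 1) (k - j) * x j) has_sum fc (\<lambda>t. 1 * fsynth x t) k) UNIV"
    by (rule fc_mult_syn[OF integrable_const_M2])
  moreover have "((\<lambda>j. fc (\<lambda>_. 1) (k - j) * x j) has_sum x k) UNIV"
    by (rule has_sum_finite_neutralI[of "{k}"]) (auto simp: fc_const_1)
  ultimately show ?thesis using has_sum_unique by force
qed

end

lemma periodic_int:
  fixes f :: "real \<Rightarrow> 'a" assumes "\<And>x. f (x + 2) = f x"
  shows "f (x + 2 * of_int m) = f x"
proof -
  have nat: "f (x + 2 * real n) = f x" for x n
  proof (induction n)
    case (Suc n)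
    have "f (x + 2 * real (Suc n)) = f ((x + 2 * real n) + 2)" by (simp add: algebra_simps)
    thus ?case using assms Suc by simp
  qed simp
  show ?thesis
  proof (cases "m \<ge> 0")
    case True thus ?thesis using nat[of x "nat m"] by simp
  next
    case False thus ?thesis using nat[of "x + 2 * of_int m" "nat (- m)"] by simp
  qed
qed

lemma periodic_eqI:
  fixes f g :: "real \<Rightarrow> 'a"
  assumes "\<And>x. f (x + 2) = f x" "\<And>x. g (x + 2) = g x" "\<And>x. x \<in> {0..2} \<Longrightarrow> f x = g x"
  shows "f x = g x"
proof -
  define y where "y = x - 2 * of_int \<lfloor>x / 2\<rfloor>"
  have "y \<in> {0..2}" unfolding y_def by (auto; linarith)
  moreover have "x = y + 2 * of_int \<lfloor>x / 2\<rfloor>" by (simp add: y_def)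
  ultimately show ?thesis using periodic_int[of f y, OF assms(1)] periodic_int[of g y, OF assms(2)] assms(3) by metis
qed

text \<open>Reads symmetric partial sums as a subnet of the unordered sum, so that the two kinds of
  limit can be compared.\<close>

lemma int_intervals_exhaust: "filterlim (\<lambda>N. {- int N..int N}) (finite_subsets_at_top UNIV) sequentially"
  unfolding filterlim_finite_subsets_at_top
proof (intro allI impI)
  fix X :: "int set" assume X: "finite X \<and> X \<subseteq> UNIV"
  have "\<forall>\<^sub>F N in sequentially. \<forall>k\<in>X. k \<in> {- int N..int N}"
  proof (rule eventually_ball_finite)
    show "\<forall>k\<in>X. \<forall>\<^sub>F N in sequentially. k \<in> {- int N..int N}"
    proof
      fix k show "\<forall>\<^sub>F N in sequentially. k \<in> {- int N..int N}"
        using eventually_ge_at_top[of "nat \<bar>k\<bar>"] by eventually_elim auto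
    qed
  qed (use X in auto)
  thus "\<forall>\<^sub>F N in sequentially. finite {- int N..int N} \<and> X \<subseteq> {- int N..int N} \<and> {- int N..int N} \<subseteq> UNIV"
    by eventually_elim auto
qed

text \<open>The symmetric partial sums tend to \<open>f\<close> by differentiability and to the
  synthesis by absolute summability, at interior points of the period. Continuity of both sides adds
  the end points, and periodicity the rest of the line.\<close>

lemma Fourier_series:
  assumes per: "\<And>t. f (t + 2) = f t" and d: "\<And>t. (f has_vector_derivative f1 t) (at t)"
    and s: "(\<lambda>k. cmod (fc f k)) summable_on UNIV"
  shows "f t = fsynth (fc f) t"
proof -
  have fcont: "continuous_on A f" for A
    by (rule continuous_on_vector_derivative) (use d has_vector_derivative_at_within in blast)
  have inner: "f t - fsynth (fc f) t = 0" if "t \<in> {0<..<2}" for t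
  proof -
    have "(\<lambda>N. \<Sum>k\<in>{- int N..int N}. fc f k * fmode k t) \<longlonglongrightarrow> fsynth (fc f) t"
      using filterlim_compose[OF fsynth_has_sum[OF s, of t, unfolded has_sum_def] int_intervals_exhaust] by simp
    moreover have "(\<lambda>N. \<Sum>k\<in>{- int N..int N}. fc f k * fmode k t) \<longlonglongrightarrow> f t"
      by (rule Fourier_partial_sums[OF fcont _ _ d]) (use that in auto)
    ultimately show ?thesis using LIMSEQ_unique by fastforce
  qed
  have on: "f t - fsynth (fc f) t = 0" if "t \<in> {0..2}" for t
  proof (rule continuous_constant_on_closure[of "{0<..<2}" "\<lambda>t. f t - fsynth (fc f) t"])
    show "continuous_on (closure {0<..<2}) (\<lambda>t. f t - fsynth (fc f) t)"
      by (rule continuous_on_diff[OF fcont fsynth_continuous[OF s]])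
    show "t \<in> closure {0<..<2}" using that by simp
  qed (rule inner)
  have "f t = fsynth (fc f) t" if "t \<in> {0..2}" for t using on[OF that] by (rule eq_iff_diff_eq_0[THEN iffD2])
  thus ?thesis by (rule periodic_eqI[of f "fsynth (fc f)", OF per fsynth_periodic])
qed

section \<open>Periodic antiderivatives of integrable functions\<close>

lemmas hk_integral_combine = Henstock_Kurzweil_Integration.integral_combine
lemmas hk_integrable_combine = Henstock_Kurzweil_Integration.integrable_combine

text \<open>Integration by parts for an indefinite integral, by Fubini on the triangle \<open>s \<le> t\<close>.\<close>

lemma fc_indefinite_integral:
  assumes g: "integrable M2 g" and g0: "fc g 0 = 0"
  shows "fc g k = \<i> * of_real (pi * of_int k) * fc (\<lambda>t. integral {0..t} g) k"
proof (cases "k = 0")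
  case True thus ?thesis using g0 by simp
next
  case False
  define e where "e = fmode (- k)"
  define d where "d = \<i> * of_real (pi * of_int (- k))"
  have d0: "d \<noteq> 0" using False by (simp add: d_def)
  interpret F: finite_measure M2 by (rule finite_measure_lebesgue_on) auto
  interpret P: pair_sigma_finite M2 M2 by unfold_locales
  have gm [measurable]: "g \<in> borel_measurable M2" by (rule borel_measurable_integrable[OF g])
  have em [measurable]: "e \<in> borel_measurable M2" unfolding e_def by (rule fmode_measurable)
  have idm: "(\<lambda>x::real. x) \<in> borel_measurable M2"
    using id_borel_measurable_lebesgue_on[of "{0..2::real}"] by (simp add: id_def)
  have m1 [measurable]: "fst \<in> borel_measurable (M2 \<Otimes>\<^sub>M M2)"
    by (rule measurable_compose[OF measurable_fst idm])
  have m2 [measurable]: "snd \<in> borel_measurable (M2 \<Otimes>\<^sub>M M2)"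
    by (rule measurable_compose[OF measurable_snd idm])
  have sets: "{s \<in> space M2. s \<le> t} \<in> sets M2" "{s \<in> space M2. t \<le> s} \<in> sets M2" for t
    using borel_measurable_le[OF idm borel_measurable_const[of t]]
      borel_measurable_le[OF borel_measurable_const[of t] idm] by simp_all
  define K where "K s t = (if s \<le> t then g s * e t else 0)" for s t
  have iH: "integrable (M2 \<Otimes>\<^sub>M M2) (\<lambda>p. g (fst p))"
  proof (rule P.Fubini_integrable)
    show "(\<lambda>p. g (fst p)) \<in> borel_measurable (M2 \<Otimes>\<^sub>M M2)" by measurable
    show "integrable M2 (\<lambda>x. LINT y|M2. norm (g (fst (x, y))))" using g by simp
    show "AE x in M2. integrable M2 (\<lambda>y. g (fst (x, y)))" by simp
  qed
  have iK: "integrable (M2 \<Otimes>\<^sub>M M2) (case_prod K)"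
  proof (rule Bochner_Integration.integrable_bound[OF iH])
    have "(\<lambda>p. if fst p \<le> snd p then g (fst p) * e (snd p) else 0) \<in> borel_measurable (M2 \<Otimes>\<^sub>M M2)"
      by measurable
    thus "case_prod K \<in> borel_measurable (M2 \<Otimes>\<^sub>M M2)" by (simp add: K_def case_prod_unfold)
    show "AE p in M2 \<Otimes>\<^sub>M M2. norm (case_prod K p) \<le> norm (g (fst p))"
      by (auto simp: K_def e_def norm_mult)
  qed
  have inner1: "(LINT s|M2. K s t) = integral {0..t} g * e t" if t: "t \<in> {0..2}" for t
  proof -
    have gt: "integrable M2 (\<lambda>s. if s \<in> {..t} then g s else 0)"
      by (rule Bochner_Integration.integrable_bound[OF g]) (simp only: atMost_iff measurable_If[OF gm borel_measurable_const sets(1)], auto)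
    have "(LINT s|M2. K s t) = (LINT s|M2. (if s \<in> {..t} then g s else 0) * e t)"
      by (intro Bochner_Integration.integral_cong) (auto simp: K_def)
    also have "\<dots> = (LINT s|M2. (if s \<in> {..t} then g s else 0)) * e t" by simp
    also have "(LINT s|M2. (if s \<in> {..t} then g s else 0)) = integral {0..2} (\<lambda>s. if s \<in> {..t} then g s else 0)"
      by (rule lebesgue_integral_eq_integral[OF gt]) simp
    also have "\<dots> = integral ({0..2} \<inter> {..t}) g" by (subst Int_commute, rule integral_restrict_Int)
    also have "{0..2} \<inter> {..t} = {0..t}" using t by auto
    finally show ?thesis .
  qed
  have inner2: "(LINT t|M2. K s t) = (g s - g s * e s) / d" if s: "s \<in> {0..2}" for s
  proof -
    have et: "integrable M2 (\<lambda>t. if t \<in> {s..} then e t else 0)"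
      by (rule Bochner_Integration.integrable_bound[OF integrable_const_M2[of 1]]) (simp only: atLeast_iff measurable_If[OF em borel_measurable_const sets(2)], auto simp: e_def)
    have "(LINT t|M2. K s t) = (LINT t|M2. g s * (if t \<in> {s..} then e t else 0))"
      by (intro Bochner_Integration.integral_cong) (auto simp: K_def)
    also have "\<dots> = g s * (LINT t|M2. (if t \<in> {s..} then e t else 0))" by simp
    also have "(LINT t|M2. (if t \<in> {s..} then e t else 0)) = integral {0..2} (\<lambda>t. if t \<in> {s..} then e t else 0)"
      by (rule lebesgue_integral_eq_integral[OF et]) simp
    also have "\<dots> = integral ({0..2} \<inter> {s..}) e" by (subst Int_commute, rule integral_restrict_Int)
    also have "{0..2} \<inter> {s..} = {s..2}" using s by auto
    also have "integral {s..2} e = (1 - e s) / d"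
    proof -
      have "((\<lambda>t. d * e t) has_integral (e 2 - e s)) {s..2}"
        unfolding e_def by (rule fundamental_theorem_of_calculus) (use s in \<open>auto simp only: d_def atLeastAtMost_iff intro!: fmode_deriv\<close>)
      from has_integral_mult_right[OF this, of "1 / d"]
      have "(e has_integral ((1 / d) * (e 2 - e s))) {s..2}" using d0 by simp
      moreover have "e 2 = 1" unfolding e_def using fmode_periodic[of "- k" 0] by simp
      ultimately show ?thesis by (simp add: integral_unique)
    qed
    finally show ?thesis by (simp add: algebra_simps)
  qed
  have ge: "integrable M2 (\<lambda>s. g s * e s)" unfolding e_def by (rule integrable_mult_cisk[OF g])
  have "(LINT t|M2. integral {0..t} g * e t) = (LINT t|M2. LINT s|M2. K s t)"
    by (intro Bochner_Integration.integral_cong) (auto simp: inner1)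
  also have "\<dots> = (LINT s|M2. LINT t|M2. K s t)" by (rule P.Fubini_integral[OF iK])
  also have "\<dots> = (LINT s|M2. (g s - g s * e s) / d)"
    by (intro Bochner_Integration.integral_cong) (auto simp: inner2)
  also have "\<dots> = ((LINT s|M2. g s) - (LINT s|M2. g s * e s)) / d" using g ge by simp
  \<comment> \<open>This is the boundary term coming from \<open>e 2 = 1\<close>, a multiple of the
    mean of \<open>g\<close>.\<close>
  also have "(LINT s|M2. g s) = 0" using g0 by (simp add: fc_def)
  finally have "fc (\<lambda>t. integral {0..t} g) k = - fc g k / d" by (simp add: fc_def e_def)
  thus ?thesis using d0 by (simp add: d_def)
qed

lemma fc_add_const:
  assumes "integrable M2 f" shows "fc (\<lambda>t. f t + c) k = fc f k + (if k = 0 then c else 0)"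
  using fc_add[OF assms integrable_const_M2, of c k] by (simp add: fc_const_1)

lemma periodic_integrable_intervals:
  fixes g :: "real \<Rightarrow> complex"
  assumes per: "\<And>x. g (x + 2) = g x" and g: "g integrable_on {0..2}"
  shows "g integrable_on {a..b}"
    and "integral {a + 2 * of_int m..b + 2 * of_int m} g = integral {a..b} g"
proof -
  have sh: "g \<circ> (+) (2 * of_int m) = g" for m
    using periodic_int[of g _ m, OF per] by (auto simp: fun_eq_iff add.commute)
  have block: "g integrable_on {2 * of_int m..2 * of_int m + 2}" for m
    using integrable_on_shift_Icc_real[of g "2 * of_int m" 0 2] g by (simp add: sh add.commute)
  have blocks: "g integrable_on {2 * of_int m..2 * of_int m + 2 * real n}" for m n
  proof (induction n)
    case (Suc n)
    have "g integrable_on {2 * of_int m + 2 * real n..2 * of_int m + 2 * real n + 2}"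
      using block[of "m + int n"] by (simp add: algebra_simps)
    from hk_integrable_combine[OF _ _ Suc this]
    have "g integrable_on {2 * of_int m..2 * of_int m + 2 * real n + 2}" by simp
    thus ?case by (simp add: algebra_simps)
  next
    case 0 show ?case using integrable_on_refl[of g "2 * of_int m"] by simp
  qed
  define m0 where "m0 = \<lfloor>a / 2\<rfloor>"
  define n0 where "n0 = nat \<lceil>b / 2 - of_int m0\<rceil>"
  have "2 * of_int m0 \<le> a" unfolding m0_def by linarith
  moreover have "b \<le> 2 * of_int m0 + 2 * real n0" unfolding n0_def by linarith
  ultimately show "g integrable_on {a..b}"
    by (intro integrable_on_subinterval[OF blocks[of m0 n0]]) auto
  show "integral {a + 2 * of_int m..b + 2 * of_int m} g = integral {a..b} g"
    using integral_shift_Icc_real[of a b g "2 * of_int m"] by (simp add: sh)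
qed

text \<open>A vanishing mean makes the antiderivative periodic. The constant of integration is spent
  on prescribing the coefficient at 0, so with \<open>c = 0\<close> the construction can be
  repeated.\<close>

lemma periodic_antiderivative:
  assumes per: "\<And>x. g (x + 2) = g x" and g: "integrable M2 g" and g0: "fc g 0 = 0"
  obtains G where "\<And>x. G (x + 2) = G x" "continuous_on UNIV G"
    "\<And>a b. a \<le> b \<Longrightarrow> (g has_integral (G b - G a)) {a..b}"
    "fc G 0 = c" "\<And>k. fc g k = \<i> * of_real (pi * of_int k) * fc G k"
proof -
  have g02: "g integrable_on {0..2}" by (rule integrable_on_lebesgue_on[OF g]) simp
  note gi = periodic_integrable_intervals[of g, OF per g02]
  \<comment> \<open>The signed integral from 0 to \<open>t\<close>: one of the two terms is always
    0, being an integral over an empty or one-point interval.\<close>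
  define I where "I t = integral {0..t} g - integral {t..0} g" for t :: real
  have Idiff: "I b - I a = integral {a..b} g" if ab: "a \<le> b" for a b
  proof -
    consider "0 \<le> a" | "b \<le> 0" | "a < 0" "0 < b" by linarith
    thus ?thesis
    proof cases
      case 1 thus ?thesis using ab hk_integral_combine[OF 1 ab gi(1)]
        by (cases "a = 0"; cases "b = 0") (auto simp: I_def algebra_simps)
    next
      case 2 thus ?thesis using ab hk_integral_combine[OF ab 2 gi(1)]
        by (cases "a = 0"; cases "b = 0") (auto simp: I_def algebra_simps)
    next
      case 3 thus ?thesis using hk_integral_combine[of a 0 b, OF _ _ gi(1)]
        by (auto simp: I_def algebra_simps)
    qed
  qed
  have z: "integral {0..2} g = 0"
    using g0 lebesgue_integral_eq_integral[OF g] by (simp add: fc_def)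
  have Iper: "I (x + 2) = I x" for x
  proof -
    define m where "m = \<lfloor>x / 2\<rfloor>"
    define p where "p = 2 * real_of_int m"
    have p: "p \<le> x" "x \<le> p + 2" unfolding p_def m_def by linarith+
    have "I (x + 2) - I x = integral {x..x + 2} g" by (rule Idiff) simp
    also have "\<dots> = integral {x..p + 2} g + integral {p + 2..x + 2} g"
      using hk_integral_combine[of x "p + 2" "x + 2", OF _ _ gi(1)] p by simp
    also have "integral {p + 2..x + 2} g = integral {p..x} g" using gi(2)[of p 1 x] by simp
    also have "integral {x..p + 2} g + integral {p..x} g = integral {p..p + 2} g"
      using hk_integral_combine[of p x "p + 2", OF _ _ gi(1)] p by (simp add: add.commute)
    also have "\<dots> = 0" using gi(2)[of 0 m 2] z by (simp add: p_def add.commute)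
    finally show ?thesis by simp
  qed
  have Icont: "continuous_on UNIV I"
  proof (rule continuous_at_imp_continuous_on, rule ballI)
    fix x :: real
    define R where "R = \<bar>x\<bar> + 1"
    have "continuous_on {- R..R} (\<lambda>t. I (- R) + integral {- R..t} g)"
      by (intro continuous_intros indefinite_integral_continuous_1 gi)
    moreover have "I (- R) + integral {- R..t} g = I t" if "t \<in> {- R..R}" for t
      using Idiff[of "- R" t] that by (auto simp: algebra_simps)
    ultimately have "continuous_on {- R..R} I" by (rule continuous_on_eq)
    thus "isCont I x" by (rule continuous_on_interior) (auto simp: R_def)
  qed
  have Ii: "integrable M2 I"
    by (rule continuous_imp_integrable_real[OF continuous_on_subset[OF Icont]]) auto
  define C where "C = c - fc I 0"
  have right: "integral {t..0} g = 0" if "0 \<le> t" for t using that by (cases "t = 0") auto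
  have fcI: "fc I k = fc (\<lambda>t. integral {0..t} g) k" for k
    unfolding fc_def by (intro arg_cong[where f = "\<lambda>x. x / 2"] Bochner_Integration.integral_cong)
      (auto simp: I_def right)
  show ?thesis
  proof (rule that[of "\<lambda>t. I t + C"])
    show "continuous_on UNIV (\<lambda>t. I t + C)" by (intro continuous_intros Icont)
    show "(g has_integral (I b + C - (I a + C))) {a..b}" if "a \<le> b" for a b
      using Idiff[OF that] gi(1)[of a b] by (simp add: has_integral_iff)
    show "fc (\<lambda>t. I t + C) 0 = c" by (simp add: fc_add_const[OF Ii] C_def)
    show "fc g k = \<i> * of_real (pi * of_int k) * fc (\<lambda>t. I t + C) k" for k
      using fc_indefinite_integral[OF g g0, of k] by (simp add: fc_add_const[OF Ii] fcI)
  qed (simp add: Iper)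
qed

lemma has_integral_imp_derivative:
  fixes f :: "real \<Rightarrow> complex"
  assumes f: "continuous_on UNIV f" and F: "\<And>a b. a \<le> b \<Longrightarrow> (f has_integral (F b - F a)) {a..b}"
  shows "(F has_vector_derivative f x) (at x)"
proof -
  define a b where "a = x - 1" and "b = x + 1"
  have "((\<lambda>u. integral {a..u} f) has_vector_derivative f x) (at x within {a..b})"
    by (rule integral_has_vector_derivative) (auto simp: a_def b_def intro: continuous_on_subset[OF f])
  hence "((\<lambda>u. integral {a..u} f) has_vector_derivative f x) (at x)"
    by (subst (asm) at_within_interior) (auto simp: a_def b_def)
  hence "((\<lambda>u. F a + integral {a..u} f) has_vector_derivative f x) (at x)"
    by (auto intro!: derivative_eq_intros)
  thus ?thesis
  proof (rule has_vector_derivative_transform_within[where d = 1])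
    fix u assume "dist u x < 1"
    hence "a \<le> u" by (auto simp: a_def dist_real_def)
    from integral_unique[OF F[OF this]] show "F a + integral {a..u} f = F u" by simp
  qed auto
qed

section \<open>The periodic eigenspaces\<close>

lemma i_square_factor: "\<i> * a * (\<i> * a * z) = - (a\<^sup>2) * z"
proof -
  have "\<i> * a * (\<i> * a * z) = (\<i> * \<i>) * (a\<^sup>2 * z)" by (simp only: power2_eq_square mult_ac)
  thus ?thesis by simp
qed

locale hill_potential =
  fixes q :: "real \<Rightarrow> complex"
  assumes q_L2: "q \<in> L2_circle" and q_real: "AE x in lebesgue. q x \<in> \<real>"
begin

lemma q_periodic: "q (x + 1) = q x" "q (x + 2) = q x"
proof -
  show *: "q (x + 1) = q x" for x using q_L2 by (simp add: L2_circle_def)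
  show "q (x + 2) = q x" using *[of "x + 1"] *[of x] by (simp add: add.assoc)
qed

lemma q_unit: "square_integrable_on q {0..1}" "integrable (lebesgue_on {0..1}) q" "q integrable_on {0..1}"
proof -
  show 1: "square_integrable_on q {0..1}" using q_L2 by (simp add: L2_circle_def)
  show 2: "integrable (lebesgue_on {0..1}) q" by (rule square_integrable_imp_integrable[OF 1])
  show "q integrable_on {0..1}" by (rule integrable_on_lebesgue_on[OF 2]) simp
qed

lemma q_shifted_unit: "q \<circ> (+) 1 = q"
  using q_periodic(1) by (auto simp: fun_eq_iff add.commute)

lemma q_integrable_on_2: "q integrable_on {0..2}"
proof -
  have "q integrable_on {1..2}" using q_unit(3) integrable_on_shift_Icc_real[of q 1 0 1] by (simp add: q_shifted_unit)
  thus ?thesis using hk_integrable_combine[of 0 1 2 q] q_unit(3) by simp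
qed

lemma q_square_integrable: "square_integrable_on q {0..2}"
proof -
  define h where "h x = (cmod (q x))\<^sup>2" for x
  have h01: "h integrable_on {0..1}"
    using q_unit(1) unfolding square_integrable_on_def h_def[abs_def] by (intro integrable_on_lebesgue_on) auto
  have "h \<circ> (+) 1 = h" using q_periodic(1) by (auto simp: h_def fun_eq_iff add.commute)
  hence "h integrable_on {1..2}" using h01 integrable_on_shift_Icc_real[of h 1 0 1] by simp
  hence "h integrable_on {0..2}" using hk_integrable_combine[of 0 1 2 h] h01 by simp
  hence "h absolutely_integrable_on {0..2}"
    by (rule nonnegative_absolutely_integrable_1) (simp add: h_def)
  hence "integrable M2 h" by (rule absolutely_integrable_imp_integrable) simp
  thus ?thesis using integrable_imp_measurable[OF q_integrable_on_2]
    by (simp add: square_integrable_on_def h_def[abs_def])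
qed

lemma q_integrable: "integrable M2 q"
  by (rule square_integrable_imp_integrable[OF q_square_integrable])

lemma fc_q_eq: "fc q k = (if even k then fourier_coeff q (k div 2) else 0)"
proof -
  define h where "h x = q x * fmode (- k) x" for x
  have hM: "integrable M2 h" unfolding h_def[abs_def] by (rule integrable_mult_cisk[OF q_integrable])
  have hi: "h integrable_on {0..2}" by (rule integrable_on_lebesgue_on[OF hM]) simp
  have h1: "integrable (lebesgue_on {0..1}) h" by (rule integrable_subinterval[OF hM]) simp
  have "h \<circ> (+) 1 = (\<lambda>x. (if even k then 1 else - 1) * h x)"
    using q_periodic(1) fmode_shift_one[of "- k"] by (auto simp: h_def fun_eq_iff add.commute)
  moreover have "integral {1..2} h = integral {0..1} (h \<circ> (+) 1)"
    using integral_shift_Icc_real[of 0 1 h 1] by simp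
  ultimately have "integral {1..2} h = (if even k then 1 else - 1) * integral {0..1} h" by simp
  moreover have "integral {0..2} h = integral {0..1} h + integral {1..2} h"
    using hk_integral_combine[of 0 1 2 h] hi by simp
  moreover have "fc q k = integral {0..2} h / 2"
    using lebesgue_integral_eq_integral[OF hM] by (simp add: fc_def h_def[symmetric])
  ultimately have e: "fc q k = (if even k then integral {0..1} h else 0)" by auto
  show ?thesis
  proof (cases "even k")
    case True
    then obtain m where m: "k = 2 * m" by auto
    have "fourier_coeff q m = (LINT x|lebesgue_on {0..1}. h x)"
      unfolding fourier_coeff_def h_def by (simp add: m fmode_def cis_conv_exp mult_ac)
    also have "\<dots> = integral {0..1} h" by (rule lebesgue_integral_eq_integral[OF h1]) simp
    finally show ?thesis using e True m by simp
  qed (use e in simp)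
qed

lemma AE_M2: "AE x in lebesgue. P x \<Longrightarrow> AE x in M2. P x"
  by (subst AE_restrict_space_iff) (auto elim: eventually_mono)

lemma fc_q_minus: "fc q (- k) = cnj (fc q k)"
proof -
  have "fc q (- k) = fc (\<lambda>x. cnj (q x)) (- k)"
  proof (rule fc_cong_AE)
    show qm: "q \<in> borel_measurable M2" using q_square_integrable by (simp add: square_integrable_on_def)
    show "(\<lambda>x. cnj (q x)) \<in> borel_measurable M2"
      by (rule borel_measurable_integrable[OF integrable_cnj[OF q_integrable]])
    show "AE x in M2. q x = cnj (q x)"
      using AE_M2[OF q_real] by eventually_elim (simp add: Reals_cnj_iff)
  qed
  also have "\<dots> = (LINT x|M2. cnj (q x * fmode (- k) x)) / 2"
    by (simp add: fc_def fmode_minus)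
  also have "\<dots> = cnj (fc q k)" unfolding Bochner_Integration.integral_cnj by (simp add: fc_def)
  finally show ?thesis .
qed

sublocale hermitian_coeffs "fc q"
  by unfold_locales (rule fc_q_minus, rule fc_square_summable[OF q_square_integrable])

text \<open>Integrating by parts twice, the coefficients of the second derivative \<open>g\<close>
  are \<open>- (pi k)^2\<close> times those of \<open>f\<close>. As the former are bounded, the
  latter decay like \<open>1 / k^2\<close>, so the Fourier series of \<open>f\<close> converges
  absolutely and represents it.\<close>

lemma eigenfunction_coeffs:
  assumes f: "f \<in> hill_eigenspace q (of_real l)"
  shows "fc f \<in> eigseq l" "f = fsynth (fc f)"
proof -
  from f obtain f1 g where per: "\<And>x. f (x + 2) = f x"
    and d: "\<And>x. (f has_vector_derivative f1 x) (at x)"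
    and g2: "square_integrable_on g {0..2}"
    and gi: "\<And>a b. a \<le> b \<Longrightarrow> (g has_integral (f1 b - f1 a)) {a..b}"
    and ae: "AE x in lebesgue. - g x + q x * f x = of_real l * f x"
    unfolding hill_eigenspace_def by blast
  have fcont: "continuous_on A f" for A
    by (rule continuous_on_vector_derivative) (use d has_vector_derivative_at_within in blast)
  have f1per: "f1 (x + 2) = f1 x" for x
  proof -
    have "((\<lambda>t. t + 2) has_vector_derivative 1) (at x)"
      using has_vector_derivative_add[OF has_vector_derivative_id has_vector_derivative_const[of "2::real"]] by simp
    from vector_diff_chain_at[OF this d[of "x + 2"]]
    have "((\<lambda>t. f (t + 2)) has_vector_derivative f1 (x + 2)) (at x)" by (simp add: o_def)
    hence "(f has_vector_derivative f1 (x + 2)) (at x)" by (simp add: per)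
    thus ?thesis using d vector_derivative_unique_at by blast
  qed
  have gM: "integrable M2 g" by (rule square_integrable_imp_integrable[OF g2])
  have gint: "integral {0..t} g = f1 t - f1 0" if "t \<in> {0..2}" for t
    by (rule integral_unique[OF gi]) (use that in auto)
  have fint: "integral {0..t} f1 = f t - f 0" if "t \<in> {0..2}" for t
    by (rule integral_unique[OF fundamental_theorem_of_calculus[OF _ has_vector_derivative_at_within[OF d]]])
       (use that in auto)
  have f1c: "continuous_on {0..2} f1"
  proof -
    have "continuous_on {0..2} (\<lambda>t. f1 0 + integral {0..t} g)"
      by (intro continuous_intros indefinite_integral_continuous_1 integrable_on_lebesgue_on[OF gM]) simp
    thus ?thesis by (rule continuous_on_eq) (simp add: gint)
  qed
  note f1M = continuous_imp_integrable_real[OF f1c]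
  note fM = continuous_imp_integrable_real[OF fcont]
  have fcI: "fc (\<lambda>t. h t - h 0) k = fc h k - (if k = 0 then h 0 else 0)" if "integrable M2 h" for h k
    using fc_add_const[OF that, of "- h 0" k] by auto
  have cong: "fc h k = fc h' k" if "\<And>t. t \<in> {0..2} \<Longrightarrow> h t = h' t" for h h' k
    unfolding fc_def by (intro arg_cong[where f = "\<lambda>x. x / 2"] Bochner_Integration.integral_cong) (auto simp: that)
  have g0: "fc g 0 = 0"
    using lebesgue_integral_eq_integral[OF gM] gint[of 2] f1per[of 0] by (simp add: fc_def)
  have f10: "fc f1 0 = 0"
    using lebesgue_integral_eq_integral[OF f1M] fint[of 2] per[of 0] by (simp add: fc_def)
  have s1: "fc g k = \<i> * of_real (pi * of_int k) * fc f1 k" for k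
    using fc_indefinite_integral[OF gM g0, of k] cong[OF gint, where k = k] fcI[OF f1M, of k] by auto
  have s2: "fc f1 k = \<i> * of_real (pi * of_int k) * fc f k" for k
    using fc_indefinite_integral[OF f1M f10, of k] cong[OF fint, where k = k] fcI[OF fM, of k] by auto
  have s3: "fc g k = - of_real ((pi * of_int k)\<^sup>2) * fc f k" for k
    unfolding s1 s2 i_square_factor by simp
  have summ: "(\<lambda>k. cmod (fc f k)) summable_on UNIV"
  proof (rule summable_on_comparison_test)
    define C where "C = (LINT x|M2. cmod (g x)) / 2"
    show "(\<lambda>k. C * inv_sq k + (if k = 0 then cmod (fc f 0) else 0)) summable_on UNIV"
      by (intro summable_on_add summable_on_cmult_right inv_sq_summable finite_nonzero_values_imp_summable_on) auto
    fix k show "cmod (fc f k) \<le> C * inv_sq k + (if k = 0 then cmod (fc f 0) else 0)"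
    proof (cases "k = 0")
      case False
      have "(real_of_int k)\<^sup>2 * cmod (fc f k) \<le> (pi * of_int k)\<^sup>2 * cmod (fc f k)"
        using power_mono[OF pi_ge_two, of 2] mult_right_mono[of 1 "pi\<^sup>2" "(real_of_int k)\<^sup>2"]
        by (intro mult_right_mono) (auto simp: power_mult_distrib)
      also have "\<dots> = cmod (fc g k)" unfolding s3 by (simp add: norm_mult norm_power power_mult_distrib)
      also have "\<dots> \<le> C" unfolding C_def by (rule fc_norm_le)
      finally show ?thesis using False by (simp add: inv_sq_def field_simps)
    qed (simp add: inv_sq_def)
  qed auto
  show fs: "f = fsynth (fc f)" by (rule ext, rule Fourier_series[OF per d summ])
  have "of_real (l - (pi * of_int k)\<^sup>2) * fc f k = (\<Sum>\<^sub>\<infinity>j. fc q (k - j) * fc f j)" for k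
  proof -
    have "(\<Sum>\<^sub>\<infinity>j. fc q (k - j) * fc f j) = fc (\<lambda>t. q t * fsynth (fc f) t) k"
      by (rule infsumI[OF fc_mult_syn[OF summ q_integrable]])
    also have "\<dots> = fc (\<lambda>t. q t * f t) k" using fs by simp
    also have "\<dots> = fc (\<lambda>t. of_real l * f t + g t) k"
    proof (rule fc_cong_AE)
      have "integrable M2 (\<lambda>t. q t * f t)" using integrable_mult_syn[OF summ q_integrable] fs by simp
      thus "(\<lambda>t. q t * f t) \<in> borel_measurable M2" by (rule borel_measurable_integrable)
      show "(\<lambda>t. of_real l * f t + g t) \<in> borel_measurable M2"
        by (intro borel_measurable_integrable Bochner_Integration.integrable_add integrable_mult_right fM gM)
      show "AE t in M2. q t * f t = of_real l * f t + g t"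
        using AE_M2[OF ae] by eventually_elim (simp add: algebra_simps)
    qed
    also have "\<dots> = of_real l * fc f k + fc g k"
      by (simp add: fc_add[OF integrable_mult_right[OF fM] gM] fc_cmult)
    finally show ?thesis unfolding s3 by (simp add: algebra_simps)
  qed
  thus "fc f \<in> eigseq l" using summ by (simp add: eigseq_def)
qed

text \<open>Termwise differentiation is avoided: the only possible second derivative,
  \<open>g = q f - l f\<close>, has mean 0 by the equation at \<open>k = 0\<close> and is integrated
  twice periodically. Choosing the means 0 and \<open>x 0\<close> gives a function with coefficients
  \<open>x\<close>, which must be the synthesis of \<open>x\<close>.\<close>

lemma fsynth_eigenfunction:
  assumes x: "x \<in> eigseq l"
  shows "fsynth x \<in> hill_eigenspace q (of_real l)"
proof -
  have xs: "(\<lambda>k. cmod (x k)) summable_on UNIV"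
    and eq: "\<And>k. of_real (l - (pi * of_int k)\<^sup>2) * x k = (\<Sum>\<^sub>\<infinity>j. fc q (k - j) * x j)"
    using x by (auto simp: eigseq_def)
  define f where "f = fsynth x"
  define g where "g t = q t * f t - of_real l * f t" for t
  have fM: "integrable M2 f" unfolding f_def
    by (rule continuous_imp_integrable_real[OF fsynth_continuous[OF xs]])
  have qfM: "integrable M2 (\<lambda>t. q t * f t)" unfolding f_def by (rule integrable_mult_syn[OF xs q_integrable])
  have gM: "integrable M2 g" unfolding g_def by (intro Bochner_Integration.integrable_diff qfM integrable_mult_right fM)
  have gper: "g (t + 2) = g t" for t by (simp add: g_def q_periodic f_def fsynth_periodic)
  have fcg: "fc g k = - of_real ((pi * of_int k)\<^sup>2) * x k" for k
  proof -
    have "fc g k = fc (\<lambda>t. q t * f t) k - of_real l * fc f k"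
      unfolding g_def by (simp add: fc_diff[OF qfM integrable_mult_right[OF fM]] fc_cmult)
    also have "fc (\<lambda>t. q t * f t) k = of_real (l - (pi * of_int k)\<^sup>2) * x k"
      unfolding f_def eq by (rule infsumI[OF fc_mult_syn[OF xs q_integrable], symmetric])
    also have "fc f k = x k" unfolding f_def by (rule fc_syn[OF xs])
    finally show ?thesis by (simp add: algebra_simps)
  qed
  have g2: "square_integrable_on g {0..2}"
  proof -
    define B where "B = tail x {}"
    have B: "cmod (f t) \<le> B" for t unfolding f_def B_def using fsynth_tail[OF xs, of "{}" t] by simp
    have "integrable M2 (\<lambda>t. (cmod (g t))\<^sup>2)"
    proof (rule Bochner_Integration.integrable_bound)
      show "integrable M2 (\<lambda>t. 2 * B\<^sup>2 * (cmod (q t))\<^sup>2 + 2 * B\<^sup>2 * l\<^sup>2)"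
        using q_square_integrable
        by (auto simp: square_integrable_on_def intro!: Bochner_Integration.integrable_add continuous_imp_integrable_real)
      show "(\<lambda>t. (cmod (g t))\<^sup>2) \<in> borel_measurable M2" using borel_measurable_integrable[OF gM] by measurable
      have "(cmod (g t))\<^sup>2 \<le> 2 * B\<^sup>2 * (cmod (q t))\<^sup>2 + 2 * B\<^sup>2 * l\<^sup>2" for t
      proof -
        have "cmod (g t) \<le> cmod (q t) * cmod (f t) + \<bar>l\<bar> * cmod (f t)"
          unfolding g_def by (rule order_trans[OF norm_triangle_ineq4]) (simp add: norm_mult)
        also have "\<dots> \<le> cmod (q t) * B + \<bar>l\<bar> * B" by (intro add_mono mult_left_mono B) auto
        finally have "(cmod (g t))\<^sup>2 \<le> (cmod (q t) * B + \<bar>l\<bar> * B)\<^sup>2" by (intro power_mono) auto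
        also have "\<dots> \<le> 2 * B\<^sup>2 * (cmod (q t))\<^sup>2 + 2 * B\<^sup>2 * l\<^sup>2"
          using zero_le_power2[of "cmod (q t) * B - \<bar>l\<bar> * B"]
          by (simp add: power2_eq_square algebra_simps)
        finally show ?thesis .
      qed
      thus "AE t in M2. norm ((cmod (g t))\<^sup>2) \<le> norm (2 * B\<^sup>2 * (cmod (q t))\<^sup>2 + 2 * B\<^sup>2 * l\<^sup>2)" by auto
    qed
    thus ?thesis using borel_measurable_integrable[OF gM] by (simp add: square_integrable_on_def)
  qed
  have g0: "fc g 0 = 0" by (simp add: fcg)
  obtain G where G: "\<And>t. G (t + 2) = G t" "continuous_on UNIV G"
    "\<And>a b. a \<le> b \<Longrightarrow> (g has_integral (G b - G a)) {a..b}"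
    "fc G 0 = 0" "\<And>k. fc g k = \<i> * of_real (pi * of_int k) * fc G k"
    using periodic_antiderivative[OF gper gM g0, of 0] by metis
  have GM: "integrable M2 G" by (rule continuous_imp_integrable_real[OF continuous_on_subset[OF G(2)]]) auto
  obtain F where F: "\<And>t. F (t + 2) = F t" "continuous_on UNIV F"
    "\<And>a b. a \<le> b \<Longrightarrow> (G has_integral (F b - F a)) {a..b}"
    "fc F 0 = x 0" "\<And>k. fc G k = \<i> * of_real (pi * of_int k) * fc F k"
    using periodic_antiderivative[OF G(1) GM G(4), of "x 0"] by metis
  have dF: "(F has_vector_derivative G t) (at t)" for t by (rule has_integral_imp_derivative[OF G(2) F(3)])
  have fcF: "fc F = x"
  proof
    fix k show "fc F k = x k"
    proof (cases "k = 0")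
      case False
      have "- of_real ((pi * of_int k)\<^sup>2) * fc F k = - of_real ((pi * of_int k)\<^sup>2) * x k"
        unfolding fcg[symmetric] G(5) F(5) i_square_factor by simp
      thus ?thesis using False by simp
    qed (simp add: F(4))
  qed
  have "F t = fsynth x t" for t using Fourier_series[OF F(1) dF, of t] xs by (simp add: fcF)
  hence "F = f" by (simp add: f_def fun_eq_iff)
  hence dF': "(f has_vector_derivative G t) (at t)" for t using dF by simp
  have "f \<in> hill_eigenspace q (of_real l)"
    unfolding hill_eigenspace_def mem_Collect_eq
  proof (intro conjI allI exI)
    show "f (t + 2) = f t" for t by (simp add: f_def fsynth_periodic)
    show "(f has_vector_derivative G t) (at t)" for t by (rule dF')
    show "square_integrable_on g {0..2}" by (rule g2)
    show "a \<le> b \<longrightarrow> (g has_integral G b - G a) {a..b}" for a b using G(3) by blast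
    show "AE t in lebesgue. - g t + q t * f t = of_real l * f t" by (simp add: g_def)
  qed
  thus ?thesis by (simp add: f_def)
qed

end

interpretation fun_space: vector_space scale_fun by (rule vector_space_scale_fun)

context hill_potential
begin

text \<open>Eigenfunctions correspond linearly to kernel vectors of the 2x2 matrix, since the
  resonant coefficients of a synthesis can be read off from it. At a simple root the off-diagonal
  entry is nonzero and the kernel is a line; at a double root the matrix is 0.\<close>

lemma tile_multiplicity:
  assumes n: "large n"
    and iff: "\<And>l. l \<in> tile n \<Longrightarrow> \<bar>detuning n l\<bar> = cmod (offdiag n l) \<longleftrightarrow> l = r1 \<or> l = r2"
    and deg: "r1 = r2 \<longleftrightarrow> offdiag n r2 = 0" "r1 = r2 \<longleftrightarrow> offdiag n r1 = 0"
    and l: "l \<in> tile n"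
  shows "hill_multiplicity q l = (if l = r1 then 1 else 0) + (if l = r2 then 1 else 0)"
proof -
  define W where "W \<beta> \<alpha> = (\<lambda>k. \<beta> * U n l k + \<alpha> * cnj (U n l (- k)))" for \<beta> \<alpha>
  have nn: "int n \<noteq> - int n" using n by (simp add: large_def)
  have Un: "U n l (- int n) = 1" "U n l (int n) = 0" using nn by (auto simp: U_def resolvent_def)
  have Wn: "W \<beta> \<alpha> (- int n) = \<beta>" "W \<beta> \<alpha> (int n) = \<alpha>" for \<beta> \<alpha> by (simp_all add: W_def Un)
  have WI: "W \<beta> \<alpha> \<in> eigseq l" if "of_real (detuning n l) * \<alpha> = offdiag n l * \<beta>" "of_real (detuning n l) * \<beta> = cnj (offdiag n l) * \<alpha>" for \<beta> \<alpha>
    unfolding W_def by (rule eigseqI[OF n l that])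
  have WE: "\<exists>\<beta> \<alpha>. x = W \<beta> \<alpha> \<and> of_real (detuning n l) * \<alpha> = offdiag n l * \<beta> \<and> of_real (detuning n l) * \<beta> = cnj (offdiag n l) * \<alpha>"
    if "x \<in> eigseq l" for x
    using eigseq_imp[OF n l that] unfolding W_def by blast
  have fcW: "fc (fsynth x) = x" "\<And>t. ((\<lambda>k. x k * fmode k t) has_sum fsynth x t) UNIV" if "x \<in> eigseq l" for x
    using fc_syn[of x] fsynth_has_sum[of x] that by (auto simp: eigseq_def)
  have V: "hill_eigenspace q (of_real l) = fsynth ` eigseq l"
  proof
    show "hill_eigenspace q (of_real l) \<subseteq> fsynth ` eigseq l"
      using eigenfunction_coeffs by (metis image_eqI subsetI)
  qed (auto intro: fsynth_eigenfunction)
  have lin: "fsynth z = (\<lambda>t. a * fsynth x t + b * fsynth y t)"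
    if "x \<in> eigseq l" "y \<in> eigseq l" "\<And>k. z k = a * x k + b * y k" for x y z a b
  proof
    fix t
    have "((\<lambda>k. a * (x k * fmode k t) + b * (y k * fmode k t)) has_sum (a * fsynth x t + b * fsynth y t)) UNIV"
      by (intro has_sum_add has_sum_cmult_right fcW that)
    thus "fsynth z t = a * fsynth x t + b * fsynth y t"
      by (simp add: fsynth_def[of z] that(3) algebra_simps infsumI)
  qed
  have iff': "\<bar>detuning n l\<bar> = cmod (offdiag n l) \<longleftrightarrow> l = r1 \<or> l = r2" by (rule iff[OF l])
  show ?thesis
  proof (cases "l = r1 \<or> l = r2")
    case False
    hence ne: "\<bar>detuning n l\<bar> \<noteq> cmod (offdiag n l)" using iff' by simp
    have zero: "\<beta> = 0 \<and> \<alpha> = 0"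
      if "of_real (detuning n l) * \<alpha> = offdiag n l * \<beta>" "of_real (detuning n l) * \<beta> = cnj (offdiag n l) * \<alpha>" for \<beta> \<alpha> :: complex
    proof -
      have 1: "\<bar>detuning n l\<bar> * cmod \<alpha> = cmod (offdiag n l) * cmod \<beta>" "\<bar>detuning n l\<bar> * cmod \<beta> = cmod (offdiag n l) * cmod \<alpha>"
        using arg_cong[OF that(1), of cmod] arg_cong[OF that(2), of cmod] by (simp_all add: norm_mult)
      hence "(\<bar>detuning n l\<bar> - cmod (offdiag n l)) * (cmod \<alpha> + cmod \<beta>) = 0" by (simp add: algebra_simps)
      hence "cmod \<alpha> + cmod \<beta> = 0" using ne by simp
      thus ?thesis using norm_ge_zero[of \<alpha>] norm_ge_zero[of \<beta>] by (simp add: add_nonneg_eq_0_iff)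
    qed
    have "hill_eigenspace q (of_real l) \<subseteq> fun_space.span {}"
    proof
      fix f assume "f \<in> hill_eigenspace q (of_real l)"
      then obtain x where x: "x \<in> eigseq l" "f = fsynth x" using V by auto
      obtain \<beta> \<alpha> where "x = W \<beta> \<alpha>" "\<beta> = 0 \<and> \<alpha> = 0" using WE[OF x(1)] zero by blast
      hence "f = 0" using x by (simp add: W_def fsynth_def fun_eq_iff)
      thus "f \<in> fun_space.span {}" by simp
    qed
    hence "fun_space.dim (hill_eigenspace q (of_real l)) = 0"
      by (intro fun_space.dim_unique[of "{}"]) (auto simp: fun_space.independent_empty)
    thus ?thesis using False by (simp add: hill_multiplicity_def)
  next
    case root: True
    hence ab: "\<bar>detuning n l\<bar> = cmod (offdiag n l)" using iff' by simp
    show ?thesis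
    proof (cases "r1 = r2")
      case False
      hence c0: "offdiag n l \<noteq> 0" using root deg by auto
      hence d0: "detuning n l \<noteq> 0" using ab by auto
      \<comment> \<open>The coefficient at \<open>n\<close> forced by the coefficient 1 at
        \<open>- n\<close>; singularity of the matrix makes the second row consistent.\<close>
      define \<rho> where "\<rho> = offdiag n l / of_real (detuning n l)"
      have dd: "of_real (detuning n l) * of_real (detuning n l) = offdiag n l * cnj (offdiag n l)"
      proof -
        have "(detuning n l)\<^sup>2 = (cmod (offdiag n l))\<^sup>2" using ab by (metis power2_abs)
        hence "of_real ((detuning n l)\<^sup>2) = offdiag n l * cnj (offdiag n l)" by (simp only: complex_norm_square)
        thus ?thesis by (simp add: power2_eq_square)
      qed
      have v: "W 1 \<rho> \<in> eigseq l"
        by (rule WI) (use d0 dd in \<open>simp_all add: \<rho>_def field_simps\<close>)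
      have Vsub: "hill_eigenspace q (of_real l) \<subseteq> fun_space.span {fsynth (W 1 \<rho>)}"
      proof
        fix f assume "f \<in> hill_eigenspace q (of_real l)"
        then obtain x where x: "x \<in> eigseq l" "f = fsynth x" using V by auto
        obtain \<beta> \<alpha> where ba: "x = W \<beta> \<alpha>" "of_real (detuning n l) * \<alpha> = offdiag n l * \<beta>" using WE[OF x(1)] by blast
        have "\<alpha> = \<beta> * \<rho>" using ba(2) d0 by (simp add: \<rho>_def field_simps)
        hence "x k = \<beta> * W 1 \<rho> k + 0 * W 1 \<rho> k" for k by (simp add: ba W_def algebra_simps)
        hence "f = (\<lambda>t. \<beta> * fsynth (W 1 \<rho>) t)" unfolding x(2) by (subst lin[OF v v, of _ \<beta> 0]) auto
        thus "f \<in> fun_space.span {fsynth (W 1 \<rho>)}"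
          using fun_space.span_scale[OF fun_space.span_base[of "fsynth (W 1 \<rho>)" "{fsynth (W 1 \<rho>)}"], of \<beta>] by simp
      qed
      have "fsynth (W 1 \<rho>) \<noteq> 0"
      proof
        assume "fsynth (W 1 \<rho>) = 0"
        hence "fc (fsynth (W 1 \<rho>)) (- int n) = 0" by (simp add: fc_def)
        thus False using fcW(1)[OF v] Wn(1)[of 1 \<rho>] by simp
      qed
      hence "fun_space.dim (hill_eigenspace q (of_real l)) = 1"
        by (intro fun_space.dim_unique[OF _ Vsub]) (use V v in auto)
      thus ?thesis using root False by (auto simp: hill_multiplicity_def)
    next
      case True
      hence c0: "offdiag n l = 0" using root deg by auto
      hence d0: "detuning n l = 0" using ab by simp
      have v: "W 1 0 \<in> eigseq l" "W 0 1 \<in> eigseq l" by (rule WI; simp add: c0 d0)+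
      have Vsub: "hill_eigenspace q (of_real l) \<subseteq> fun_space.span {fsynth (W 1 0), fsynth (W 0 1)}"
      proof
        fix f assume "f \<in> hill_eigenspace q (of_real l)"
        then obtain x where x: "x \<in> eigseq l" "f = fsynth x" using V by auto
        obtain \<beta> \<alpha> where ba: "x = W \<beta> \<alpha>" using WE[OF x(1)] by blast
        hence "x k = \<beta> * W 1 0 k + \<alpha> * W 0 1 k" for k by (simp add: W_def)
        hence "f = (\<lambda>t. \<beta> * fsynth (W 1 0) t + \<alpha> * fsynth (W 0 1) t)" unfolding x(2) by (subst lin[OF v, of _ \<beta> \<alpha>]) auto
        moreover have "(\<lambda>t. \<beta> * fsynth (W 1 0) t) + (\<lambda>t. \<alpha> * fsynth (W 0 1) t) \<in> fun_space.span {fsynth (W 1 0), fsynth (W 0 1)}"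
          by (intro fun_space.span_add fun_space.span_scale fun_space.span_base) auto
        ultimately show "f \<in> fun_space.span {fsynth (W 1 0), fsynth (W 0 1)}" by (simp add: plus_fun_def)
      qed
      have nz: "fsynth (W 0 1) \<noteq> 0"
      proof
        assume "fsynth (W 0 1) = 0"
        hence "fc (fsynth (W 0 1)) (int n) = 0" by (simp add: fc_def)
        thus False using fcW(1)[OF v(2)] Wn(2)[of 0 1] by simp
      qed
      have ns: "fsynth (W 1 0) \<notin> fun_space.span {fsynth (W 0 1)}"
      proof
        assume "fsynth (W 1 0) \<in> fun_space.span {fsynth (W 0 1)}"
        then obtain a where "fsynth (W 1 0) = (\<lambda>t. a * fsynth (W 0 1) t)"
          by (auto simp: fun_space.span_singleton)
        hence "fc (fsynth (W 1 0)) (- int n) = a * fc (fsynth (W 0 1)) (- int n)" by (simp add: fc_cmult)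
        thus False using fcW(1)[OF v(1)] fcW(1)[OF v(2)] Wn(1)[of 1 0] Wn(1)[of 0 1] by simp
      qed
      hence ne: "fsynth (W 1 0) \<noteq> fsynth (W 0 1)" using fun_space.span_base by blast
      have "fun_space.independent {fsynth (W 1 0), fsynth (W 0 1)}"
        using ns nz ne by (simp add: fun_space.independent_insert)
      hence "fun_space.dim (hill_eigenspace q (of_real l)) = 2"
        by (intro fun_space.dim_unique[OF _ Vsub]) (use V v ne in auto)
      thus ?thesis using root True by (auto simp: hill_multiplicity_def)
    qed
  qed
qed

end

section \<open>The list of eigenvalues\<close>

locale hill_spectrum = hill_potential +
  fixes lam :: "nat \<Rightarrow> real"
  assumes lam: "periodic_eigenvalue_list q lam"
begin

lemma lam_mono: "i \<le> j \<Longrightarrow> lam i \<le> lam j"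
  using lam by (auto simp: periodic_eigenvalue_list_def mono_def)

lemma lam_fiber: "finite {k. lam k = l}" "card {k. lam k = l} = hill_multiplicity q l"
  using lam by (auto simp: periodic_eigenvalue_list_def)

text \<open>The position of a tile in the list is not computed: only its parity matters, and an even
  position would make the gaps of the list the long intervals between consecutive tiles.\<close>

lemma gap_control:
  assumes gap0: "(\<lambda>n. gap_length lam n) \<longlonglongrightarrow> 0"
  obtains n0 j0 :: nat and r where "j0 \<ge> 1" "\<And>n. n \<ge> n0 \<Longrightarrow> large n" "\<And>n. n \<ge> n0 \<Longrightarrow> r n \<in> tile n"
    "\<And>n. n \<ge> n0 \<Longrightarrow> cmod (offdiag n (r n)) \<le> gap_length lam (j0 + (n - n0))"
proof -
  obtain n0 where n0: "\<And>n. n \<ge> n0 \<Longrightarrow> large n" using eventually_large by blast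
  define P where "P n r1 r2 \<longleftrightarrow> r1 \<le> r2 \<and> r1 \<in> tile n \<and> r2 \<in> tile n \<and>
    \<bar>r1 - (pi * real n)\<^sup>2\<bar> \<le> 4 * S \<and> \<bar>r2 - (pi * real n)\<^sup>2\<bar> \<le> 4 * S \<and>
    (\<forall>l\<in>tile n. hill_multiplicity q l = (if l = r1 then 1 else 0) + (if l = r2 then 1 else 0)) \<and>
    cmod (offdiag n r2) \<le> r2 - r1" for n r1 r2
  have "\<exists>r1 r2. P n r1 r2" if "n \<ge> n0" for n
  proof -
    note L = n0[OF that]
    show ?thesis
    proof (rule tile_roots[OF L], goal_cases)
      case (1 r1 r2)
      have "P n r1 r2" unfolding P_def
        by (intro conjI ballI 1(1-5) 1(9) tile_multiplicity[OF L 1(6-8)])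
      thus ?case by blast
    qed
  qed
  then obtain r1 r2 where "\<And>n. n \<ge> n0 \<Longrightarrow> P n (r1 n) (r2 n)" by metis
  hence R: "\<And>n. n \<ge> n0 \<Longrightarrow> r1 n \<le> r2 n" "\<And>n. n \<ge> n0 \<Longrightarrow> r1 n \<in> tile n" "\<And>n. n \<ge> n0 \<Longrightarrow> r2 n \<in> tile n"
    "\<And>n. n \<ge> n0 \<Longrightarrow> \<bar>r1 n - (pi * real n)\<^sup>2\<bar> \<le> 4 * S" "\<And>n. n \<ge> n0 \<Longrightarrow> \<bar>r2 n - (pi * real n)\<^sup>2\<bar> \<le> 4 * S"
    "\<And>n l. n \<ge> n0 \<Longrightarrow> l \<in> tile n \<Longrightarrow> hill_multiplicity q l = (if l = r1 n then 1 else 0) + (if l = r2 n then 1 else 0)"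
    "\<And>n. n \<ge> n0 \<Longrightarrow> cmod (offdiag n (r2 n)) \<le> r2 n - r1 n"
    unfolding P_def by simp_all
  define a where "a n = ((real n - 1/2) * pi)\<^sup>2" for n
  have tile_a: "tile n = {a n..a (Suc n)}" for n
    by (simp add: tile_def a_def algebra_simps)
  have lg: "real n \<ge> 1" "8 * S + 1 \<le> real n" if "n \<ge> n0" for n using n0[OF that] by (simp_all add: large_def)
  have p4: "pi\<^sup>2 \<ge> 4" using power_mono[OF pi_ge_two, of 2] by simp
  \<comment> \<open>Strictness keeps the roots off the end point shared with the next tile, so that
    each of them is counted once.\<close>
  have upper: "r2 n < a (Suc n)" if n: "n \<ge> n0" for n
  proof -
    have "a (Suc n) = (pi * real n)\<^sup>2 + pi\<^sup>2 * (real n + 1/4)"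
      by (simp add: a_def power2_eq_square algebra_simps)
    moreover have "pi\<^sup>2 * (real n + 1/4) \<ge> 4 * (real n + 1/4)" using p4 by (intro mult_right_mono) auto
    moreover have "4 * (real n + 1/4) > 4 * S" using lg[OF n] S_nonneg by simp
    ultimately show ?thesis using abs_le_D1[OF R(5)[OF n]] by linarith
  qed
  have nonempty: "{k. lam k = r1 n} \<noteq> {}" if "n \<ge> n0" for n
  proof
    assume "{k. lam k = r1 n} = {}"
    hence "hill_multiplicity q (r1 n) = 0" using lam_fiber(2)[of "r1 n"] by simp
    thus False using R(6)[OF that R(2)[OF that]] by (simp split: if_splits)
  qed
  \<comment> \<open>A monotone list might stay bounded. The roots \<open>r1 n\<close> occur in it
    and tend to infinity, so only finitely many entries lie below any level.\<close>
  have unbounded: "\<exists>k. lam k \<ge> x" for x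
  proof -
    define n where "n = max n0 (nat \<lceil>\<bar>x\<bar> + 1\<rceil>)"
    have n: "n \<ge> n0" "real n \<ge> \<bar>x\<bar> + 1"
    proof -
      show "n \<ge> n0" by (simp add: n_def)
      have "nat \<lceil>\<bar>x\<bar> + 1\<rceil> \<le> n" unfolding n_def by (rule max.cobounded2)
      hence "real (nat \<lceil>\<bar>x\<bar> + 1\<rceil>) \<le> real n" by (simp only: of_nat_le_iff)
      thus "real n \<ge> \<bar>x\<bar> + 1" by (rule order_trans[OF real_nat_ceiling_ge])
    qed
    obtain k where k: "lam k = r1 n" using nonempty[OF n(1)] by auto
    have "x \<le> 4 * (real n * real n) - 4 * S"
    proof -
      have "real n * (8 * S + 1) \<le> real n * real n" using lg[OF n(1)] by (intro mult_left_mono) auto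
      moreover have "1 * S \<le> real n * S" using lg[OF n(1)] S_nonneg by (intro mult_right_mono) auto
      moreover have "real n \<le> real n * real n" using mult_right_mono[OF lg(1)[OF n(1)], of "real n"] by simp
      ultimately show ?thesis using n(2) S_nonneg by (simp add: algebra_simps)
    qed
    also have "\<dots> \<le> (pi * real n)\<^sup>2 - 4 * S"
      using mult_right_mono[OF p4, of "real n * real n"] by (simp add: power2_eq_square mult_ac)
    also have "\<dots> \<le> r1 n" using abs_le_D2[OF R(4)[OF n(1)]] by linarith
    finally have "x \<le> lam k" by (simp only: k)
    thus ?thesis by blast
  qed
  define D where "D x = {k. lam k < x}" for x
  have finD: "finite (D x)" for x
  proof -
    obtain k where "lam k \<ge> x" using unbounded by blast
    hence "j < k" if "lam j < x" for j using lam_mono[of k j] that by (cases "j < k") auto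
    hence "D x \<subseteq> {..<k}" by (auto simp: D_def)
    thus ?thesis by (rule finite_subset) simp
  qed
  \<comment> \<open>By monotonicity the entries below a level are the first ones, so counting them
    determines positions in the list.\<close>
  have initial: "D x = {..<card (D x)}" for x
  proof (rule card_subset_eq[symmetric])
    show "finite (D x)" by (rule finD)
    have down: "i \<in> D x" if "j \<in> D x" "i \<le> j" for i j using that lam_mono[of i j] by (auto simp: D_def)
    show "{..<card (D x)} \<subseteq> D x"
    proof
      fix i assume i: "i \<in> {..<card (D x)}"
      show "i \<in> D x"
      proof (rule ccontr)
        assume "i \<notin> D x"
        hence "j < i" if "j \<in> D x" for j using down[OF that, of i] by (cases "j < i") auto
        hence "D x \<subseteq> {..<i}" by auto
        hence "card (D x) \<le> i" using card_mono[of "{..<i}" "D x"] by simp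
        thus False using i by simp
      qed
    qed
  qed simp
  define N0 where "N0 = card (D (a n0))"
  have block: "D (a (Suc n)) = D (a n) \<union> ({k. lam k = r1 n} \<union> {k. lam k = r2 n})" if n: "n \<ge> n0" for n
  proof -
    have in_tile: "lam k \<in> {r1 n, r2 n}" if k: "lam k \<in> tile n" for k
    proof (rule ccontr)
      assume "lam k \<notin> {r1 n, r2 n}"
      hence "card {k'. lam k' = lam k} = 0" using R(6)[OF n k] lam_fiber(2)[of "lam k"] by simp
      thus False using lam_fiber(1)[of "lam k"] by auto
    qed
    have "a n \<le> a (Suc n)" using tile_a R(2)[OF n] by auto
    moreover have "r1 n < a (Suc n)" "r2 n < a (Suc n)" using upper[OF n] R(1)[OF n] by auto
    ultimately have "lam k < a (Suc n) \<longleftrightarrow> lam k < a n \<or> lam k = r1 n \<or> lam k = r2 n" for k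
      using in_tile[of k] unfolding tile_a by (cases "lam k < a n"; cases "lam k < a (Suc n)") (auto simp: not_less)
    thus ?thesis unfolding D_def by blast
  qed
  have disj: "D (a n) \<inter> ({k. lam k = r1 n} \<union> {k. lam k = r2 n}) = {}" if "n \<ge> n0" for n
    using R(2,3)[OF that] by (auto simp: D_def tile_a)
  have fib: "card {k. lam k = r1 n} = (if r1 n = r2 n then 2 else 1)" "card {k. lam k = r2 n} = (if r1 n = r2 n then 2 else 1)"
    if "n \<ge> n0" for n
    using R(6)[OF that R(2)[OF that]] R(6)[OF that R(3)[OF that]] by (auto simp: lam_fiber(2))
  have two: "card ({k. lam k = r1 n} \<union> {k. lam k = r2 n}) = 2" if "n \<ge> n0" for n
  proof (cases "r1 n = r2 n")
    case False
    hence "card ({k. lam k = r1 n} \<union> {k. lam k = r2 n}) = card {k. lam k = r1 n} + card {k. lam k = r2 n}"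
      by (intro card_Un_disjoint lam_fiber) auto
    thus ?thesis using fib[OF that] False by simp
  qed (use fib[OF that] in simp)
  have cardD: "card (D (a (n0 + i))) = N0 + 2 * i" for i
  proof (induction i)
    case (Suc i)
    have "card (D (a (Suc (n0 + i)))) = card (D (a (n0 + i))) + 2"
      using block[of "n0 + i"] disj[of "n0 + i"] two[of "n0 + i"]
      by (simp add: card_Un_disjoint finD lam_fiber)
    thus ?case using Suc by simp
  qed (simp add: N0_def)
  have pos: "lam (N0 + 2 * i) = r1 (n0 + i) \<and> lam (N0 + 2 * i + 1) = r2 (n0 + i)" for i
  proof -
    define n p where "n = n0 + i" and "p = N0 + 2 * i"
    have n: "n \<ge> n0" by (simp add: n_def)
    have "D (a (Suc n)) - D (a n) = {p, p + 1}"
      using initial[of "a (Suc n)"] initial[of "a n"] cardD[of "Suc i"] cardD[of i] by (auto simp: n_def p_def)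
    hence set: "{k. lam k = r1 n} \<union> {k. lam k = r2 n} = {p, p + 1}"
      using block[OF n] disj[OF n] by blast
    have r12: "r1 n \<le> r2 n" by (rule R(1)[OF n])
    have m: "lam p \<le> lam (p + 1)" by (rule lam_mono) simp
    have mem: "lam p = r1 n \<or> lam p = r2 n" "lam (p + 1) = r1 n \<or> lam (p + 1) = r2 n" using set by blast+
    have "lam p = r1 n \<and> lam (p + 1) = r2 n"
    proof (cases "r1 n = r2 n")
      case False
      have c: "card {k. lam k = r1 n} = 1" "card {k. lam k = r2 n} = 1" using fib[OF n] False by simp_all
      have "lam p \<noteq> lam (p + 1)"
      proof
        assume "lam p = lam (p + 1)"
        hence "{p, p + 1} \<subseteq> {k. lam k = lam p}" by auto
        hence "card {p, p + 1} \<le> card {k. lam k = lam p}" by (rule card_mono[OF lam_fiber(1)])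
        thus False using c mem by auto
      qed
      thus ?thesis using mem m r12 False by auto
    qed (use mem in auto)
    thus ?thesis by (simp add: n_def p_def)
  qed
  show ?thesis
  proof (cases "even N0")
    case True
    then obtain m where m: "N0 = 2 * m" by auto
    \<comment> \<open>For even \<open>N0\<close> a gap of the list runs from \<open>r2 n\<close> to
      \<open>r1 (Suc n)\<close>. Each root is within \<open>4 * S\<close> of its free value, so the
      length is at least \<open>4 * (2 * n + 1) - 8 * S\<close>, against
      \<open>gap0\<close>.\<close>
    have big: "gap_length lam (m + Suc i) \<ge> 1" for i
    proof -
      define n where "n = n0 + i"
      have n: "n \<ge> n0" by (simp add: n_def)
      have "2 * (m + Suc i) - 1 = N0 + 2 * i + 1" "2 * (m + Suc i) = N0 + 2 * Suc i" using m by auto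
      hence "gap_length lam (m + Suc i) = r1 (Suc n) - r2 n"
        using pos[of i] pos[of "Suc i"] unfolding gap_length_def n_def by simp
      moreover have "r1 (Suc n) \<ge> (pi * real (Suc n))\<^sup>2 - 4 * S" using abs_le_D2[OF R(4)[of "Suc n"]] n by simp
      moreover have "r2 n \<le> (pi * real n)\<^sup>2 + 4 * S" using abs_le_D1[OF R(5)[OF n]] by simp
      moreover have "(pi * real (Suc n))\<^sup>2 - (pi * real n)\<^sup>2 = pi\<^sup>2 * (2 * real n + 1)"
        by (simp add: power2_eq_square algebra_simps)
      moreover have "pi\<^sup>2 * (2 * real n + 1) \<ge> 4 * (2 * real n + 1)" using p4 by (intro mult_right_mono) auto
      moreover have "4 * (2 * real n + 1) \<ge> 8 * S + 1" using lg[OF n] S_nonneg by (simp add: algebra_simps)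
      ultimately show ?thesis by linarith
    qed
    have "\<forall>\<^sub>F n in sequentially. gap_length lam n < 1" using order_tendstoD(2)[OF gap0] by simp
    then obtain M where "\<And>n. n \<ge> M \<Longrightarrow> gap_length lam n < 1" by (auto simp: eventually_sequentially)
    from this[of "m + Suc M"] big[of M] show ?thesis by simp
  next
    case False
    then obtain m where m: "N0 = 2 * m + 1" by (auto elim: oddE)
    show ?thesis
    \<comment> \<open>With \<open>N0 = 2 * m + 1\<close> the roots of the first tile sit at
      positions \<open>2 * (m + 1) - 1\<close> and \<open>2 * (m + 1)\<close>, which bound the gap
      number \<open>m + 1\<close>.\<close>
    proof (rule that[of "m + 1" n0 r2])
      fix n assume n: "n \<ge> n0"
      have "2 * (m + 1 + (n - n0)) - 1 = N0 + 2 * (n - n0)" "2 * (m + 1 + (n - n0)) = N0 + 2 * (n - n0) + 1" using m by auto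
      hence "gap_length lam (m + 1 + (n - n0)) = r2 n - r1 n"
        using pos[of "n - n0"] n unfolding gap_length_def by simp
      thus "cmod (offdiag n (r2 n)) \<le> gap_length lam (m + 1 + (n - n0))" using R(7)[OF n] by simp
    qed (use n0 R(3) in auto)
  qed
qed

end

section \<open>Weighted estimates\<close>

text \<open>From \<open>N\<close> on the quotient of \<open>\<psi>\<close> by its argument is
  nonincreasing, and this gives plain subadditivity there. An argument below \<open>N\<close> costs
  at most \<open>\<psi> (2 * N)\<close>, by monotonicity.\<close>

lemma subadditive_upto_constant:
  fixes \<psi> :: "nat \<Rightarrow> real"
  assumes mono: "\<And>a b. a \<le> b \<Longrightarrow> \<psi> a \<le> \<psi> b" and nn: "\<psi> 0 \<ge> 0" and N: "N \<ge> 1"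
    and anti: "\<And>a b. N \<le> a \<Longrightarrow> a \<le> b \<Longrightarrow> \<psi> b * real a \<le> \<psi> a * real b"
  shows "\<psi> (a + b) \<le> \<psi> (2 * N) + \<psi> a + \<psi> b"
proof -
  have nn': "\<psi> n \<ge> 0" for n using mono[of 0 n] nn by simp
  have main: "\<psi> (a + b) \<le> \<psi> (2 * N) + \<psi> a + \<psi> b" if ab: "a \<le> b" for a b
  proof -
    consider "b < N" | "a < N" "N \<le> b" | "N \<le> a" using ab by linarith
    thus ?thesis
    proof cases
      case 1
      thus ?thesis using mono[of "a + b" "2 * N"] ab nn'[of a] nn'[of b] by simp
    next
      case 2
      have b0: "real b > 0" using 2 N by simp
      \<comment> \<open>Adding \<open>a\<close> to \<open>b\<close> raises \<open>\<psi>\<close> by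
        at most \<open>a / b\<close> times \<open>\<psi> b\<close>. Since \<open>a < N\<close>, this
        is at most \<open>N\<close> times the quotient at \<open>b\<close>, hence at most
        \<open>\<psi> N\<close>.\<close>
      have "\<psi> (a + b) * real b \<le> \<psi> b * real (a + b)" by (rule anti) (use 2 in auto)
      also have "\<dots> = \<psi> b * real b + real a * \<psi> b" by (simp add: algebra_simps)
      also have "real a * \<psi> b \<le> real N * \<psi> b" using 2 nn' by (intro mult_right_mono) auto
      also have "real N * \<psi> b \<le> \<psi> N * real b" using anti[of N b] 2 by (simp add: mult.commute)
      finally have "\<psi> (a + b) * real b \<le> (\<psi> b + \<psi> N) * real b" by (simp add: algebra_simps)
      hence "\<psi> (a + b) \<le> \<psi> b + \<psi> N" using b0 by (rule mult_right_le_imp_le)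
      thus ?thesis using mono[of N "2 * N"] nn'[of a] by simp
    next
      case 3
      have p: "real (a + b) > 0" using 3 N by simp
      have "\<psi> (a + b) * real a \<le> \<psi> a * real (a + b)" "\<psi> (a + b) * real b \<le> \<psi> b * real (a + b)"
        by (rule anti; use 3 ab in simp)+
      hence "\<psi> (a + b) * real (a + b) \<le> (\<psi> a + \<psi> b) * real (a + b)" by (simp add: algebra_simps)
      hence "\<psi> (a + b) \<le> \<psi> a + \<psi> b" using p by (rule mult_right_le_imp_le)
      thus ?thesis using nn'[of "2 * N"] by simp
    qed
  qed
  show ?thesis
  proof (cases "a \<le> b")
    case False
    thus ?thesis using main[of b a] by (simp add: add.commute add.left_commute)
  qed (rule main)
qed

lemma summable_tail_small:
  fixes f :: "int \<Rightarrow> real"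
  assumes f: "f summable_on UNIV" and nn: "\<And>m. f m \<ge> 0" and e: "e > 0"
  shows "\<exists>N. \<forall>M\<ge>N. (\<Sum>\<^sub>\<infinity>m\<in>- {- int M..int M}. f m) < e"
proof -
  have "\<forall>\<^sub>F F in finite_subsets_at_top UNIV. (\<Sum>\<^sub>\<infinity>m\<in>- F. cmod (of_real (f m))) < e"
    using order_tendstoD(2)[OF fsynth_tail_tendsto_0[of "\<lambda>m. of_real (f m)"] e] f nn by simp
  hence "\<forall>\<^sub>F F in finite_subsets_at_top UNIV. (\<Sum>\<^sub>\<infinity>m\<in>- F. f m) < e" by (simp add: nn)
  hence "\<forall>\<^sub>F N in sequentially. (\<Sum>\<^sub>\<infinity>m\<in>- {- int N..int N}. f m) < e"
    using int_intervals_exhaust unfolding filterlim_iff by blast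
  thus ?thesis by (simp add: eventually_sequentially)
qed

lemma infsum_split_int:
  fixes f :: "int \<Rightarrow> real"
  assumes f: "f summable_on UNIV"
  shows "(\<Sum>\<^sub>\<infinity>m. f m) = (\<Sum>m\<in>{- int M..int M}. f m) + (\<Sum>\<^sub>\<infinity>m\<in>- {- int M..int M}. f m)"
proof -
  have "(\<Sum>\<^sub>\<infinity>m\<in>{- int M..int M} \<union> - {- int M..int M}. f m)
     = (\<Sum>\<^sub>\<infinity>m\<in>{- int M..int M}. f m) + (\<Sum>\<^sub>\<infinity>m\<in>- {- int M..int M}. f m)"
    by (rule infsum_Un_disjoint) (use summable_on_subset_banach[OF f] in auto)
  thus ?thesis by simp
qed

context hill_potential
begin

definition qabs :: "int \<Rightarrow> real" where "qabs m = cmod (fc q (2 * m))"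

lemma qabs_eq: "qabs m = cmod (fourier_coeff q m)" by (simp add: qabs_def fc_q_eq)

lemma qabs_minus: "qabs (- m) = qabs m"
  using fc_q_minus[of "2 * m"] by (simp add: qabs_def)

text \<open>The rounding in \<open>k div 2\<close> is harmless because the odd coefficients
  vanish.\<close>

lemma even_coeffs_has_sum:
  assumes "((\<lambda>m. (v m * qabs m)\<^sup>2) has_sum s) UNIV"
  shows "((\<lambda>k. (v (k div 2) * cmod (fc q k))\<^sup>2) has_sum s) UNIV"
proof -
  have "((\<lambda>k. (v (k div 2) * cmod (fc q k))\<^sup>2) has_sum s) (range (\<lambda>m. 2 * m))"
    by (subst has_sum_reindex) (use assms in \<open>auto simp: inj_on_def o_def qabs_def\<close>)
  thus ?thesis
    by (rule has_sum_cong_neutral[THEN iffD1, rotated 3]) (auto simp: fc_q_eq elim!: evenE)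
qed

lemma qabs_square_summable: "(\<lambda>m. (qabs m)\<^sup>2) summable_on UNIV"
proof -
  have "(\<lambda>k. (cmod (fc q k))\<^sup>2) summable_on range (\<lambda>m. 2 * m)"
    by (rule summable_on_subset[OF fc_square_summable[OF q_square_integrable]]) auto
  thus ?thesis by (subst (asm) summable_on_reindex) (auto simp: inj_on_def o_def qabs_def[abs_def])
qed

text \<open>The weighted estimate of the reduced equation: the solution \<open>Y\<close> is bounded in the weight
  shifted by \<open>n\<close>, so the coefficient \<open>offdiag n l\<close> differs from \<open>fc q (2 * n)\<close> by a quadratic term of
  size \<open>1 / n\<close>.\<close>

lemma weighted_coefficient:
  fixes v :: "int \<Rightarrow> real"
  assumes n: "large n" and l: "l \<in> tile n"
    and v1: "\<And>m. v m \<ge> 1" and vJ: "\<And>m. v m \<le> J" and K: "K \<ge> 0"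
    and vK: "\<And>a b. v (a + b) \<le> K * (v a * v b)"
    and X: "X \<ge> 0" "((\<lambda>m. (v m * qabs m)\<^sup>2) has_sum X\<^sup>2) UNIV"
    and small: "2 * (K * X * res_const) \<le> real n"
  shows "v (int n) * qabs (int n) \<le> v (int n) * cmod (offdiag n l) + 2 * K * X\<^sup>2 * res_const / real n"
proof -
  have n1: "n \<ge> 1" using n by (simp add: large_def)
  define V where "V k = v (k div 2) * cmod (fc q k)" for k
  \<comment> \<open>The source \<open>Q (k + n)\<close> is centred at \<open>- n\<close>, so the
    weight is shifted by \<open>n\<close>; halving converts modes of period 2 into modes of period
    1.\<close>
  define W where "W k = v ((k + int n) div 2)" for k
  have v0: "v m > 0" for m using v1[of m] by simp
  hence v0': "v m \<ge> 0" for m by (simp add: less_imp_le)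
  have Vs: "((\<lambda>k. (V k)\<^sup>2) has_sum X\<^sup>2) UNIV" unfolding V_def by (rule even_coeffs_has_sum[OF X(2)])
  have VX: "V k \<le> X" for k
  proof -
    have "(V k)\<^sup>2 \<le> (\<Sum>\<^sub>\<infinity>k. (V k)\<^sup>2)"
      using finite_sum_le_infsum[OF has_sum_imp_summable[OF Vs], of "{k}"] by simp
    also have "\<dots> = X\<^sup>2" by (rule infsumI[OF Vs])
    finally show ?thesis using X(1) by (rule power2_le_imp_le)
  qed
  have V0: "V k \<ge> 0" for k by (simp add: V_def v0')
  note conv = convolution_rdiag[OF n1 l V0 has_sum_imp_summable[OF Vs]]
  have sX: "sqrt (\<Sum>\<^sub>\<infinity>k. (V k)\<^sup>2) = X" using infsumI[OF Vs] X(1) by simp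
  \<comment> \<open>The kernel conjugated by the weight. Where \<open>Q (k - j)\<close> is nonzero,
    \<open>k - j\<close> is even, so the rounded indices of \<open>W k\<close> and
    \<open>W j\<close> differ by exactly half of it and \<open>W k / W j\<close> is at most
    \<open>K\<close> times the weight there. Thus \<open>A\<close> obeys the bound of the plain
    kernel with \<open>V\<close> in place of \<open>Q\<close>.\<close>
  define A where "A k j = of_real (W k / W j) * kern n l k j" for k j
  have Ale: "cmod (A k j) \<le> K * (V (k - j) * \<bar>resolvent n l j\<bar>)" for k j
  proof (cases "fc q (k - j) = 0")
    case False
    hence "even (k - j)" by (auto simp: fc_q_eq split: if_splits)
    then obtain a where a: "k - j = 2 * a" by (rule evenE)
    have "k + int n = j + int n + 2 * a" using a by simp
    hence "(k + int n) div 2 = a + (j + int n) div 2" by simp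
    hence "W k \<le> K * (v a * W j)" unfolding W_def using vK by metis
    hence "W k / W j \<le> K * v a" using v0 by (simp add: W_def field_simps)
    hence "(W k / W j) * (cmod (fc q (k - j)) * \<bar>resolvent n l j\<bar>) \<le> K * v a * (cmod (fc q (k - j)) * \<bar>resolvent n l j\<bar>)"
      by (rule mult_right_mono) auto
    moreover have "cmod (A k j) = (W k / W j) * (cmod (fc q (k - j)) * \<bar>resolvent n l j\<bar>)"
      using v0' by (simp add: A_def kern_def norm_mult norm_divide W_def)
    moreover have "V (k - j) = v a * cmod (fc q (k - j))" by (simp add: V_def a)
    ultimately show ?thesis by (simp add: mult_ac)
  qed (use K V0 in \<open>simp add: A_def kern_def\<close>)
  have sK: "(\<lambda>j. K * (V (k - j) * \<bar>resolvent n l j\<bar>)) summable_on UNIV" for k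
    by (intro summable_on_cmult_right conv)
  have As: "(\<lambda>j. cmod (A k j)) summable_on UNIV" for k
    by (rule summable_on_comparison_test[OF sK Ale]) auto
  have Asum: "(\<Sum>\<^sub>\<infinity>j. cmod (A k j)) \<le> K * X * res_const / real n" for k
  proof -
    have "(\<Sum>\<^sub>\<infinity>j. cmod (A k j)) \<le> (\<Sum>\<^sub>\<infinity>j. K * (V (k - j) * \<bar>resolvent n l j\<bar>))"
      by (rule infsum_mono[OF As sK Ale])
    also have "\<dots> = K * (\<Sum>\<^sub>\<infinity>j. V (k - j) * \<bar>resolvent n l j\<bar>)" by (rule infsum_cmult_right')
    also have "\<dots> \<le> K * (X * res_const / real n)"
      using conv(2)[of k] K by (intro mult_left_mono) (simp_all add: sX)
    finally show ?thesis by simp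
  qed
  have half: "(\<Sum>\<^sub>\<infinity>j. cmod (A k j)) \<le> 1/2" for k
  proof -
    have "K * X * res_const / real n \<le> 1/2" using small n1 by (simp add: field_simps)
    thus ?thesis using Asum[of k] by linarith
  qed
  define y where "y k = of_real (W k) * Y n l k" for k
  define b where "b k = of_real (W k) * fc q (k + int n)" for k
  \<comment> \<open>The cap \<open>J\<close> gives finiteness of the weighted supremum; the
    resulting bound \<open>2 * X\<close> is free of it.\<close>
  have yb: "cmod (y k) \<le> J * (2 * S)" for k
    unfolding y_def norm_mult using v0' vJ order_trans[OF v0'[of 0] vJ[of 0]]
    by (intro mult_mono Y_bound[OF n l]) (auto simp: W_def)
  have bX: "cmod (b k) \<le> X" for k
    using VX[of "k + int n"] v0' by (simp add: b_def V_def W_def norm_mult)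
  have yeq: "y k = b k + (\<Sum>\<^sub>\<infinity>j. A k j * y j)" for k
  proof -
    have "A k j * y j = of_real (W k) * (kern n l k j * Y n l j)" for j
      using v0[of "(j + int n) div 2"] by (simp add: A_def y_def W_def)
    hence "(\<Sum>\<^sub>\<infinity>j. A k j * y j) = of_real (W k) * (\<Sum>\<^sub>\<infinity>j. kern n l k j * Y n l j)"
      by (simp add: infsum_cmult_right')
    thus ?thesis unfolding y_def[of k] b_def by (subst Y_eq[OF n l]) (simp add: algebra_simps)
  qed
  have y2X: "cmod (y k) \<le> 2 * X" for k
    by (rule bounded_solution_bound[OF As half bX yb yeq])
  have Wn: "W (int n) = v (int n)" by (simp add: W_def)
  \<comment> \<open>At \<open>k = n\<close> the source is the weighted coefficient
    \<open>2 * n\<close> and \<open>y\<close> is the weighted off-diagonal entry. The row sum times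
    the bound \<open>2 * X\<close> is the quadratic error.\<close>
  have "b (int n) = y (int n) - (\<Sum>\<^sub>\<infinity>j. A (int n) j * y j)" using yeq[of "int n"] by simp
  hence "cmod (b (int n)) \<le> cmod (y (int n)) + cmod (\<Sum>\<^sub>\<infinity>j. A (int n) j * y j)"
    by (simp add: norm_triangle_ineq4)
  also have "cmod (\<Sum>\<^sub>\<infinity>j. A (int n) j * y j) \<le> (\<Sum>\<^sub>\<infinity>j. cmod (A (int n) j)) * (2 * X)"
    by (rule bounded_row_apply(3)[OF As y2X])
  also have "\<dots> \<le> K * X * res_const / real n * (2 * X)"
    using X(1) by (intro mult_right_mono Asum) auto
  also have "cmod (b (int n)) = v (int n) * qabs (int n)"
    using v0' by (simp add: b_def Wn norm_mult qabs_def)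
  also have "cmod (y (int n)) = v (int n) * cmod (offdiag n l)"
    using v0' by (simp add: y_def Wn norm_mult offdiag_def)
  finally show ?thesis by (simp add: power2_eq_square mult_ac)
qed

end

definition truncation :: "(int \<Rightarrow> real) \<Rightarrow> real \<Rightarrow> real \<Rightarrow> int \<Rightarrow> real" where
  "truncation w e J m = min (w m) (min (exp (e * real_of_int \<bar>m\<bar>)) J)"

context hill_potential
begin

text \<open>Continuity method: for the bounded truncations \<open>truncation w e J\<close> the
  norm of the coefficients is continuous in \<open>e\<close>, starts at the plain square sum at \<open>e = 0\<close>, and by
  the quadratic estimate cannot enter the interval \<open>{B<..B + 1}\<close>.  All constants are independent
  of \<open>J\<close>.\<close>

lemma weighted_regularity:
  fixes w :: "int \<Rightarrow> real"
  assumes w1: "\<And>m. w m \<ge> 1" and we: "\<And>m. w (- m) = w m" and K: "K \<ge> 0"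
    and wK: "\<And>e J a b. e \<ge> 0 \<Longrightarrow> J \<ge> 1 \<Longrightarrow>
      truncation w e J (a + b) \<le> K * (truncation w e J a * truncation w e J b)"
    and L: "\<And>n. n \<ge> n0 \<Longrightarrow> large n" and r: "\<And>n. n \<ge> n0 \<Longrightarrow> r n \<in> tile n"
    and p: "(\<lambda>n. (w (int n) * cmod (offdiag n (r n)))\<^sup>2) summable_on {n0..}"
  shows "\<exists>e>0. (\<lambda>m. (min (w m) (exp (e * real_of_int \<bar>m\<bar>)) * qabs m)\<^sup>2) summable_on UNIV"
proof -
  define q0 where "q0 = (\<Sum>\<^sub>\<infinity>m. (qabs m)\<^sup>2)"
  have q0: "q0 \<ge> 0" unfolding q0_def by (rule infsum_nonneg) simp
  \<comment> \<open>\<open>2 * q0\<close> pays for the low modes, whose squared weight will be at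
    most 2; the 1 pays for the tail, as twice 1/4 from the gaps plus 1/2 from the quadratic
    error.\<close>
  define B where "B = 2 * q0 + 1"
  have B0: "B \<ge> 1" using q0 by (simp add: B_def)
  define f where "f n = (if n \<ge> n0 then (w (int n) * cmod (offdiag n (r n)))\<^sup>2 else 0)" for n
  have fs: "f summable_on UNIV"
    by (rule summable_on_cong_neutral[THEN iffD1, OF _ _ _ p]) (auto simp: f_def)
  define P where "P m = f (nat \<bar>m\<bar>)" for m :: int
  have Ps: "P summable_on UNIV" unfolding P_def[abs_def] by (rule summable_on_nat_abs[OF fs])
  have P0: "P m \<ge> 0" for m by (simp add: P_def f_def)
  obtain N1 where N1: "\<And>M. M \<ge> N1 \<Longrightarrow> (\<Sum>\<^sub>\<infinity>m\<in>- {- int M..int M}. P m) < 1/4"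
    using summable_tail_small[OF Ps P0, of "1/4"] by auto
  \<comment> \<open>Twice the square of the quadratic error
    \<open>2 * K * (B + 1) * res_const / n\<close>, without the \<open>1 / n^2\<close>; the factor 2
    comes from squaring a sum of two terms.\<close>
  define c2 where "c2 = 8 * K\<^sup>2 * (B + 1)\<^sup>2 * res_const\<^sup>2"
  have c20: "c2 \<ge> 0" by (simp add: c2_def)
  obtain N2 where N2: "\<And>M. M \<ge> N2 \<Longrightarrow> (\<Sum>\<^sub>\<infinity>m\<in>- {- int M..int M}. c2 * inv_sq m) < 1/2"
    using summable_tail_small[of "\<lambda>m. c2 * inv_sq m" "1/2"] summable_on_cmult_right[OF inv_sq_summable, of c2] c20
    by (auto simp: inv_sq_nonneg)
  \<comment> \<open>Beyond \<open>N3\<close> every norm up to \<open>sqrt (B + 1)\<close> is small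
    enough for the weighted estimate.\<close>
  define N3 where "N3 = nat \<lceil>2 * (K * sqrt (B + 1) * res_const)\<rceil>"
  define M where "M = max (max N1 N2) (max N3 n0)"
  let ?F = "{- int M..int M}"
  have M: "M \<ge> N1" "M \<ge> N2" "M \<ge> N3" "M \<ge> n0" by (auto simp: M_def)
  \<comment> \<open>Chosen so that the square of \<open>exp (e1 * (M + 1))\<close> is 2;
    \<open>M + 1\<close> instead of \<open>M\<close> avoids dividing by 0.\<close>
  define e1 where "e1 = ln 2 / (2 * (real M + 1))"
  have e1: "e1 > 0" by (simp add: e1_def)
  define v where "v J e m = truncation w e J m" for J e m
  have v_sym: "v J e (- m) = v J e m" for J e m by (simp add: v_def truncation_def we)
  have v1: "v J e m \<ge> 1" if "J \<ge> 1" "e \<ge> 0" for J e m using that w1 by (simp add: v_def truncation_def)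
  have vJ: "v J e m \<le> J" for J e m by (simp add: v_def truncation_def)
  have v2: "(v J e m)\<^sup>2 \<le> 2" if "J \<ge> 1" "e \<ge> 0" "e \<le> e1" "m \<in> ?F" for J e m
  proof -
    have "\<bar>m\<bar> \<le> int M" using that by auto
    hence mM: "real_of_int \<bar>m\<bar> \<le> real M + 1" by linarith
    have "v J e m \<le> exp (e * real_of_int \<bar>m\<bar>)" by (simp add: v_def truncation_def)
    also have "\<dots> \<le> exp (e1 * (real M + 1))"
      unfolding exp_le_cancel_iff using that mM e1 by (intro mult_mono) auto
    also have "e1 * (real M + 1) = ln 2 / 2" by (simp add: e1_def field_simps)
    finally have "(v J e m)\<^sup>2 \<le> (exp (ln 2 / 2))\<^sup>2" using v1[OF that(1,2), of m] by (intro power_mono) auto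
    also have "\<dots> = exp (ln 2)" by (simp add: exp_double[symmetric])
    finally show ?thesis by simp
  qed
  define X2 where "X2 J e = (\<Sum>\<^sub>\<infinity>m. (v J e m * qabs m)\<^sup>2)" for J e
  have dom: "(v J e m * qabs m)\<^sup>2 \<le> J\<^sup>2 * (qabs m)\<^sup>2" if "J \<ge> 1" "e \<ge> 0" for J e m
    unfolding power_mult_distrib using v1[OF that, of m] vJ[of J e m] by (intro mult_right_mono power_mono) auto
  have Js: "(\<lambda>m. J\<^sup>2 * (qabs m)\<^sup>2) summable_on UNIV" for J by (intro summable_on_cmult_right qabs_square_summable)
  have vs: "(\<lambda>m. (v J e m * qabs m)\<^sup>2) summable_on UNIV" if "J \<ge> 1" "e \<ge> 0" for J e
    by (rule summable_on_comparison_test[OF Js dom[OF that]]) auto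
  have step: "X2 J e \<le> B" if J: "J \<ge> 1" and e: "e \<ge> 0" "e \<le> e1" and le: "X2 J e \<le> B + 1" for J e
  proof -
    note s = vs[OF J e(1)]
    have X20: "X2 J e \<ge> 0" unfolding X2_def by (rule infsum_nonneg) simp
    define X where "X = sqrt (X2 J e)"
    have X: "X \<ge> 0" "X\<^sup>2 = X2 J e" using X20 by (simp_all add: X_def)
    have XB: "X \<le> sqrt (B + 1)" unfolding X_def using le by (rule real_sqrt_le_mono)
    have hX: "((\<lambda>m. (v J e m * qabs m)\<^sup>2) has_sum X\<^sup>2) UNIV"
      unfolding X X2_def by (rule has_sum_infsum[OF s])
    have tail: "(v J e m * qabs m)\<^sup>2 \<le> 2 * P m + c2 * inv_sq m" if m: "m \<in> - ?F" for m
    proof -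
      define n where "n = nat \<bar>m\<bar>"
      have nM: "n > M" and mn: "m = int n \<or> m = - int n" using m by (auto simp: n_def)
      have nn: "n \<ge> n0" "n \<ge> 1" using nM M by auto
      have "2 * (K * X * res_const) \<le> 2 * (K * sqrt (B + 1) * res_const)"
        using K XB res_const_nonneg by (intro mult_left_mono mult_right_mono) auto
      also have "\<dots> \<le> real N3" unfolding N3_def by (rule real_nat_ceiling_ge)
      also have "\<dots> \<le> real n" using nM M by simp
      finally have small: "2 * (K * X * res_const) \<le> real n" .
      have "v J e (int n) * qabs (int n) \<le> v J e (int n) * cmod (offdiag n (r n)) + 2 * K * X\<^sup>2 * res_const / real n"
        by (rule weighted_coefficient[where v = "v J e" and J = J])
           (use L[OF nn(1)] r[OF nn(1)] v1[OF J e(1)] vJ K wK[OF e(1) J] X(1) hX small in \<open>auto simp: v_def truncation_def\<close>)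
      also have "\<dots> \<le> w (int n) * cmod (offdiag n (r n)) + 2 * K * (B + 1) * res_const / real n"
        using K res_const_nonneg X(2) le
        by (intro add_mono mult_right_mono divide_right_mono mult_left_mono) (auto simp: v_def truncation_def)
      finally have "(v J e (int n) * qabs (int n))\<^sup>2 \<le> (w (int n) * cmod (offdiag n (r n)) + 2 * K * (B + 1) * res_const / real n)\<^sup>2"
        using v1[OF J e(1), of "int n"] by (intro power_mono) (auto simp: qabs_def)
      also have "\<dots> \<le> 2 * (w (int n) * cmod (offdiag n (r n)))\<^sup>2 + 2 * (2 * K * (B + 1) * res_const / real n)\<^sup>2"
        using zero_le_power2[of "w (int n) * cmod (offdiag n (r n)) - 2 * K * (B + 1) * res_const / real n"]
        by (simp add: power2_sum power2_diff)
      also have "2 * (2 * K * (B + 1) * res_const / real n)\<^sup>2 = c2 * inv_sq m"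
        using mn nn by (auto simp: c2_def inv_sq_def power_divide power_mult_distrib)
      also have "(w (int n) * cmod (offdiag n (r n)))\<^sup>2 = P m" using nn by (simp add: P_def f_def n_def[symmetric])
      also have "v J e (int n) * qabs (int n) = v J e m * qabs m" using mn by (auto simp: v_sym qabs_minus)
      finally show ?thesis .
    qed
    have "X2 J e = (\<Sum>m\<in>?F. (v J e m * qabs m)\<^sup>2) + (\<Sum>\<^sub>\<infinity>m\<in>- ?F. (v J e m * qabs m)\<^sup>2)"
      unfolding X2_def by (rule infsum_split_int[OF s])
    also have "(\<Sum>m\<in>?F. (v J e m * qabs m)\<^sup>2) \<le> (\<Sum>m\<in>?F. 2 * (qabs m)\<^sup>2)"
      unfolding power_mult_distrib by (intro sum_mono mult_right_mono v2[OF J e]) auto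
    also have "\<dots> = 2 * (\<Sum>m\<in>?F. (qabs m)\<^sup>2)" by (simp add: sum_distrib_left)
    also have "(\<Sum>m\<in>?F. (qabs m)\<^sup>2) \<le> q0"
      unfolding q0_def by (rule finite_sum_le_infsum[OF qabs_square_summable]) auto
    also have "(\<Sum>\<^sub>\<infinity>m\<in>- ?F. (v J e m * qabs m)\<^sup>2) \<le> (\<Sum>\<^sub>\<infinity>m\<in>- ?F. 2 * P m + c2 * inv_sq m)"
      by (intro infsum_mono tail summable_on_add summable_on_cmult_right)
         (auto intro: summable_on_subset_banach[OF s] summable_on_subset_banach[OF Ps] summable_on_subset_banach[OF inv_sq_summable])
    also have "\<dots> = 2 * (\<Sum>\<^sub>\<infinity>m\<in>- ?F. P m) + (\<Sum>\<^sub>\<infinity>m\<in>- ?F. c2 * inv_sq m)"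
      by (subst infsum_add)
         (auto intro!: summable_on_cmult_right summable_on_subset_banach[OF Ps] summable_on_subset_banach[OF inv_sq_summable]
           simp: infsum_cmult_right')
    also have "\<dots> \<le> 1" using N1[OF M(1)] N2[OF M(2)] by linarith
    finally show ?thesis by (simp add: B_def)
  qed
  have cont: "continuous_on {0..e1} (X2 J)" if J: "J \<ge> 1" for J
  proof (rule uniform_limit_theorem[where F = "finite_subsets_at_top UNIV"])
    show "uniform_limit {0..e1} (\<lambda>F e. \<Sum>m\<in>F. (v J e m * qabs m)\<^sup>2) (X2 J) (finite_subsets_at_top UNIV)"
      unfolding X2_def[abs_def]
      by (rule Weierstrass_m_test_general[OF _ Js[of J]]) (use dom[OF J] in auto)
    show "\<forall>\<^sub>F F in finite_subsets_at_top UNIV. continuous_on {0..e1} (\<lambda>e. \<Sum>m\<in>F. (v J e m * qabs m)\<^sup>2)"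
      unfolding v_def truncation_def by (intro always_eventually allI continuous_intros)
  qed auto
  have bound: "X2 J e1 \<le> B" if J: "J \<ge> 1" for J
  proof (rule ccontr)
    assume "\<not> X2 J e1 \<le> B"
    hence "X2 J e1 \<ge> B + 1" using step[OF J, of e1] e1 by linarith
    moreover have "X2 J 0 \<le> B + 1"
    proof -
      have "v J 0 m = 1" for m using w1[of m] J by (simp add: v_def truncation_def)
      hence "X2 J 0 = q0" by (simp add: X2_def q0_def)
      thus ?thesis using q0 by (simp add: B_def)
    qed
    ultimately obtain t where "0 \<le> t" "t \<le> e1" "X2 J t = B + 1"
      using IVT'[of "X2 J" 0 "B + 1" e1] e1 cont[OF J] by auto
    thus False using step[OF J, of t] by simp
  qed
  have "(\<lambda>m. (min (w m) (exp (e1 * real_of_int \<bar>m\<bar>)) * qabs m)\<^sup>2) summable_on UNIV"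
  proof (rule nonneg_bdd_above_summable_on)
    show "bdd_above (sum (\<lambda>m. (min (w m) (exp (e1 * real_of_int \<bar>m\<bar>)) * qabs m)\<^sup>2) ` {F. F \<subseteq> UNIV \<and> finite F})"
    proof (rule bdd_aboveI2)
      fix F assume "F \<in> {F :: int set. F \<subseteq> UNIV \<and> finite F}"
      hence F: "finite F" by simp
      \<comment> \<open>A cap above all values of \<open>w\<close> on \<open>F\<close> is invisible
        there, so the bound \<open>B\<close>, uniform in \<open>J\<close>, passes to the uncapped
        weight.\<close>
      define J where "J = 1 + (\<Sum>m\<in>F. w m)"
      have w0: "w m \<ge> 0" for m using w1[of m] by linarith
      have J: "J \<ge> 1" unfolding J_def using sum_nonneg[of F w] w0 by simp
      have wJ: "w m \<le> J" if "m \<in> F" for m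
        using member_le_sum[OF that _ F, of w] w0 by (simp add: J_def)
      have "(\<Sum>m\<in>F. (min (w m) (exp (e1 * real_of_int \<bar>m\<bar>)) * qabs m)\<^sup>2) = (\<Sum>m\<in>F. (v J e1 m * qabs m)\<^sup>2)"
      proof (rule sum.cong)
        fix m assume "m \<in> F"
        hence "min (w m) (exp (e1 * real_of_int \<bar>m\<bar>)) = v J e1 m" using wJ[of m] by (auto simp: v_def truncation_def min_def)
        thus "(min (w m) (exp (e1 * real_of_int \<bar>m\<bar>)) * qabs m)\<^sup>2 = (v J e1 m * qabs m)\<^sup>2" by simp
      qed simp
      also have "\<dots> \<le> X2 J e1" unfolding X2_def
        by (rule finite_sum_le_infsum[OF vs[OF J]]) (use F e1 in auto)
      also have "\<dots> \<le> B" by (rule bound[OF J])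
      finally show "(\<Sum>m\<in>F. (min (w m) (exp (e1 * real_of_int \<bar>m\<bar>)) * qabs m)\<^sup>2) \<le> B" .
    qed
  qed auto
  thus ?thesis using e1 by blast
qed

end

section \<open>Analytic potentials\<close>

text \<open>Pointwise Fourier inversion requires a derivative, so it is applied to a second
  antiderivative of \<open>d\<close>, which therefore vanishes. Hence all integrals of
  \<open>d\<close> over intervals vanish, and Lebesgue differentiation gives \<open>d = 0\<close>
  almost everywhere.\<close>

lemma periodic_AE_zero:
  assumes per: "\<And>x. d (x + 2) = d x" and d: "integrable M2 d" and z: "\<And>k. fc d k = 0"
  shows "AE x in lebesgue. d x = 0"
proof -
  have no: "fc G k = 0" if "fc G 0 = 0" "\<And>k. 0 = \<i> * of_real (pi * of_int k) * fc G k" for G k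
    using that(1) that(2)[of k] by (cases "k = 0") auto
  obtain G where G: "\<And>x. G (x + 2) = G x" "continuous_on UNIV G"
    "\<And>a b. a \<le> b \<Longrightarrow> (d has_integral (G b - G a)) {a..b}"
    "fc G 0 = 0" "\<And>k. fc d k = \<i> * of_real (pi * of_int k) * fc G k"
    by (rule periodic_antiderivative[of d 0, OF per d z]) blast
  have fG: "fc G k = 0" for k by (rule no[OF G(4)]) (use G(5) z in metis)
  have GM: "integrable M2 G" by (rule continuous_imp_integrable_real[OF continuous_on_subset[OF G(2)]]) auto
  obtain F where F: "\<And>x. F (x + 2) = F x" "continuous_on UNIV F"
    "\<And>a b. a \<le> b \<Longrightarrow> (G has_integral (F b - F a)) {a..b}"
    "fc F 0 = 0" "\<And>k. fc G k = \<i> * of_real (pi * of_int k) * fc F k"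
    by (rule periodic_antiderivative[of G 0, OF G(1) GM fG]) blast
  have fF: "fc F k = 0" for k by (rule no[OF F(4)]) (use F(5) fG in metis)
  have dF: "(F has_vector_derivative G t) (at t)" for t by (rule has_integral_imp_derivative[OF G(2) F(3)])
  have "F t = 0" for t using Fourier_series[OF F(1) dF, of t] by (simp add: fF fsynth_def)
  hence "F = (\<lambda>_. 0)" by (simp add: fun_eq_iff)
  hence "((\<lambda>_. 0) has_vector_derivative G t) (at t)" for t using dF[of t] by simp
  hence G0: "G t = 0" for t using vector_derivative_unique_at[OF _ has_vector_derivative_const] by metis
  hence int0: "(d has_integral 0) {a..b}" if "a \<le> b" for a b using G(3)[OF that] by simp
  have "d integrable_on cbox a b" for a b
    using int0[of a b] by (cases "a \<le> b") (auto intro: has_integral_integrable)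
  then obtain N where N: "negligible N"
    "\<And>x e. \<lbrakk>x \<notin> N; 0 < e\<rbrakk> \<Longrightarrow> \<exists>\<delta>>0. \<forall>h. 0 < h \<and> h < \<delta> \<longrightarrow>
       norm (integral (cbox x (x + h *\<^sub>R One)) d /\<^sub>R h ^ DIM(real) - d x) < e"
    by (rule integrable_ccontinuous_explicit) blast
  have "d x = 0" if "x \<notin> N" for x
  proof -
    have "norm (d x) < e" if e: "e > 0" for e
    proof -
      obtain \<delta> where \<delta>: "\<delta> > 0" "\<And>h. 0 < h \<Longrightarrow> h < \<delta> \<Longrightarrow> norm (integral (cbox x (x + h *\<^sub>R One)) d /\<^sub>R h ^ DIM(real) - d x) < e"
        using N(2)[OF \<open>x \<notin> N\<close> e] by blast
      have "integral {x..x + \<delta> / 2} d = 0" by (rule integral_unique[OF int0]) (use \<delta> in auto)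
      thus ?thesis using \<delta>(2)[of "\<delta> / 2"] \<delta>(1) by simp
    qed
    thus ?thesis by (metis less_irrefl zero_less_norm_iff)
  qed
  moreover have "AE x in lebesgue. x \<notin> N"
    by (rule AE_not_in) (use N(1) negligible_iff_null_sets in blast)
  ultimately show ?thesis by (auto elim: eventually_mono)
qed

text \<open>Each mode is expanded around \<open>t0\<close> in the exponential series. As
  \<open>|pi k (t - t0)| \<le> s |k|\<close>, the double series is dominated by \<open>xs\<close>,
  and the sums may be exchanged.\<close>

lemma fsynth_power_series:
  assumes s: "s > 0" and xs: "(\<lambda>k. cmod (x k) * exp (s * real_of_int \<bar>k\<bar>)) summable_on UNIV"
    and t: "\<bar>t - t0\<bar> < s / pi"
  shows "(\<lambda>n. (\<Sum>\<^sub>\<infinity>k. x k * fmode k t0 * (\<i> * of_real (pi * of_int k)) ^ n / fact n) * of_real (t - t0) ^ n) sums fsynth x t"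
proof -
  define z where "z k = \<i> * of_real (pi * of_int k) * of_real (t - t0)" for k
  define F where "F k n = x k * fmode k t0 * (z k ^ n / fact n)" for k n
  have ek: "fmode k t = fmode k t0 * exp (z k)" for k
  proof -
    have "fmode k t = exp (\<i> * of_real (pi * of_int k * t0) + z k)"
      by (simp add: fmode_def cis_conv_exp z_def algebra_simps)
    thus ?thesis by (simp add: exp_add fmode_def cis_conv_exp)
  qed
  have es: "((\<lambda>n. y ^ n / fact n) has_sum exp y) UNIV" for y :: complex
    using norm_summable_imp_has_sum[OF summable_norm_exp exp_converges, of y]
    by (simp add: scaleR_conv_of_real divide_inverse mult.commute)
  have er: "((\<lambda>n. y ^ n / fact n) has_sum exp y) UNIV" for y :: real
    using norm_summable_imp_has_sum[OF summable_norm_exp exp_converges, of y]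
    by (simp add: divide_inverse mult.commute)
  have zs: "cmod (z k) \<le> s * real_of_int \<bar>k\<bar>" for k
  proof -
    have "cmod (z k) = (pi * \<bar>t - t0\<bar>) * real_of_int \<bar>k\<bar>"
      by (simp add: z_def norm_mult mult_ac del: of_real_diff)
    also have "\<dots> \<le> s * real_of_int \<bar>k\<bar>"
      using t by (intro mult_right_mono) (auto simp: field_simps)
    finally show ?thesis .
  qed
  have Fs: "(\<lambda>(k, n). F k n) summable_on UNIV \<times> UNIV"
  proof -
    have "(\<lambda>p. cmod (case p of (k, n) \<Rightarrow> F k n)) summable_on UNIV \<times> UNIV"
    proof (rule summable_on_SigmaI)
      show "((\<lambda>n. cmod (case (k, n) of (k, n) \<Rightarrow> F k n)) has_sum (cmod (x k) * exp (cmod (z k)))) UNIV" for k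
        using has_sum_cmult_right[OF er[of "cmod (z k)"], of "cmod (x k)"]
        by (simp add: F_def norm_mult norm_divide norm_power)
      show "(\<lambda>k. cmod (x k) * exp (cmod (z k))) summable_on UNIV"
        by (rule summable_on_comparison_test[OF xs]) (auto intro!: mult_left_mono zs[unfolded of_int_abs])
    qed auto
    thus ?thesis by (rule abs_summable_summable)
  qed
  have Fn: "(\<Sum>\<^sub>\<infinity>n. F k n) = x k * fmode k t" for k
    unfolding F_def ek using has_sum_cmult_right[OF es[of "z k"], of "x k * fmode k t0"] by (simp add: infsumI mult.assoc)
  have Fk: "(\<Sum>\<^sub>\<infinity>k. F k n) = (\<Sum>\<^sub>\<infinity>k. x k * fmode k t0 * (\<i> * of_real (pi * of_int k)) ^ n / fact n) * of_real (t - t0) ^ n" for n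
    unfolding infsum_cmult_left'[symmetric]
    by (intro infsum_cong) (simp only: F_def z_def power_mult_distrib times_divide_eq_right times_divide_eq_left mult.assoc)
  have Fs': "(\<lambda>(n, k). F k n) summable_on UNIV \<times> UNIV"
    using Fs by (subst summable_on_swap) (simp add: case_prod_unfold)
  have "fsynth x t = (\<Sum>\<^sub>\<infinity>k. \<Sum>\<^sub>\<infinity>n. F k n)" by (simp add: fsynth_def Fn)
  also have "\<dots> = (\<Sum>\<^sub>\<infinity>n. \<Sum>\<^sub>\<infinity>k. F k n)" by (rule infsum_swap_banach[OF Fs])
  finally have e: "(\<Sum>\<^sub>\<infinity>n. \<Sum>\<^sub>\<infinity>k. F k n) = fsynth x t" by simp
  have "(\<lambda>n. \<Sum>\<^sub>\<infinity>k. F k n) summable_on UNIV"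
    using summable_on_Sigma_banach[OF Fs'] by simp
  hence "((\<lambda>n. \<Sum>\<^sub>\<infinity>k. F k n) has_sum fsynth x t) UNIV" unfolding e[symmetric] by (rule has_sum_infsum)
  thus ?thesis unfolding Fk by (rule has_sum_imp_sums)
qed

context hill_potential
begin

lemma exponential_decay_imp_analytic:
  assumes \<kappa>: "\<kappa> > 0" and s: "(\<lambda>m. (exp (\<kappa> * real_of_int \<bar>m\<bar>) * qabs m)\<^sup>2) summable_on UNIV"
  shows "\<exists>g. real_analytic_circle g \<and> (AE x in lebesgue. q x = g x)"
proof -
  define C where "C = sqrt (\<Sum>\<^sub>\<infinity>m. (exp (\<kappa> * real_of_int \<bar>m\<bar>) * qabs m)\<^sup>2)"
  have C0: "C \<ge> 0" by (simp add: C_def infsum_nonneg)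
  have qcC: "exp (\<kappa> * real_of_int \<bar>m\<bar>) * qabs m \<le> C" for m
    unfolding C_def by (rule real_le_rsqrt) (use finite_sum_le_infsum[OF s, of "{m}"] in simp)
  \<comment> \<open>For \<open>k = 2 * m\<close> the decay \<open>exp (- \<kappa> |m|)\<close>
    equals \<open>exp (- 2 \<sigma> |k|)\<close>. One half becomes the weight in the power series
    lemma, the other a geometric majorant.\<close>
  define \<sigma> where "\<sigma> = \<kappa> / 4"
  have \<sigma>: "\<sigma> > 0" using \<kappa> by (simp add: \<sigma>_def)
  have bound: "cmod (fc q k) * exp (\<sigma> * real_of_int \<bar>k\<bar>) \<le> C * exp (- \<sigma>) ^ nat \<bar>k\<bar>" for k
  proof (cases "even k")
    case True
    then obtain m where m: "k = 2 * m" by auto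
    have km: "real_of_int \<bar>k\<bar> = 2 * real_of_int \<bar>m\<bar>" by (simp add: m abs_mult)
    have "exp (\<sigma> * real_of_int \<bar>k\<bar>) = exp (\<kappa> * real_of_int \<bar>m\<bar>) * exp (- \<sigma> * real_of_int \<bar>k\<bar>)"
      unfolding exp_add[symmetric] km \<sigma>_def by simp
    hence "cmod (fc q k) * exp (\<sigma> * real_of_int \<bar>k\<bar>) = (exp (\<kappa> * real_of_int \<bar>m\<bar>) * qabs m) * exp (- \<sigma> * real_of_int \<bar>k\<bar>)"
      by (simp only: m qabs_def mult_ac)
    also have "\<dots> \<le> C * exp (- \<sigma> * real_of_int \<bar>k\<bar>)" by (intro mult_right_mono qcC) auto
    also have "exp (- \<sigma> * real_of_int \<bar>k\<bar>) = exp (- \<sigma>) ^ nat \<bar>k\<bar>"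
      by (subst exp_of_nat_mult[symmetric]) (simp add: mult.commute)
    finally show ?thesis .
  qed (use C0 in \<open>simp add: fc_q_eq\<close>)
  have gs: "(\<lambda>n. C * exp (- \<sigma>) ^ n) summable_on UNIV"
    by (subst summable_on_UNIV_nonneg_real_iff) (use C0 \<sigma> in \<open>auto intro!: summable_mult summable_geometric\<close>)
  have xs: "(\<lambda>k. cmod (fc q k) * exp (\<sigma> * real_of_int \<bar>k\<bar>)) summable_on UNIV"
    by (rule summable_on_comparison_test[OF summable_on_nat_abs[OF gs] bound]) auto
  have xs0: "(\<lambda>k. cmod (fc q k)) summable_on UNIV"
    by (rule summable_on_comparison_test[OF xs]) (use \<sigma> in \<open>auto intro!: mult_le_cancel_left1[THEN iffD2]\<close>)
  define g where "g = fsynth (fc q)"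
  have "g (t + 1) = g t" for t
    unfolding g_def fsynth_def by (intro infsum_cong) (simp add: fmode_shift_one fc_q_eq)
  moreover have "\<exists>r>0. \<exists>a :: nat \<Rightarrow> complex. \<forall>t. \<bar>t - t0\<bar> < r \<longrightarrow> (\<lambda>n. a n * of_real (t - t0) ^ n) sums g t" for t0
    unfolding g_def using \<sigma>
    by (intro exI[of _ "\<sigma> / pi"] exI[of _ "\<lambda>n. \<Sum>\<^sub>\<infinity>k. fc q k * fmode k t0 * (\<i> * of_real (pi * of_int k)) ^ n / fact n"]
        conjI allI impI fsynth_power_series[OF \<sigma> xs]) auto
  ultimately have an: "real_analytic_circle g" by (simp add: real_analytic_circle_def)
  have gM: "integrable M2 g" unfolding g_def
    by (rule continuous_imp_integrable_real[OF fsynth_continuous[OF xs0]])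
  have "AE x in lebesgue. q x - g x = 0"
  proof (rule periodic_AE_zero)
    show "q (x + 2) - g (x + 2) = q x - g x" for x by (simp add: q_periodic g_def fsynth_periodic)
    show "integrable M2 (\<lambda>x. q x - g x)" by (intro Bochner_Integration.integrable_diff q_integrable gM)
    show "fc (\<lambda>x. q x - g x) k = 0" for k unfolding fc_diff[OF q_integrable gM] by (simp add: g_def fc_syn[OF xs0])
  qed
  hence "AE x in lebesgue. q x = g x" by (auto elim: eventually_mono)
  thus ?thesis using an by blast
qed

end

section \<open>From the gap lengths to the potential\<close>

text \<open>The last clause says, without division, that \<open>ln (w n) / n\<close> is nonincreasing from \<open>N\<close> on.\<close>

definition rate_decreasing_weight :: "(int \<Rightarrow> real) \<Rightarrow> nat \<Rightarrow> bool" where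
  "rate_decreasing_weight w N \<longleftrightarrow> N \<ge> 1 \<and> (\<forall>m. w m \<ge> 1 \<and> w (- m) = w m) \<and>
     (\<forall>a b. a \<le> b \<longrightarrow> w (int a) \<le> w (int b)) \<and>
     (\<forall>a b. N \<le> a \<longrightarrow> a \<le> b \<longrightarrow> ln (w (int b)) * real a \<le> ln (w (int a)) * real b)"

context
  fixes w :: "int \<Rightarrow> real" and N :: nat
  assumes w: "rate_decreasing_weight w N"
begin

lemma weight_ge_1: "w m \<ge> 1" and weight_minus: "w (- m) = w m"
  and weight_mono: "a \<le> b \<Longrightarrow> w (int a) \<le> w (int b)"
  using w by (auto simp: rate_decreasing_weight_def)

lemma weight_abs: "w m = w (int (nat \<bar>m\<bar>))"
  using weight_minus[of m] by (cases "m \<ge> 0") auto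

text \<open>Each of the three functions under the minimum in \<open>\<psi>\<close> is nondecreasing
  with nonincreasing quotient from \<open>N\<close> on, and minima inherit both. The constant is
  free of \<open>e\<close> and \<open>J\<close>, as the continuity method demands.\<close>

lemma weight_truncation:
  assumes e: "e \<ge> 0" and J: "J \<ge> 1"
  shows "truncation w e J (a + b) \<le> w (int (2 * N)) * (truncation w e J a * truncation w e J b)"
proof -
  define \<psi> where "\<psi> n = min (ln (w (int n))) (min (e * real n) (ln J))" for n
  have w0: "w m > 0" for m using weight_ge_1[of m] by linarith
  have exp_min: "exp (min x y) = min (exp x) (exp y)" for x y :: real by (simp add: min_def)
  have v: "truncation w e J m = exp (\<psi> (nat \<bar>m\<bar>))" for m
    using w0 J by (simp add: truncation_def \<psi>_def exp_min weight_abs[of m])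
  have mono: "\<psi> a \<le> \<psi> b" if "a \<le> b" for a b
    unfolding \<psi>_def using weight_mono[OF that] w0 that e by (intro min.mono mult_left_mono) auto
  have nn: "\<psi> 0 \<ge> 0" using weight_ge_1 J by (simp add: \<psi>_def)
  have anti: "\<psi> b * real a \<le> \<psi> a * real b" if "N \<le> a" "a \<le> b" for a b
  proof -
    have "\<psi> b * real a \<le> ln (w (int a)) * real b"
    proof -
      have "\<psi> b * real a \<le> ln (w (int b)) * real a" by (intro mult_right_mono) (auto simp: \<psi>_def)
      also have "\<dots> \<le> ln (w (int a)) * real b" using w that by (auto simp: rate_decreasing_weight_def)
      finally show ?thesis .
    qed
    moreover have "\<psi> b * real a \<le> (e * real a) * real b"
    proof -
      have "\<psi> b * real a \<le> (e * real b) * real a" by (intro mult_right_mono) (auto simp: \<psi>_def)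
      thus ?thesis by (simp add: mult_ac)
    qed
    moreover have "\<psi> b * real a \<le> ln J * real b"
    proof -
      have "\<psi> b * real a \<le> ln J * real a" by (intro mult_right_mono) (auto simp: \<psi>_def)
      also have "\<dots> \<le> ln J * real b" using J that by (intro mult_left_mono) auto
      finally show ?thesis .
    qed
    ultimately show ?thesis unfolding \<psi>_def[of a] by (simp add: min_def)
  qed
  have N: "N \<ge> 1" using w by (simp add: rate_decreasing_weight_def)
  have "\<psi> (nat \<bar>a + b\<bar>) \<le> \<psi> (nat \<bar>a\<bar> + nat \<bar>b\<bar>)" by (rule mono) linarith
  also have "\<dots> \<le> \<psi> (2 * N) + \<psi> (nat \<bar>a\<bar>) + \<psi> (nat \<bar>b\<bar>)"
    by (rule subadditive_upto_constant[of \<psi>, OF mono nn N anti])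
  also have "\<psi> (2 * N) \<le> ln (w (int (2 * N)))" by (simp add: \<psi>_def)
  finally have "exp (\<psi> (nat \<bar>a + b\<bar>)) \<le> exp (ln (w (int (2 * N))) + \<psi> (nat \<bar>a\<bar>) + \<psi> (nat \<bar>b\<bar>))" by simp
  also have "\<dots> = w (int (2 * N)) * (exp (\<psi> (nat \<bar>a\<bar>)) * exp (\<psi> (nat \<bar>b\<bar>)))"
    using w0 by (simp add: exp_add)
  finally show ?thesis unfolding v .
qed

text \<open>Makes the shift between the number of a tile and the number of its gap cost a constant
  factor.\<close>

lemma weight_shift: "w (int (j + n)) \<le> w (int (2 * N)) * (w (int j) * w (int n))"
proof -
  have w0: "w m > 0" for m using weight_ge_1[of m] by linarith
  have "ln (w (int (j + n))) \<le> ln (w (int (2 * N))) + ln (w (int j)) + ln (w (int n))"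
    by (rule subadditive_upto_constant[of "\<lambda>n. ln (w (int n))"])
       (use w w0 weight_mono weight_ge_1 in \<open>auto simp: rate_decreasing_weight_def simp del: of_nat_mult\<close>)
  hence "exp (ln (w (int (j + n)))) \<le> exp (ln (w (int (2 * N))) + ln (w (int j)) + ln (w (int n)))" by simp
  thus ?thesis using w0 by (simp add: exp_add mult.assoc del: of_nat_add of_nat_mult)
qed

end

context hill_spectrum
begin

lemma gaps_imp_regularity:
  assumes w: "rate_decreasing_weight w N"
    and gaps: "(\<lambda>n. (w (int n))\<^sup>2 * \<bar>gap_length lam n\<bar>\<^sup>2) summable_on {1..}"
  shows "\<exists>e>0. (\<lambda>m. (min (w m) (exp (e * real_of_int \<bar>m\<bar>)) * qabs m)\<^sup>2) summable_on UNIV"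
proof -
  define h where "h n = (w (int n))\<^sup>2 * \<bar>gap_length lam n\<bar>\<^sup>2" for n
  have w0: "w m \<ge> 1" "w m > 0" for m using weight_ge_1[OF w, of m] by linarith+
  have h0: "h n \<ge> 0" for n by (simp add: h_def)
  have gap0: "(\<lambda>n. gap_length lam n) \<longlonglongrightarrow> 0"
  proof -
    have "(\<lambda>n. h (Suc n)) summable_on UNIV"
    proof -
      have "h summable_on range Suc" using gaps unfolding h_def[abs_def]
        by (rule summable_on_subset) auto
      thus ?thesis by (subst (asm) summable_on_reindex) (auto simp: o_def)
    qed
    hence "(\<lambda>n. h (Suc n)) \<longlonglongrightarrow> 0" by (intro summable_LIMSEQ_zero summable_on_imp_summable)
    hence h0': "(\<lambda>n. sqrt (h (Suc n))) \<longlonglongrightarrow> 0" using tendsto_real_sqrt by force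
    have "(\<lambda>n. gap_length lam (Suc n)) \<longlonglongrightarrow> 0"
    proof (rule Lim_null_comparison[OF always_eventually h0'], rule allI)
      fix n
      have "1 * \<bar>gap_length lam (Suc n)\<bar> \<le> w (int (Suc n)) * \<bar>gap_length lam (Suc n)\<bar>"
        by (intro mult_right_mono w0) auto
      also have "\<dots> = sqrt (h (Suc n))"
        using w0(2)[of "int (Suc n)"] by (simp add: h_def real_sqrt_mult)
      finally show "norm (gap_length lam (Suc n)) \<le> sqrt (h (Suc n))" by simp
    qed
    thus ?thesis by (rule LIMSEQ_imp_Suc)
  qed
  obtain n0 j0 :: nat and r where g: "j0 \<ge> 1" "\<And>n. n \<ge> n0 \<Longrightarrow> large n" "\<And>n. n \<ge> n0 \<Longrightarrow> r n \<in> tile n"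
    "\<And>n. n \<ge> n0 \<Longrightarrow> cmod (offdiag n (r n)) \<le> gap_length lam (j0 + (n - n0))"
    by (rule gap_control[OF gap0]) blast
  define C where "C = w (int (2 * N)) * w (int n0)"
  have C0: "C \<ge> 0" unfolding C_def using w0(2) by (intro mult_nonneg_nonneg) (auto intro: less_imp_le)
  define J where "J n = j0 + (n - n0)" for n
  have hJ: "(\<lambda>n. h (J n)) summable_on {n0..}"
  proof -
    have "h summable_on J ` {n0..}" using gaps unfolding h_def[abs_def]
      by (rule summable_on_subset) (use g(1) in \<open>auto simp: J_def\<close>)
    thus ?thesis by (subst (asm) summable_on_reindex) (auto simp: o_def inj_on_def J_def)
  qed
  have p: "(\<lambda>n. (w (int n) * cmod (offdiag n (r n)))\<^sup>2) summable_on {n0..}"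
  proof (rule summable_on_comparison_test)
    show "(\<lambda>n. C\<^sup>2 * h (J n)) summable_on {n0..}" by (rule summable_on_cmult_right[OF hJ])
    fix n assume n: "n \<in> {n0..}"
    \<comment> \<open>The gap number \<open>J n\<close> may be smaller than \<open>n\<close>, but by
      less than \<open>n0\<close>, since \<open>j0\<close> is positive.\<close>
    have "w (int n) \<le> w (int (J n + n0))" by (rule weight_mono[OF w]) (use n in \<open>auto simp: J_def\<close>)
    also have "\<dots> \<le> C * w (int (J n))" using weight_shift[OF w, of "J n" n0] by (simp add: C_def mult_ac)
    finally have wC: "w (int n) \<le> C * w (int (J n))" .
    have gJ: "cmod (offdiag n (r n)) \<le> gap_length lam (J n)" unfolding J_def by (rule g(4)) (use n in simp)
    have "w (int n) * cmod (offdiag n (r n)) \<le> (C * w (int (J n))) * gap_length lam (J n)"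
      by (rule mult_mono[OF wC gJ]) (use C0 w0(2)[of "int (J n)"] in simp_all)
    hence "(w (int n) * cmod (offdiag n (r n)))\<^sup>2 \<le> ((C * w (int (J n))) * gap_length lam (J n))\<^sup>2"
      using w0(2)[of "int n"] by (intro power_mono) auto
    thus "(w (int n) * cmod (offdiag n (r n)))\<^sup>2 \<le> C\<^sup>2 * h (J n)" by (simp add: h_def power_mult_distrib)
  qed auto
  show ?thesis
    by (rule weighted_regularity[where K = "w (int (2 * N))" and r = r and ?n0.0 = n0])
       (use w0 weight_minus[OF w] weight_truncation[OF w] g p in \<open>auto intro: less_imp_le\<close>)
qed

end

text \<open>If the quotient is eventually nondecreasing, its limit 0 bounds it from above, while
  \<open>w \<ge> 1\<close> bounds it from below by 0. It then vanishes from \<open>N\<close> on, so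
  the decreasing alternative is the essential one.\<close>

lemma strictly_subexponential_imp_rate_decreasing:
  assumes w: "strictly_subexponential_weight w"
  shows "\<exists>N. rate_decreasing_weight w N"
proof -
  have nw: "\<And>m. w m \<ge> 1" "\<And>m. w (- m) = w m"
    and lim: "(\<lambda>n. ln (w (int n)) / real n) \<longlonglongrightarrow> 0"
    and mono: "mono_on {0..} w"
    using w by (auto simp: strictly_subexponential_weight_def normalized_weight_def)
  obtain N where N: "mono_on {N..} (\<lambda>n. ln (w (int n)) / real n) \<or> antimono_on {N..} (\<lambda>n. ln (w (int n)) / real n)"
    using w by (auto simp: strictly_subexponential_weight_def)
  define N' where "N' = max N 1"
  have main: "ln (w (int b)) * real a \<le> ln (w (int a)) * real b" if ab: "N' \<le> a" "a \<le> b" for a b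
  proof -
    have pos: "real a > 0" "real b > 0" and aN: "a \<in> {N..}" "b \<in> {N..}" using ab by (auto simp: N'_def)
    have "ln (w (int b)) / real b \<le> ln (w (int a)) / real a"
      using N
    proof
      assume m: "mono_on {N..} (\<lambda>n. ln (w (int n)) / real n)"
      have "ln (w (int b)) / real b \<le> 0"
      proof (rule LIMSEQ_le_const[OF lim], intro exI allI impI)
        fix n assume "b \<le> n"
        thus "ln (w (int b)) / real b \<le> ln (w (int n)) / real n"
          using mono_onD[OF m, of b n] aN by auto
      qed
      also have "0 \<le> ln (w (int a)) / real a" using nw(1)[of "int a"] by simp
      finally show ?thesis .
    next
      assume m: "antimono_on {N..} (\<lambda>n. ln (w (int n)) / real n)"
      show ?thesis using monotone_onD[OF m aN(1) aN(2) ab(2)] .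
    qed
    thus ?thesis using pos by (simp add: field_simps)
  qed
  have "w (int a) \<le> w (int b)" if "a \<le> b" for a b using mono_onD[OF mono, of "int a" "int b"] that by auto
  hence "rate_decreasing_weight w N'" using nw main by (auto simp: rate_decreasing_weight_def N'_def)
  thus ?thesis ..
qed

theorem theorem3:
  fixes w :: "int \<Rightarrow> real" and q :: "real \<Rightarrow> complex" and lam :: "nat \<Rightarrow> real"
  assumes "normalized_weight w"
    and "q \<in> L2_circle"
    and "AE x in lebesgue. q x \<in> \<real>"
    and "periodic_eigenvalue_list q lam"
    and "(\<lambda>n. (w (int n))\<^sup>2 * \<bar>gap_length lam n\<bar>\<^sup>2) summable_on {1..}"
  shows "(strictly_subexponential_weight w \<longrightarrow> q \<in> H_weighted w) \<and>
    (exponential_weight w \<longrightarrow>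
       (\<exists>g. real_analytic_circle g \<and> (AE x in lebesgue. q x = g x)))"
proof (intro conjI impI)
  interpret hill_spectrum q lam by unfold_locales (fact assms)+
  assume w: "strictly_subexponential_weight w"
  then obtain N where "rate_decreasing_weight w N" using strictly_subexponential_imp_rate_decreasing by blast
  note wN = this
  obtain e where e: "e > 0" "(\<lambda>m. (min (w m) (exp (e * real_of_int \<bar>m\<bar>)) * qabs m)\<^sup>2) summable_on UNIV"
    using gaps_imp_regularity[OF wN assms(5)] by blast
  have "(\<lambda>n. ln (w (int n)) / real n) \<longlonglongrightarrow> 0" using w by (simp add: strictly_subexponential_weight_def)
  from order_tendstoD(2)[OF this e(1)]
  obtain M where M: "\<And>n. n \<ge> M \<Longrightarrow> ln (w (int n)) / real n < e" by (auto simp: eventually_sequentially)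
  define F where "F = {- int M..int M}"
  \<comment> \<open>Beyond \<open>M\<close> the subexponential weight lies below
    \<open>exp (e * |m|)\<close>, so the minimum is \<open>w\<close> itself and finitely many modes
    remain.\<close>
  have eq: "(min (w m) (exp (e * real_of_int \<bar>m\<bar>)) * qabs m)\<^sup>2 = (w m)\<^sup>2 * (cmod (fourier_coeff q m))\<^sup>2" if "m \<in> - F" for m
  proof -
    define n where "n = nat \<bar>m\<bar>"
    have n: "n \<ge> M" "real n > 0" "real_of_int \<bar>m\<bar> = real n" using that by (auto simp: F_def n_def)
    have "w m > 0" using weight_ge_1[OF wN, of m] by linarith
    have "w m = w (int n)" unfolding n_def by (rule weight_abs[OF wN])
    hence "ln (w m) \<le> e * real n" using M[OF n(1)] n(2) by (simp add: field_simps)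
    hence "exp (ln (w m)) \<le> exp (e * real n)" by simp
    hence "w m \<le> exp (e * real_of_int \<bar>m\<bar>)" using \<open>w m > 0\<close> n(3) by simp
    thus ?thesis by (simp add: qabs_eq power_mult_distrib)
  qed
  have "(\<lambda>m. (min (w m) (exp (e * real_of_int \<bar>m\<bar>)) * qabs m)\<^sup>2) summable_on - F"
    by (rule summable_on_subset[OF e(2)]) simp
  hence "(\<lambda>m. (w m)\<^sup>2 * (cmod (fourier_coeff q m))\<^sup>2) summable_on - F"
    by (rule summable_on_cong[THEN iffD1, OF eq, rotated])
  moreover have "(\<lambda>m. (w m)\<^sup>2 * (cmod (fourier_coeff q m))\<^sup>2) summable_on F" by (simp add: F_def)
  ultimately have "(\<lambda>m. (w m)\<^sup>2 * (cmod (fourier_coeff q m))\<^sup>2) summable_on (F \<union> - F)"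
    by (intro summable_on_union) auto
  thus "q \<in> H_weighted w" using assms(2) by (simp add: H_weighted_def)
next
  interpret hill_spectrum q lam by unfold_locales (fact assms)+
  assume w: "exponential_weight w"
  hence "liminf (\<lambda>n. ereal (ln (w (int n)) / real n)) > 0" by (simp add: exponential_weight_def)
  from ereal_dense2[OF this] obtain \<delta> where d: "\<delta> > 0"
    "ereal \<delta> < liminf (\<lambda>n. ereal (ln (w (int n)) / real n))" by auto
  from less_LiminfD[OF d(2)] obtain n1 where n1: "\<And>n. n \<ge> n1 \<Longrightarrow> \<delta> < ln (w (int n)) / real n"
    by (auto simp: eventually_sequentially)
  have w1: "w m \<ge> 1" for m using assms(1) by (simp add: normalized_weight_def)
  \<comment> \<open>An exponential weight has no monotone quotient in general, so it is replaced by
    a pure exponential with a rate below the liminf. The factor \<open>exp (\<delta> * n1)\<close>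
    in \<open>uw\<close> covers the arguments before \<open>n1\<close>.\<close>
  define u where "u m = exp (\<delta> * real_of_int \<bar>m\<bar>)" for m :: int
  have u: "rate_decreasing_weight u 1" using d(1) by (auto simp: rate_decreasing_weight_def u_def)
  have uw: "u (int n) \<le> exp (\<delta> * real n1) * w (int n)" for n
  proof (cases "n \<ge> n1 \<and> n > 0")
    case True
    hence "\<delta> * real n \<le> ln (w (int n))" using n1[of n] by (simp add: field_simps)
    hence "u (int n) \<le> exp (ln (w (int n)))" by (simp add: u_def)
    also have "\<dots> = 1 * w (int n)" using w1[of "int n"] by simp
    also have "\<dots> \<le> exp (\<delta> * real n1) * w (int n)" using d(1) w1[of "int n"] by (intro mult_right_mono) auto
    finally show ?thesis .
  next
    case False
    hence "u (int n) \<le> exp (\<delta> * real n1) * 1" using d(1) by (auto simp: u_def)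
    also have "\<dots> \<le> exp (\<delta> * real n1) * w (int n)" by (intro mult_left_mono w1) auto
    finally show ?thesis .
  qed
  have gaps: "(\<lambda>n. (u (int n))\<^sup>2 * \<bar>gap_length lam n\<bar>\<^sup>2) summable_on {1..}"
  proof (rule summable_on_comparison_test)
    show "(\<lambda>n. (exp (\<delta> * real n1))\<^sup>2 * ((w (int n))\<^sup>2 * \<bar>gap_length lam n\<bar>\<^sup>2)) summable_on {1..}"
      by (rule summable_on_cmult_right[OF assms(5)])
    fix n
    have "(u (int n))\<^sup>2 \<le> (exp (\<delta> * real n1) * w (int n))\<^sup>2" by (rule power_mono[OF uw]) (simp add: u_def)
    thus "(u (int n))\<^sup>2 * \<bar>gap_length lam n\<bar>\<^sup>2 \<le> (exp (\<delta> * real n1))\<^sup>2 * ((w (int n))\<^sup>2 * \<bar>gap_length lam n\<bar>\<^sup>2)"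
      using mult_right_mono[of _ _ "\<bar>gap_length lam n\<bar>\<^sup>2"] by (fastforce simp: power_mult_distrib mult.assoc)
  qed auto
  obtain e where e: "e > 0" "(\<lambda>m. (min (u m) (exp (e * real_of_int \<bar>m\<bar>)) * qabs m)\<^sup>2) summable_on UNIV"
    using gaps_imp_regularity[OF u gaps] by blast
  have "min (u m) (exp (e * real_of_int \<bar>m\<bar>)) = exp (min \<delta> e * real_of_int \<bar>m\<bar>)" for m
    by (cases "m = 0") (auto simp: u_def min_def)
  hence "(\<lambda>m. (exp (min \<delta> e * real_of_int \<bar>m\<bar>) * qabs m)\<^sup>2) summable_on UNIV" using e(2) by simp
  thus "\<exists>g. real_analytic_circle g \<and> (AE x in lebesgue. q x = g x)"
    by (rule exponential_decay_imp_analytic[rotated]) (use d(1) e(1) in simp)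
qed

end
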